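(* Let $A$ be the quantum exterior algebra in $2$ generators over $k$. Then there exists a two-dimensional indecomposable $A$-module $M$ (namely $M=A(x+y)$) whose $\mho$-component is of type $\mathbb Z$. Thus $\operatorname{Ext}^i_A(M,M)=0$ for all $i\ge2$, whereas $\operatorname{Ext}^1_A(M,M)\ne0$.
   Context: Let $k$ be a field containing an element $q\in k^*=k\setminus\{0\}$ of infinite multiplicative order. The quantum exterior algebra in two generators is the $k$-algebra $A$ generated by $x,y$ with relations $x^2,\ y^2,\ xy+qyx$; it has $k$-basis $1,x,y,yx$. Modules are left $A$-modules of finite length; $\Omega Z$ is the kernel of a projective cover of $Z$. The $\mho$-quiver of $A$ has as vertices the isomorphism classes $[X]$ of indecomposable non-projective modules $X$, with an arrow $[Z]\to[X]$ if and only if $X\cong\Omega Z$ and $\operatorname{Ext}^1_A(Z,A)=0$. Its connected components are called $\mho$-components; the $\mho$-component of $M$ is the one containing $[M]$. An $\mho$-component is of type $\mathbb Z$ if it is isomorphic to the quiver with vertex set $\mathbb Z$ and precisely one arrow $z\to z-1$ for every $z\in\mathbb Z$ (and no other arrows). *)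

theory Defs
  imports "HOL-Algebra.Module" "HOL-Algebra.QuotRing" "HOL-Algebra.Embedded_Algebras"
    "Graph_Theory.Graph_Theory"
begin

section \<open>Left modules of finite length\<close>

text \<open>The library locale \<^locale>\<open>module\<close> requires a commutative ring; here the ring is
  arbitrary. The library notion \<^locale>\<open>submodule\<close> does not mention commutativity and is reused.\<close>

locale left_module = R?: ring R + M?: abelian_group M
  for R :: "('r, 'a) ring_scheme" (structure) and M :: "('r, 'm, 'c) module_scheme" (structure) +
  assumes smult_closed [simp, intro]:
      "\<lbrakk>a \<in> carrier R; x \<in> carrier M\<rbrakk> \<Longrightarrow> a \<odot>\<^bsub>M\<^esub> x \<in> carrier M"
    and smult_l_distr:
      "\<lbrakk>a \<in> carrier R; b \<in> carrier R; x \<in> carrier M\<rbrakk> \<Longrightarrow>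
        (a \<oplus> b) \<odot>\<^bsub>M\<^esub> x = a \<odot>\<^bsub>M\<^esub> x \<oplus>\<^bsub>M\<^esub> b \<odot>\<^bsub>M\<^esub> x"
    and smult_r_distr:
      "\<lbrakk>a \<in> carrier R; x \<in> carrier M; y \<in> carrier M\<rbrakk> \<Longrightarrow>
        a \<odot>\<^bsub>M\<^esub> (x \<oplus>\<^bsub>M\<^esub> y) = a \<odot>\<^bsub>M\<^esub> x \<oplus>\<^bsub>M\<^esub> a \<odot>\<^bsub>M\<^esub> y"
    and smult_assoc1:
      "\<lbrakk>a \<in> carrier R; b \<in> carrier R; x \<in> carrier M\<rbrakk> \<Longrightarrow>
        (a \<otimes> b) \<odot>\<^bsub>M\<^esub> x = a \<odot>\<^bsub>M\<^esub> (b \<odot>\<^bsub>M\<^esub> x)"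
    and smult_one [simp]:
      "x \<in> carrier M \<Longrightarrow> \<one> \<odot>\<^bsub>M\<^esub> x = x"

definition composition_series ::
    "('r, 'a) ring_scheme \<Rightarrow> ('r, 'm, 'c) module_scheme \<Rightarrow> nat \<Rightarrow> (nat \<Rightarrow> 'm set) \<Rightarrow> bool" where
  "composition_series R M n U \<longleftrightarrow>
     U 0 = {\<zero>\<^bsub>M\<^esub>} \<and> U n = carrier M \<and> (\<forall>i\<le>n. submodule (U i) R M) \<and>
     (\<forall>i<n. U i \<subset> U (Suc i) \<and>
        (\<forall>V. submodule V R M \<and> U i \<subseteq> V \<and> V \<subseteq> U (Suc i) \<longrightarrow> V = U i \<or> V = U (Suc i)))"

definition fl_module :: "('r, 'a) ring_scheme \<Rightarrow> ('r, 'm, 'c) module_scheme \<Rightarrow> bool" where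
  "fl_module R M \<longleftrightarrow> left_module R M \<and> (\<exists>n U. composition_series R M n U)"

text \<open>Homomorphisms are extensional functions, so that equality of homomorphisms is
  equality of functions.\<close>

definition lmod_hom ::
    "('r, 'a) ring_scheme \<Rightarrow> ('r, 'm, 'c) module_scheme \<Rightarrow> ('r, 'n, 'd) module_scheme \<Rightarrow> ('m \<Rightarrow> 'n) set" where
  "lmod_hom R M N = {f \<in> carrier M \<rightarrow>\<^sub>E carrier N.
     (\<forall>x\<in>carrier M. \<forall>y\<in>carrier M. f (x \<oplus>\<^bsub>M\<^esub> y) = f x \<oplus>\<^bsub>N\<^esub> f y) \<and>
     (\<forall>a\<in>carrier R. \<forall>x\<in>carrier M. f (a \<odot>\<^bsub>M\<^esub> x) = a \<odot>\<^bsub>N\<^esub> f x)}"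

definition lmod_iso ::
    "('r, 'a) ring_scheme \<Rightarrow> ('r, 'm, 'c) module_scheme \<Rightarrow> ('r, 'n, 'd) module_scheme \<Rightarrow> bool" where
  "lmod_iso R M N \<longleftrightarrow> (\<exists>f\<in>lmod_hom R M N. bij_betw f (carrier M) (carrier N))"

definition lmod_kernel ::
    "('r, 'm, 'c) module_scheme \<Rightarrow> ('r, 'n, 'd) module_scheme \<Rightarrow> ('m \<Rightarrow> 'n) \<Rightarrow> 'm set" where
  "lmod_kernel M N f = {x \<in> carrier M. f x = \<zero>\<^bsub>N\<^esub>}"

definition indecomposable :: "('r, 'a) ring_scheme \<Rightarrow> ('r, 'm, 'c) module_scheme \<Rightarrow> bool" where
  "indecomposable R M \<longleftrightarrow> fl_module R M \<and> carrier M \<noteq> {\<zero>\<^bsub>M\<^esub>} \<and>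
     (\<forall>U V. submodule U R M \<and> submodule V R M \<and> U \<inter> V = {\<zero>\<^bsub>M\<^esub>} \<and> U <+>\<^bsub>M\<^esub> V = carrier M \<longrightarrow>
        U = {\<zero>\<^bsub>M\<^esub>} \<or> V = {\<zero>\<^bsub>M\<^esub>})"

lemma submodule_extend:
  assumes "left_module R M" "submodule U R M" "v \<in> carrier M"
  shows "submodule {u \<oplus>\<^bsub>M\<^esub> a \<odot>\<^bsub>M\<^esub> v | u a. u \<in> U \<and> a \<in> carrier R} R M" (is "submodule ?V R M")
proof -
  interpret left_module R M by fact
  interpret U: submodule U R M by fact
  have sub: "U \<subseteq> carrier M" using U.subset by simp
  have U0: "\<zero>\<^bsub>M\<^esub> \<in> U" using U.one_closed by simp
  have Uadd: "x \<oplus>\<^bsub>M\<^esub> y \<in> U" if "x \<in> U" "y \<in> U" for x y using U.m_closed[OF that] by simp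
  have Uinv: "\<ominus>\<^bsub>M\<^esub> x \<in> U" if "x \<in> U" for x using U.m_inv_closed[OF that] by (simp add: a_inv_def)
  have neg: "(\<ominus>\<^bsub>R\<^esub> a) \<odot>\<^bsub>M\<^esub> v = \<ominus>\<^bsub>M\<^esub> (a \<odot>\<^bsub>M\<^esub> v)" if a: "a \<in> carrier R" for a
  proof -
    have z: "\<zero>\<^bsub>R\<^esub> \<odot>\<^bsub>M\<^esub> v = \<zero>\<^bsub>M\<^esub>"
      using smult_l_distr[of "\<zero>\<^bsub>R\<^esub>" "\<zero>\<^bsub>R\<^esub>" v] assms(3)
      by (metis M.add.l_cancel_one' R.l_zero R.zero_closed smult_closed)
    have "(\<ominus>\<^bsub>R\<^esub> a) \<odot>\<^bsub>M\<^esub> v \<oplus>\<^bsub>M\<^esub> a \<odot>\<^bsub>M\<^esub> v = \<zero>\<^bsub>M\<^esub>"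
      using smult_l_distr[of "\<ominus>\<^bsub>R\<^esub> a" a v] a assms(3) z by (simp add: R.l_neg)
    then show ?thesis using a assms(3) by (simp add: M.minus_equality)
  qed
  show ?thesis
  proof (intro submodule.intro subgroup.intro submodule_axioms.intro)
    show "?V \<subseteq> carrier (add_monoid M)" using sub assms(3) by auto
    show "\<one>\<^bsub>add_monoid M\<^esub> \<in> ?V"
    proof -
      have "\<zero>\<^bsub>R\<^esub> \<odot>\<^bsub>M\<^esub> v = \<zero>\<^bsub>M\<^esub>"
        using smult_l_distr[of "\<zero>\<^bsub>R\<^esub>" "\<zero>\<^bsub>R\<^esub>" v] assms(3)
        by (metis M.add.l_cancel_one' R.l_zero R.zero_closed smult_closed)
      then show ?thesis using U0 by force
    qed
    fix x assume "x \<in> ?V"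
    then obtain u a where x: "x = u \<oplus>\<^bsub>M\<^esub> a \<odot>\<^bsub>M\<^esub> v" "u \<in> U" "a \<in> carrier R" by blast
    have uc: "u \<in> carrier M" using x sub by auto
    {
      fix y assume "y \<in> ?V"
      then obtain t b where y: "y = t \<oplus>\<^bsub>M\<^esub> b \<odot>\<^bsub>M\<^esub> v" "t \<in> U" "b \<in> carrier R" by blast
      have tc: "t \<in> carrier M" using y sub by auto
      have "x \<oplus>\<^bsub>M\<^esub> y = (u \<oplus>\<^bsub>M\<^esub> t) \<oplus>\<^bsub>M\<^esub> (a \<oplus>\<^bsub>R\<^esub> b) \<odot>\<^bsub>M\<^esub> v"
        using x y uc tc assms(3) by (simp add: smult_l_distr M.a_ac)
      then show "x \<otimes>\<^bsub>add_monoid M\<^esub> y \<in> ?V" using x y Uadd by auto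
    }
    have "\<ominus>\<^bsub>M\<^esub> x = (\<ominus>\<^bsub>M\<^esub> u) \<oplus>\<^bsub>M\<^esub> (\<ominus>\<^bsub>R\<^esub> a) \<odot>\<^bsub>M\<^esub> v"
      using x uc assms(3) by (simp add: neg M.minus_add)
    then show "inv\<^bsub>add_monoid M\<^esub> x \<in> ?V"
      using x Uinv by (auto simp: a_inv_def[symmetric] intro!: exI)
    fix c assume c: "c \<in> carrier R"
    have "c \<odot>\<^bsub>M\<^esub> x = c \<odot>\<^bsub>M\<^esub> u \<oplus>\<^bsub>M\<^esub> (c \<otimes>\<^bsub>R\<^esub> a) \<odot>\<^bsub>M\<^esub> v"
      using x uc c assms(3) by (simp add: smult_r_distr smult_assoc1)
    then show "c \<odot>\<^bsub>M\<^esub> x \<in> ?V" using x c U.smult_closed by auto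
  qed
qed

lemma composition_series_inj:
  fixes R :: "('r, 'a) ring_scheme" and M :: "('r, 'm, 'c) module_scheme"
  assumes "left_module R M" and cs: "composition_series R M n U" and inf: "infinite (UNIV :: 'r set)"
  shows "i \<le> n \<Longrightarrow> \<exists>f :: 'm \<Rightarrow> 'r. inj_on f (U i)"
proof (induction i)
  case 0
  then show ?case using cs by (auto simp: composition_series_def)
next
  case (Suc i)
  interpret left_module R M by fact
  from Suc obtain f :: "'m \<Rightarrow> 'r" where f: "inj_on f (U i)" by auto
  have sub: "submodule (U i) R M" "submodule (U (Suc i)) R M"
    and ss: "U i \<subset> U (Suc i)"
    and mx: "\<And>V. submodule V R M \<Longrightarrow> U i \<subseteq> V \<Longrightarrow> V \<subseteq> U (Suc i) \<Longrightarrow> V = U i \<or> V = U (Suc i)"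
    using cs Suc.prems by (auto simp: composition_series_def)
  interpret S: submodule "U (Suc i)" R M by (fact sub)
  interpret T: submodule "U i" R M by (fact sub)
  from ss obtain v where v: "v \<in> U (Suc i)" "v \<notin> U i" by blast
  have Sc: "U (Suc i) \<subseteq> carrier M" using S.subset by simp
  have vc: "v \<in> carrier M" using v Sc by auto
  let ?V = "{u \<oplus>\<^bsub>M\<^esub> a \<odot>\<^bsub>M\<^esub> v | u a. u \<in> U i \<and> a \<in> carrier R}"
  have z: "\<zero>\<^bsub>R\<^esub> \<odot>\<^bsub>M\<^esub> v = \<zero>\<^bsub>M\<^esub>"
    using smult_l_distr[of "\<zero>\<^bsub>R\<^esub>" "\<zero>\<^bsub>R\<^esub>" v] vc
    by (metis M.add.l_cancel_one' R.l_zero R.zero_closed smult_closed)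
  have "U i \<subseteq> ?V"
  proof
    fix u assume u: "u \<in> U i"
    then have "u = u \<oplus>\<^bsub>M\<^esub> \<zero>\<^bsub>R\<^esub> \<odot>\<^bsub>M\<^esub> v" using z ss Sc by auto
    then show "u \<in> ?V" using u by blast
  qed
  moreover have "v \<in> ?V"
  proof -
    have "v = \<zero>\<^bsub>M\<^esub> \<oplus>\<^bsub>M\<^esub> \<one>\<^bsub>R\<^esub> \<odot>\<^bsub>M\<^esub> v" using vc by simp
    moreover have "\<zero>\<^bsub>M\<^esub> \<in> U i" using T.one_closed by simp
    ultimately show ?thesis by blast
  qed
  moreover have "?V \<subseteq> U (Suc i)"
    using ss v S.smult_closed S.m_closed by auto
  ultimately have V: "U (Suc i) = ?V"
    using mx[OF submodule_extend[OF assms(1) sub(1) vc]] v by blast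
  then have "\<forall>w\<in>U (Suc i). \<exists>u a. w = u \<oplus>\<^bsub>M\<^esub> a \<odot>\<^bsub>M\<^esub> v \<and> u \<in> U i" by blast
  then obtain g h where gh: "\<And>w. w \<in> U (Suc i) \<Longrightarrow> w = g w \<oplus>\<^bsub>M\<^esub> h w \<odot>\<^bsub>M\<^esub> v \<and> g w \<in> U i" by metis
  have "\<exists>p :: 'r \<times> 'r \<Rightarrow> 'r. inj p"
    using card_of_Times_same_infinite[OF inf] by (metis bij_betw_imp_inj_on card_of_ordIso UNIV_Times_UNIV)
  then obtain p :: "'r \<times> 'r \<Rightarrow> 'r" where p: "inj p" by blast
  have "inj_on (\<lambda>w. p (f (g w), h w)) (U (Suc i))"
  proof (rule inj_onI)
    fix w w' assume w: "w \<in> U (Suc i)" "w' \<in> U (Suc i)" "p (f (g w), h w) = p (f (g w'), h w')"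
    then have "f (g w) = f (g w')" "h w = h w'" using p by (auto dest: injD)
    then show "w = w'" using gh[OF w(1)] gh[OF w(2)] f by (metis inj_onD)
  qed
  then show ?case by blast
qed

text \<open>Every module of finite length over a ring with infinite element type \<open>'r\<close> has an
  isomorphic copy whose elements are of type \<open>'r\<close>.\<close>

lemma fl_module_copy:
  fixes R :: "('r, 'a) ring_scheme" and M :: "('r, 'm, 'c) module_scheme"
  assumes "fl_module R M" and inf: "infinite (UNIV :: 'r set)"
  shows "\<exists>N :: ('r, 'r) module. fl_module R N \<and> lmod_iso R M N"
proof -
  from assms obtain n U where lm: "left_module R M" and cs: "composition_series R M n U"
    by (auto simp: fl_module_def)
  interpret left_module R M by (fact lm)
  from composition_series_inj[OF lm cs inf, of n] cs
  obtain e :: "'m \<Rightarrow> 'r" where e: "inj_on e (carrier M)"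
    by (auto simp: composition_series_def)
  define r where "r = the_inv_into (carrier M) e"
  have re [simp]: "r (e x) = x" if "x \<in> carrier M" for x
    using that e by (simp add: r_def the_inv_into_f_f)
  define N :: "('r, 'r) module" where
    "N = \<lparr>carrier = e ` carrier M, monoid.mult = undefined, one = undefined, zero = e \<zero>\<^bsub>M\<^esub>,
       add = (\<lambda>x y. e (r x \<oplus>\<^bsub>M\<^esub> r y)), smult = (\<lambda>a x. e (a \<odot>\<^bsub>M\<^esub> r x))\<rparr>"
  have N [simp]: "carrier N = e ` carrier M" "\<zero>\<^bsub>N\<^esub> = e \<zero>\<^bsub>M\<^esub>"
    "\<And>x y. x \<oplus>\<^bsub>N\<^esub> y = e (r x \<oplus>\<^bsub>M\<^esub> r y)" "\<And>a x. a \<odot>\<^bsub>N\<^esub> x = e (a \<odot>\<^bsub>M\<^esub> r x)"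
    by (simp_all add: N_def)
  have "abelian_group N"
  proof (rule abelian_groupI)
    fix x assume "x \<in> carrier N"
    then obtain u where "x = e u" "u \<in> carrier M" by auto
    then show "\<exists>y\<in>carrier N. y \<oplus>\<^bsub>N\<^esub> x = \<zero>\<^bsub>N\<^esub>"
      by (intro bexI[of _ "e (\<ominus>\<^bsub>M\<^esub> u)"]) (auto simp: M.l_neg)
  qed (auto simp: M.a_ac)
  then interpret N: abelian_group N .
  have lN: "left_module R N"
    by unfold_locales (auto simp: smult_l_distr smult_r_distr smult_assoc1)
  interpret LN: left_module R N by (fact lN)
  have sub_image: "submodule (e ` V) R N" if "submodule V R M" for V
  proof -
    interpret V: submodule V R M by (fact that)
    have Vc: "V \<subseteq> carrier M" using V.subset by simp
    have inv: "\<ominus>\<^bsub>N\<^esub> (e x) = e (\<ominus>\<^bsub>M\<^esub> x)" if "x \<in> carrier M" for x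
      by (rule N.minus_equality) (use that in \<open>auto simp: M.l_neg\<close>)
    show ?thesis
    proof (intro submodule.intro subgroup.intro submodule_axioms.intro)
      show "e ` V \<subseteq> carrier (add_monoid N)" using Vc by auto
      show "\<one>\<^bsub>add_monoid N\<^esub> \<in> e ` V" using V.one_closed by auto
      fix x assume x: "x \<in> e ` V"
      then obtain u where u: "x = e u" "u \<in> V" by auto
      show "x \<otimes>\<^bsub>add_monoid N\<^esub> y \<in> e ` V" if "y \<in> e ` V" for y
        using u that Vc V.m_closed by (auto simp: subset_iff)
      show "inv\<^bsub>add_monoid N\<^esub> x \<in> e ` V"
        using u Vc V.m_inv_closed[of u] inv[of u] by (auto simp: a_inv_def)
      show "a \<odot>\<^bsub>N\<^esub> x \<in> e ` V" if "a \<in> carrier R" for a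
        using u that Vc by auto
    qed
  qed
  have sub_pre: "\<exists>W. submodule W R M \<and> V = e ` W" if "submodule V R N" for V
  proof -
    interpret V: submodule V R N by (fact that)
    have Vc: "V \<subseteq> e ` carrier M" using V.subset by simp
    let ?W = "{x \<in> carrier M. e x \<in> V}"
    have inv: "\<ominus>\<^bsub>N\<^esub> (e x) = e (\<ominus>\<^bsub>M\<^esub> x)" if "x \<in> carrier M" for x
      by (rule N.minus_equality) (use that in \<open>auto simp: M.l_neg\<close>)
    have "submodule ?W R M"
    proof (intro submodule.intro subgroup.intro submodule_axioms.intro)
      show "?W \<subseteq> carrier (add_monoid M)" by auto
      show "\<one>\<^bsub>add_monoid M\<^esub> \<in> ?W" using V.one_closed by auto
      fix x assume x: "x \<in> ?W"
      show "x \<otimes>\<^bsub>add_monoid M\<^esub> y \<in> ?W" if "y \<in> ?W" for y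
        using x that V.m_closed[of "e x" "e y"] by auto
      have "\<ominus>\<^bsub>N\<^esub> (e x) \<in> V" using x V.m_inv_closed[of "e x"] unfolding a_inv_def by simp
      then show "inv\<^bsub>add_monoid M\<^esub> x \<in> ?W"
        using x inv[of x] by (simp flip: a_inv_def)
      show "a \<odot>\<^bsub>M\<^esub> x \<in> ?W" if "a \<in> carrier R" for a
        using x that V.smult_closed[of a "e x"] by auto
    qed
    moreover have "V = e ` ?W" using Vc by auto
    ultimately show ?thesis by blast
  qed
  have Uc: "U i \<subseteq> carrier M" if "i \<le> n" for i
    using cs that submodule.axioms(1) subgroup.subset
    by (fastforce simp: composition_series_def)
  have img: "e ` A = e ` B \<longleftrightarrow> A = B" "e ` A \<subseteq> e ` B \<longleftrightarrow> A \<subseteq> B"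
    if "A \<subseteq> carrier M" "B \<subseteq> carrier M" for A B
  proof -
    show "e ` A = e ` B \<longleftrightarrow> A = B" using that e by (simp add: inj_on_image_eq_iff)
    have "e x \<in> e ` B \<longleftrightarrow> x \<in> B" if "x \<in> A" for x
      using that \<open>A \<subseteq> carrier M\<close> \<open>B \<subseteq> carrier M\<close> e by (intro inj_on_image_mem_iff) auto
    then show "e ` A \<subseteq> e ` B \<longleftrightarrow> A \<subseteq> B"
      unfolding image_subset_iff subset_eq[of A B] by simp
  qed
  have "composition_series R N n (\<lambda>i. e ` U i)"
    unfolding composition_series_def
  proof (intro conjI allI impI)
    show "e ` U 0 = {\<zero>\<^bsub>N\<^esub>}" "e ` U n = carrier N"
      using cs by (auto simp: composition_series_def)
    show "submodule (e ` U i) R N" if "i \<le> n" for i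
      using cs that by (intro sub_image) (auto simp: composition_series_def)
    fix i assume i: "i < n"
    then have le: "i \<le> n" "Suc i \<le> n" by auto
    show "e ` U i \<subset> e ` U (Suc i)"
      using cs i img[OF Uc[OF le(1)] Uc[OF le(2)]] by (auto simp: composition_series_def psubset_eq)
    fix V assume V: "submodule V R N \<and> e ` U i \<subseteq> V \<and> V \<subseteq> e ` U (Suc i)"
    then have "submodule V R N" ..
    from sub_pre[OF this] obtain W where W: "submodule W R M" "V = e ` W" by (elim exE conjE)
    have Wc: "W \<subseteq> carrier M"
      using subgroup.subset[OF submodule.axioms(1)[OF W(1)]] by simp
    have "U i \<subseteq> W"
      using V unfolding W(2) img(2)[OF Uc[OF le(1)] Wc] by blast
    moreover have "W \<subseteq> U (Suc i)"
      using V unfolding W(2) img(2)[OF Wc Uc[OF le(2)]] by blast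
    moreover have "\<forall>V. submodule V R M \<and> U i \<subseteq> V \<and> V \<subseteq> U (Suc i) \<longrightarrow> V = U i \<or> V = U (Suc i)"
      using cs i unfolding composition_series_def by blast
    ultimately have "W = U i \<or> W = U (Suc i)" using W(1) by blast
    then show "V = e ` U i \<or> V = e ` U (Suc i)" unfolding W(2) by blast
  qed
  then have "fl_module R N" using lN by (auto simp: fl_module_def)
  moreover have "lmod_iso R M N"
    unfolding lmod_iso_def
  proof (rule bexI)
    show "bij_betw (\<lambda>x\<in>carrier M. e x) (carrier M) (carrier N)"
      using e by (auto simp: bij_betw_def inj_on_def)
    show "(\<lambda>x\<in>carrier M. e x) \<in> lmod_hom R M N"
      by (auto simp: lmod_hom_def)
  qed
  ultimately show ?thesis by blast
qed


section \<open>Projective covers, syzygies and Ext\<close>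

text \<open>Quantification over modules is quantification over modules whose elements are taken
  from one fixed type. Nothing is lost as soon as every module of finite length has an
  isomorphic copy in that type. By \<open>fl_module_copy\<close> this holds for the type of the elements
  of the ring itself, provided that type is infinite.\<close>

definition projective :: "('r, 'a) ring_scheme \<Rightarrow> ('r, 'm) module \<Rightarrow> bool" where
  "projective R P \<longleftrightarrow> fl_module R P \<and>
     (\<forall>(M :: ('r, 'm) module) (N :: ('r, 'm) module) g f.
        fl_module R M \<and> fl_module R N \<and>
        g \<in> lmod_hom R M N \<and> g ` carrier M = carrier N \<and> f \<in> lmod_hom R P N \<longrightarrow>
        (\<exists>h\<in>lmod_hom R P M. \<forall>x\<in>carrier P. g (h x) = f x))"

definition projective_cover ::
    "('r, 'a) ring_scheme \<Rightarrow> ('r, 'm) module \<Rightarrow> ('r, 'm) module \<Rightarrow> ('m \<Rightarrow> 'm) \<Rightarrow> bool" where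
  "projective_cover R Z P p \<longleftrightarrow>
     projective R P \<and> p \<in> lmod_hom R P Z \<and> p ` carrier P = carrier Z \<and>
     (\<forall>U. submodule U R P \<and> U <+>\<^bsub>P\<^esub> lmod_kernel P Z p = carrier P \<longrightarrow> U = carrier P)"

text \<open>\<open>is_syzygy R Z X\<close> expresses that \<open>X\<close> is isomorphic to \<open>\<Omega> Z\<close>, which is only defined up to
  isomorphism.\<close>

definition is_syzygy :: "('r, 'a) ring_scheme \<Rightarrow> ('r, 'm) module \<Rightarrow> ('r, 'm) module \<Rightarrow> bool" where
  "is_syzygy R Z X \<longleftrightarrow>
     (\<exists>P p. projective_cover R Z P p \<and> lmod_iso R X (P\<lparr>carrier := lmod_kernel P Z p\<rparr>))"

text \<open>A projective resolution \<open>\<dots> \<rightarrow> P 1 \<rightarrow> P 0 \<rightarrow> M \<rightarrow> 0\<close>: the map \<open>d 0\<close> is the augmentation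
  \<open>P 0 \<rightarrow> M\<close>, and \<open>d (Suc i)\<close> is the differential \<open>P (Suc i) \<rightarrow> P i\<close>.\<close>

definition projective_resolution ::
    "('r, 'a) ring_scheme \<Rightarrow> ('r, 'm) module \<Rightarrow> (nat \<Rightarrow> ('r, 'm) module) \<Rightarrow> (nat \<Rightarrow> 'm \<Rightarrow> 'm) \<Rightarrow> bool" where
  "projective_resolution R M P d \<longleftrightarrow>
     (\<forall>i. projective R (P i)) \<and>
     d 0 \<in> lmod_hom R (P 0) M \<and> d 0 ` carrier (P 0) = carrier M \<and>
     (\<forall>i. d (Suc i) \<in> lmod_hom R (P (Suc i)) (P i)) \<and>
     d 1 ` carrier (P 1) = lmod_kernel (P 0) M (d 0) \<and>
     (\<forall>i. d (Suc (Suc i)) ` carrier (P (Suc (Suc i))) = lmod_kernel (P (Suc i)) (P i) (d (Suc i)))"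

definition Hom_group ::
    "('r, 'a) ring_scheme \<Rightarrow> ('r, 'm, 'c) module_scheme \<Rightarrow> ('r, 'n, 'd) module_scheme \<Rightarrow> ('m \<Rightarrow> 'n) monoid" where
  "Hom_group R M N = \<lparr>carrier = lmod_hom R M N,
     monoid.mult = (\<lambda>f g. \<lambda>x\<in>carrier M. f x \<oplus>\<^bsub>N\<^esub> g x),
     one = (\<lambda>x\<in>carrier M. \<zero>\<^bsub>N\<^esub>)\<rparr>"

definition cocycles ::
    "('r, 'a) ring_scheme \<Rightarrow> (nat \<Rightarrow> ('r, 'm) module) \<Rightarrow> (nat \<Rightarrow> 'm \<Rightarrow> 'm) \<Rightarrow>
      ('r, 'n, 'd) module_scheme \<Rightarrow> nat \<Rightarrow> ('m \<Rightarrow> 'n) set" where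
  "cocycles R P d N i =
     {f \<in> lmod_hom R (P i) N. \<forall>x\<in>carrier (P (Suc i)). f (d (Suc i) x) = \<zero>\<^bsub>N\<^esub>}"

fun coboundaries ::
    "('r, 'a) ring_scheme \<Rightarrow> (nat \<Rightarrow> ('r, 'm) module) \<Rightarrow> (nat \<Rightarrow> 'm \<Rightarrow> 'm) \<Rightarrow>
      ('r, 'n, 'd) module_scheme \<Rightarrow> nat \<Rightarrow> ('m \<Rightarrow> 'n) set" where
  "coboundaries R P d N 0 = {\<lambda>x\<in>carrier (P 0). \<zero>\<^bsub>N\<^esub>}"
| "coboundaries R P d N (Suc i) =
     (\<lambda>g. compose (carrier (P (Suc i))) g (d (Suc i))) ` lmod_hom R (P i) N"

text \<open>The group \<open>Ext\<^sup>i\<^sub>R(M,N)\<close>: the cohomology of \<open>Hom\<^sub>R(P, N)\<close> for some projective resolution \<open>P\<close>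
  of \<open>M\<close> by modules of finite length. Up to isomorphism it does not depend on the choice.\<close>

definition Ext ::
    "('r, 'a) ring_scheme \<Rightarrow> nat \<Rightarrow> ('r, 'm) module \<Rightarrow> ('r, 'n, 'd) module_scheme \<Rightarrow> ('m \<Rightarrow> 'n) set monoid" where
  "Ext R i M N =
     (let (P, d) = (SOME (P, d). projective_resolution R M P d)
      in (Hom_group R (P i) N)\<lparr>carrier := cocycles R P d N i\<rparr> Mod coboundaries R P d N i)"

abbreviation Ext_zero ::
    "('r, 'a) ring_scheme \<Rightarrow> nat \<Rightarrow> ('r, 'm) module \<Rightarrow> ('r, 'n, 'd) module_scheme \<Rightarrow> bool" where
  "Ext_zero R i M N \<equiv> carrier (Ext R i M N) = {\<one>\<^bsub>Ext R i M N\<^esub>}"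


section \<open>The \<open>\<mho>\<close>-quiver\<close>

definition regular_module :: "('r, 'a) ring_scheme \<Rightarrow> ('r, 'r) module" where
  "regular_module R = \<lparr>carrier = carrier R, monoid.mult = monoid.mult R, one = one R,
     zero = zero R, add = add R, smult = monoid.mult R\<rparr>"

definition principal_left_ideal :: "('r, 'a) ring_scheme \<Rightarrow> 'r \<Rightarrow> ('r, 'r) module" where
  "principal_left_ideal R r = (regular_module R)\<lparr>carrier := {a \<otimes>\<^bsub>R\<^esub> r | a. a \<in> carrier R}\<rparr>"

definition iso_class :: "('r, 'a) ring_scheme \<Rightarrow> ('r, 'm) module \<Rightarrow> ('r, 'm) module set" where
  "iso_class R X = {Y. left_module R Y \<and> lmod_iso R X Y}"

definition mho_quiver :: "('r, 'a) ring_scheme \<Rightarrow> ('r, 'm) module set pair_pre_digraph" where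
  "mho_quiver R = (let V = {X. indecomposable R X \<and> \<not> projective R X} in
     \<lparr>pverts = iso_class R ` V,
      parcs = {(iso_class R Z, iso_class R X) | Z X. Z \<in> V \<and> X \<in> V \<and>
                 is_syzygy R Z X \<and> Ext_zero R 1 Z (regular_module R)}\<rparr>)"

text \<open>Components are those of the underlying undirected graph, hence the symmetrization.\<close>

definition quiver_component :: "'v pair_pre_digraph \<Rightarrow> 'v \<Rightarrow> ('v, 'v \<times> 'v) pre_digraph" where
  "quiver_component Q v = with_proj Q \<restriction> {w. v \<rightarrow>\<^sup>*\<^bsub>with_proj (mk_symmetric (with_proj Q))\<^esub> w}"

definition mho_component ::
    "('r, 'a) ring_scheme \<Rightarrow> ('r, 'm) module \<Rightarrow> (('r, 'm) module set, ('r, 'm) module set \<times> ('r, 'm) module set) pre_digraph" where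
  "mho_component R M = quiver_component (mho_quiver R) (iso_class R M)"

definition Z_quiver :: "int pair_pre_digraph" where
  "Z_quiver = \<lparr>pverts = UNIV, parcs = {(z, z - 1) | z. True}\<rparr>"

definition type_Z :: "('v, 'e) pre_digraph \<Rightarrow> bool" where
  "type_Z C \<longleftrightarrow> digraph_iso C (with_proj Z_quiver)"


section \<open>The quantum exterior algebra in two generators\<close>

text \<open>The free associative algebra over the field \<open>'k\<close> on the set of generators \<open>'g\<close>: finitely
  supported functions on words, the value at a word being its coefficient.\<close>

definition free_algebra :: "('g list \<Rightarrow> 'k::field) ring" where
  "free_algebra = \<lparr>carrier = {f. finite {w. f w \<noteq> 0}},
     monoid.mult = (\<lambda>f g w. \<Sum>i\<le>length w. f (take i w) * g (drop i w)),
     one = (\<lambda>w. if w = [] then 1 else 0),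
     zero = (\<lambda>w. 0),
     add = (\<lambda>f g w. f w + g w)\<rparr>"

definition monomial :: "'k \<Rightarrow> 'g list \<Rightarrow> 'g list \<Rightarrow> 'k::field" where
  "monomial c w = (\<lambda>v. if v = w then c else 0)"

datatype gen = gen_x | gen_y

type_synonym 'k qext = "(gen list \<Rightarrow> 'k) set"

definition qext_relations :: "'k::field \<Rightarrow> (gen list \<Rightarrow> 'k) set" where
  "qext_relations q = {monomial 1 [gen_x, gen_x], monomial 1 [gen_y, gen_y],
     monomial 1 [gen_x, gen_y] \<oplus>\<^bsub>free_algebra\<^esub> monomial q [gen_y, gen_x]}"

definition qext_ideal :: "'k::field \<Rightarrow> (gen list \<Rightarrow> 'k) set" where
  "qext_ideal q = Idl\<^bsub>free_algebra\<^esub> (qext_relations q)"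

definition qext :: "'k::field \<Rightarrow> 'k qext ring" where
  "qext q = free_algebra Quot (qext_ideal q)"

definition qext_gen :: "'k::field \<Rightarrow> gen \<Rightarrow> 'k qext" where
  "qext_gen q g = qext_ideal q +>\<^bsub>free_algebra\<^esub> monomial 1 [g]"

text \<open>The image of the ground field in the algebra.\<close>

definition qext_scalars :: "'k::field \<Rightarrow> 'k qext set" where
  "qext_scalars q = range (\<lambda>c. qext_ideal q +>\<^bsub>free_algebra\<^esub> monomial c [])"

lemma infinite_UNIV_qext: "infinite (UNIV :: ('k::field) qext set)"
proof -
  have "inj (\<lambda>w. {monomial 1 w :: gen list \<Rightarrow> 'k})"
    by (rule injI) (metis monomial_def singleton_inject zero_neq_one)
  moreover have "infinite (UNIV :: gen list set)"
    by (simp add: infinite_UNIV_listI)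
  ultimately show ?thesis
    using finite_imageD finite_subset[OF subset_UNIV] by metis
qed

lemma ring_free_algebra: "ring (free_algebra :: ('g list \<Rightarrow> 'k::field) ring)"
proof -
  let ?F = "free_algebra :: ('g list \<Rightarrow> 'k) ring"
  have ab: "abelian_group ?F"
  proof (rule abelian_groupI)
    fix f g :: "'g list \<Rightarrow> 'k"
    assume "f \<in> carrier ?F" "g \<in> carrier ?F"
    then show "f \<oplus>\<^bsub>?F\<^esub> g \<in> carrier ?F"
      by (auto simp: free_algebra_def
          intro: finite_subset[of _ "{w. f w \<noteq> 0} \<union> {w. g w \<noteq> 0}"])
  next
    fix f :: "'g list \<Rightarrow> 'k"
    assume "f \<in> carrier ?F"
    then show "\<exists>g\<in>carrier ?F. g \<oplus>\<^bsub>?F\<^esub> f = \<zero>\<^bsub>?F\<^esub>"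
      by (intro bexI[of _ "\<lambda>w. - f w"]) (auto simp: free_algebra_def)
  qed (auto simp: free_algebra_def algebra_simps)
  have split0: "(\<Sum>i\<le>n. if i = 0 then F i else 0) = F 0" for F :: "nat \<Rightarrow> 'k" and n
    by (simp add: sum.delta)
  have mon: "monoid ?F"
  proof (rule monoidI)
    fix f g :: "'g list \<Rightarrow> 'k"
    assume fg: "f \<in> carrier ?F" "g \<in> carrier ?F"
    have "{w. (f \<otimes>\<^bsub>?F\<^esub> g) w \<noteq> 0} \<subseteq> (\<lambda>(u, v). u @ v) ` ({w. f w \<noteq> 0} \<times> {w. g w \<noteq> 0})"
    proof
      fix w assume "w \<in> {w. (f \<otimes>\<^bsub>?F\<^esub> g) w \<noteq> 0}"
      then have "(\<Sum>i\<le>length w. f (take i w) * g (drop i w)) \<noteq> 0"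
        by (simp add: free_algebra_def)
      then obtain i where "f (take i w) * g (drop i w) \<noteq> 0"
        by (meson sum.not_neutral_contains_not_neutral)
      then show "w \<in> (\<lambda>(u, v). u @ v) ` ({w. f w \<noteq> 0} \<times> {w. g w \<noteq> 0})"
        by (intro image_eqI[of _ _ "(take i w, drop i w)"]) auto
    qed
    then show "f \<otimes>\<^bsub>?F\<^esub> g \<in> carrier ?F"
      using fg finite_subset by (fastforce simp: free_algebra_def)
  next
    show "\<one>\<^bsub>?F\<^esub> \<in> carrier ?F" by (simp add: free_algebra_def)
  next
    fix f g h :: "'g list \<Rightarrow> 'k"
    show "f \<otimes>\<^bsub>?F\<^esub> g \<otimes>\<^bsub>?F\<^esub> h = f \<otimes>\<^bsub>?F\<^esub> (g \<otimes>\<^bsub>?F\<^esub> h)"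
    proof
      fix w
      let ?t = "\<lambda>i j. f (take i w) * g (take j (drop i w)) * h (drop (i + j) w)"
      have "(f \<otimes>\<^bsub>?F\<^esub> g \<otimes>\<^bsub>?F\<^esub> h) w
          = (\<Sum>j\<le>length w. \<Sum>i\<le>j. f (take i w) * g (drop i (take j w)) * h (drop j w))"
        by (auto simp: free_algebra_def sum_distrib_right min_def intro!: sum.cong)
      also have "\<dots> = (\<Sum>j\<le>length w. \<Sum>i\<le>j. ?t i (j - i))"
        by (auto simp: drop_take intro!: sum.cong)
      also have "\<dots> = (\<Sum>(i, j)\<in>{(i, j). i + j \<le> length w}. ?t i j)"
        by (simp add: sum.triangle_reindex_eq)
      also have "\<dots> = (\<Sum>(i, j)\<in>(SIGMA i:{..length w}. {..length w - i}). ?t i j)"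
        by (rule sum.cong) auto
      also have "\<dots> = (\<Sum>i\<le>length w. \<Sum>j\<le>length w - i. ?t i j)"
        by (simp add: sum.Sigma)
      also have "\<dots> = (f \<otimes>\<^bsub>?F\<^esub> (g \<otimes>\<^bsub>?F\<^esub> h)) w"
        by (auto simp: free_algebra_def sum_distrib_left mult.assoc add.commute intro!: sum.cong)
      finally show "(f \<otimes>\<^bsub>?F\<^esub> g \<otimes>\<^bsub>?F\<^esub> h) w = (f \<otimes>\<^bsub>?F\<^esub> (g \<otimes>\<^bsub>?F\<^esub> h)) w" .
    qed
  next
    fix f :: "'g list \<Rightarrow> 'k"
    show "\<one>\<^bsub>?F\<^esub> \<otimes>\<^bsub>?F\<^esub> f = f"
    proof
      fix w
      have "(\<one>\<^bsub>?F\<^esub> \<otimes>\<^bsub>?F\<^esub> f) w = (\<Sum>i\<le>length w. (if take i w = [] then 1 else 0) * f (drop i w))"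
        by (simp add: free_algebra_def del: take_eq_Nil take_eq_Nil2)
      also have "\<dots> = (\<Sum>i\<le>length w. if i = 0 then f (drop i w) else 0)"
        by (rule sum.cong) auto
      finally show "(\<one>\<^bsub>?F\<^esub> \<otimes>\<^bsub>?F\<^esub> f) w = f w" by (simp add: split0)
    qed
    show "f \<otimes>\<^bsub>?F\<^esub> \<one>\<^bsub>?F\<^esub> = f"
    proof
      fix w
      have "(f \<otimes>\<^bsub>?F\<^esub> \<one>\<^bsub>?F\<^esub>) w = (\<Sum>i\<le>length w. f (take i w) * (if drop i w = [] then 1 else 0))"
        by (simp add: free_algebra_def del: drop_eq_Nil drop_eq_Nil2)
      also have "\<dots> = (\<Sum>i\<le>length w. if i = length w then f (take i w) else 0)"
        by (rule sum.cong) auto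
      also have "\<dots> = f w" by (simp add: sum.delta)
      finally show "(f \<otimes>\<^bsub>?F\<^esub> \<one>\<^bsub>?F\<^esub>) w = f w" .
    qed
  qed
  show ?thesis
    by (rule ringI[OF ab mon])
      (simp_all add: free_algebra_def fun_eq_iff distrib_left distrib_right sum.distrib)
qed

lemma ring_qext: "ring (qext q)"
proof -
  have "qext_relations q \<subseteq> carrier free_algebra"
    by (auto simp: qext_relations_def free_algebra_def monomial_def
        intro: finite_subset[of _ "{[gen_x, gen_y], [gen_y, gen_x]}"])
  then have "ideal (qext_ideal q) free_algebra"
    unfolding qext_ideal_def by (rule ring.genideal_ideal[OF ring_free_algebra])
  then show ?thesis
    unfolding qext_def by (rule ideal.quotient_is_ring)
qed

end

theory Submission
  imports Defs
begin

text \<open>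
  Write \<open>I(\<alpha>) = A(x + \<alpha> y)\<close>, a module with basis \<open>x + \<alpha> y\<close>, \<open>y x\<close>. Everything rests on the relation
  \<open>(x + \<beta> y)(x + \<alpha> y) = (\<beta> - q \<alpha>) y x\<close> in \<open>A\<close>: it says that the left annihilator of \<open>x + \<alpha> y\<close> is
  \<open>I(q \<alpha>)\<close>. Hence right multiplication by \<open>x + \<alpha> y\<close> is a projective cover \<open>A \<rightarrow> I(\<alpha>)\<close> with kernel
  \<open>I(q \<alpha>)\<close>, and \<open>\<Omega> I(\<alpha>) = I(q \<alpha>)\<close>. The same relation shows that \<open>x + \<beta> y\<close> annihilates \<open>I(\<alpha>)\<close> only for
  \<open>\<beta> = q \<alpha>\<close>, so that different parameters give nonisomorphic modules; as \<open>q\<close> has infinite order, the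
  modules \<open>I(q\<^sup>z)\<close> with \<open>z\<close> an integer are pairwise nonisomorphic and form a copy of the quiver
  \<open>\<int>\<close>, provided that all the extension groups \<open>Ext\<^sup>1(I(\<alpha>), A)\<close> vanish and that no other arrows touch
  these vertices.

  The vanishing holds because \<open>A\<close> is a Frobenius algebra. Taking the coefficient of \<open>y x\<close> identifies
  the homomorphisms \<open>M \<rightarrow> A\<close> with the linear functionals on \<open>M\<close> (\<open>hom_of_functional\<close>). Functionals extend
  from subspaces (\<open>functional_extend\<close>), hence \<open>A\<close> is self-injective (\<open>regular_module_injective\<close>).

  For the arrows: an arrow that starts in \<open>I(\<alpha>)\<close> ends in \<open>I(q \<alpha>)\<close> since projective covers are unique
  (\<open>syzygy_of_I_unique\<close>). For an arrow from \<open>Z\<close> to \<open>I(q \<beta>)\<close>, let \<open>P \<rightarrow> Z\<close> be a projective cover with kernel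
  isomorphic to \<open>I(q \<beta>)\<close>. The embedding of \<open>I(q \<beta>)\<close> into \<open>P\<close> extends to a homomorphism \<open>A \<rightarrow> P\<close>
  (\<open>projective_annihilator\<close>). It is injective, because every nonzero left ideal of \<open>A\<close> contains \<open>y x\<close>,
  and it splits, because \<open>A\<close> is injective. As \<open>Z\<close> is indecomposable, the complement vanishes, so
  \<open>P\<close> is \<open>A\<close> and \<open>Z\<close> is \<open>A / I(q \<beta>)\<close>, that is \<open>I(\<beta>)\<close> (\<open>syzygy_I_preimage\<close>).

  For the self-extensions of \<open>M = I(1)\<close>, the exact sequence \<open>0 \<rightarrow> I(q \<gamma>) \<rightarrow> A \<rightarrow> I(\<gamma>) \<rightarrow> 0\<close> with injective
  middle term shifts degrees (\<open>cocycles_shift\<close>): \<open>Ext\<^sup>i\<^sup>+\<^sup>1(M, M)\<close> is \<open>Ext\<^sup>1(M, I(q\<^sup>-\<^sup>i))\<close>. By a direct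
  computation \<open>Ext\<^sup>1(I(\<alpha>), I(\<beta>))\<close> vanishes for \<open>\<beta>\<close> different from \<open>\<alpha>\<close> and from \<open>q \<alpha>\<close> (\<open>extend_from_I\<close>),
  whereas \<open>Ext\<^sup>1(I(\<alpha>), I(\<alpha>))\<close> does not (\<open>first_cocycles_self\<close>).
\<close>

section \<open>Homomorphisms of modules\<close>

lemma lmod_homD:
  assumes "f \<in> lmod_hom R M N"
  shows "\<And>x. x \<in> carrier M \<Longrightarrow> f x \<in> carrier N"
    and "\<And>x y. x \<in> carrier M \<Longrightarrow> y \<in> carrier M \<Longrightarrow> f (x \<oplus>\<^bsub>M\<^esub> y) = f x \<oplus>\<^bsub>N\<^esub> f y"
    and "\<And>a x. a \<in> carrier R \<Longrightarrow> x \<in> carrier M \<Longrightarrow> f (a \<odot>\<^bsub>M\<^esub> x) = a \<odot>\<^bsub>N\<^esub> f x"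
    and "f \<in> extensional (carrier M)"
  using assms by (auto simp: lmod_hom_def PiE_def)

lemma lmod_hom_restrictI:
  assumes "left_module R M"
    and "\<And>x. x \<in> carrier M \<Longrightarrow> f x \<in> carrier N"
    and "\<And>x y. x \<in> carrier M \<Longrightarrow> y \<in> carrier M \<Longrightarrow> f (x \<oplus>\<^bsub>M\<^esub> y) = f x \<oplus>\<^bsub>N\<^esub> f y"
    and "\<And>a x. a \<in> carrier R \<Longrightarrow> x \<in> carrier M \<Longrightarrow> f (a \<odot>\<^bsub>M\<^esub> x) = a \<odot>\<^bsub>N\<^esub> f x"
  shows "restrict f (carrier M) \<in> lmod_hom R M N"
proof -
  interpret left_module R M by fact
  show ?thesis using assms by (auto simp: lmod_hom_def)
qed

lemma (in left_module) smult_zero_left [simp]: "x \<in> carrier M \<Longrightarrow> \<zero>\<^bsub>R\<^esub> \<odot>\<^bsub>M\<^esub> x = \<zero>\<^bsub>M\<^esub>"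
  using smult_l_distr[of "\<zero>\<^bsub>R\<^esub>" "\<zero>\<^bsub>R\<^esub>" x]
  by (metis M.add.l_cancel_one' R.l_zero R.zero_closed smult_closed)

lemma (in left_module) smult_zero_right [simp]: "a \<in> carrier R \<Longrightarrow> a \<odot>\<^bsub>M\<^esub> \<zero>\<^bsub>M\<^esub> = \<zero>\<^bsub>M\<^esub>"
  using smult_r_distr[of a "\<zero>\<^bsub>M\<^esub>" "\<zero>\<^bsub>M\<^esub>"]
  by (metis M.add.l_cancel_one' M.l_zero M.zero_closed smult_closed)

lemma (in left_module) smult_minus_right:
  assumes "a \<in> carrier R" "x \<in> carrier M"
  shows "a \<odot>\<^bsub>M\<^esub> (\<ominus>\<^bsub>M\<^esub> x) = \<ominus>\<^bsub>M\<^esub> (a \<odot>\<^bsub>M\<^esub> x)"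
proof -
  have "a \<odot>\<^bsub>M\<^esub> (\<ominus>\<^bsub>M\<^esub> x) \<oplus>\<^bsub>M\<^esub> a \<odot>\<^bsub>M\<^esub> x = \<zero>\<^bsub>M\<^esub>"
    using assms smult_r_distr[of a "\<ominus>\<^bsub>M\<^esub> x" x] by (simp add: M.l_neg)
  then show ?thesis using assms by (simp add: M.minus_equality)
qed

lemma (in left_module) smult_uminus_one:
  assumes "x \<in> carrier M"
  shows "(\<ominus>\<^bsub>R\<^esub> \<one>\<^bsub>R\<^esub>) \<odot>\<^bsub>M\<^esub> x = \<ominus>\<^bsub>M\<^esub> x"
proof -
  have "(\<ominus>\<^bsub>R\<^esub> \<one>\<^bsub>R\<^esub>) \<odot>\<^bsub>M\<^esub> x \<oplus>\<^bsub>M\<^esub> x = \<zero>\<^bsub>M\<^esub>"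
    using assms smult_l_distr[of "\<ominus>\<^bsub>R\<^esub> \<one>\<^bsub>R\<^esub>" "\<one>\<^bsub>R\<^esub>" x] by (simp add: R.l_neg)
  then show ?thesis using assms by (simp add: M.minus_equality)
qed

lemma (in left_module) diff_eq_zero_iff:
  assumes "x \<in> carrier M" "y \<in> carrier M"
  shows "x \<ominus>\<^bsub>M\<^esub> y = \<zero>\<^bsub>M\<^esub> \<longleftrightarrow> x = y"
proof
  assume "x \<ominus>\<^bsub>M\<^esub> y = \<zero>\<^bsub>M\<^esub>"
  then have "x = \<ominus>\<^bsub>M\<^esub> (\<ominus>\<^bsub>M\<^esub> y)"
    using assms by (intro M.minus_equality[symmetric]) (auto simp: a_minus_def)
  then show "x = y" using assms by simp
qed (use assms in \<open>simp add: a_minus_def M.r_neg\<close>)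

lemma lmod_hom_zero:
  assumes "left_module R M" "left_module R N" "f \<in> lmod_hom R M N"
  shows "f \<zero>\<^bsub>M\<^esub> = \<zero>\<^bsub>N\<^esub>"
proof -
  interpret M: left_module R M by fact
  interpret N: left_module R N by fact
  note f = lmod_homD[OF assms(3)]
  have "f (\<zero>\<^bsub>R\<^esub> \<odot>\<^bsub>M\<^esub> \<zero>\<^bsub>M\<^esub>) = \<zero>\<^bsub>R\<^esub> \<odot>\<^bsub>N\<^esub> f \<zero>\<^bsub>M\<^esub>" by (rule f(3)) auto
  then show ?thesis using f(1)[of "\<zero>\<^bsub>M\<^esub>"] by simp
qed

lemma lmod_hom_uminus:
  assumes "left_module R M" "left_module R N" "f \<in> lmod_hom R M N" "x \<in> carrier M"
  shows "f (\<ominus>\<^bsub>M\<^esub> x) = \<ominus>\<^bsub>N\<^esub> f x"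
proof -
  interpret M: left_module R M by fact
  interpret N: left_module R N by fact
  note f = lmod_homD[OF assms(3)]
  show ?thesis
    using f(3)[of "\<ominus>\<^bsub>R\<^esub> \<one>\<^bsub>R\<^esub>" x] f(1)[OF assms(4)] assms(4)
    by (simp add: M.smult_uminus_one N.smult_uminus_one)
qed

lemma lmod_hom_minus:
  assumes "left_module R M" "left_module R N" "f \<in> lmod_hom R M N" "x \<in> carrier M" "y \<in> carrier M"
  shows "f (x \<ominus>\<^bsub>M\<^esub> y) = f x \<ominus>\<^bsub>N\<^esub> f y"
proof -
  interpret M: left_module R M by fact
  show ?thesis
    using assms lmod_homD[OF assms(3)] lmod_hom_uminus[OF assms(1,2,3,5)]
    by (simp add: a_minus_def)
qed

lemma lmod_hom_compose:
  assumes "left_module R M" "f \<in> lmod_hom R M N" "g \<in> lmod_hom R N L"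
  shows "compose (carrier M) g f \<in> lmod_hom R M L"
  unfolding compose_def
  by (rule lmod_hom_restrictI[OF assms(1)]) (simp_all add: lmod_homD[OF assms(2)] lmod_homD[OF assms(3)])

lemma lmod_hom_add:
  assumes "left_module R M" "left_module R N" "f \<in> lmod_hom R M N" "g \<in> lmod_hom R M N"
  shows "(\<lambda>x\<in>carrier M. f x \<oplus>\<^bsub>N\<^esub> g x) \<in> lmod_hom R M N"
proof (rule lmod_hom_restrictI[OF assms(1)])
  interpret N: left_module R N by fact
  note f = lmod_homD[OF assms(3)] and g = lmod_homD[OF assms(4)]
  fix x assume x: "x \<in> carrier M"
  show "f x \<oplus>\<^bsub>N\<^esub> g x \<in> carrier N" using f(1) g(1) x by simp
  show "f (x \<oplus>\<^bsub>M\<^esub> y) \<oplus>\<^bsub>N\<^esub> g (x \<oplus>\<^bsub>M\<^esub> y) = f x \<oplus>\<^bsub>N\<^esub> g x \<oplus>\<^bsub>N\<^esub> (f y \<oplus>\<^bsub>N\<^esub> g y)"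
    if y: "y \<in> carrier M" for y
    using f(1,2) g(1,2) x y by (simp add: N.M.a_ac)
  show "f (a \<odot>\<^bsub>M\<^esub> x) \<oplus>\<^bsub>N\<^esub> g (a \<odot>\<^bsub>M\<^esub> x) = a \<odot>\<^bsub>N\<^esub> (f x \<oplus>\<^bsub>N\<^esub> g x)"
    if a: "a \<in> carrier R" for a
    using f(1,3) g(1,3) x a by (simp add: N.smult_r_distr)
qed

lemma lmod_hom_diff:
  assumes "left_module R M" "left_module R N" "f \<in> lmod_hom R M N" "g \<in> lmod_hom R M N"
  shows "(\<lambda>x\<in>carrier M. f x \<ominus>\<^bsub>N\<^esub> g x) \<in> lmod_hom R M N"
proof (rule lmod_hom_restrictI[OF assms(1)])
  interpret N: left_module R N by fact
  note f = lmod_homD[OF assms(3)] and g = lmod_homD[OF assms(4)]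
  fix x assume x: "x \<in> carrier M"
  show "f x \<ominus>\<^bsub>N\<^esub> g x \<in> carrier N" using f(1) g(1) x by simp
  show "f (x \<oplus>\<^bsub>M\<^esub> y) \<ominus>\<^bsub>N\<^esub> g (x \<oplus>\<^bsub>M\<^esub> y) = f x \<ominus>\<^bsub>N\<^esub> g x \<oplus>\<^bsub>N\<^esub> (f y \<ominus>\<^bsub>N\<^esub> g y)"
    if y: "y \<in> carrier M" for y
    using f(1,2) g(1,2) x y by (simp add: a_minus_def N.M.minus_add N.M.a_ac)
  show "f (a \<odot>\<^bsub>M\<^esub> x) \<ominus>\<^bsub>N\<^esub> g (a \<odot>\<^bsub>M\<^esub> x) = a \<odot>\<^bsub>N\<^esub> (f x \<ominus>\<^bsub>N\<^esub> g x)"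
    if a: "a \<in> carrier R" for a
    using f(1,3) g(1,3) x a by (simp add: a_minus_def N.smult_r_distr N.smult_minus_right)
qed

section \<open>Submodules, kernels and images\<close>

lemma submodule_subset: "submodule U R M \<Longrightarrow> U \<subseteq> carrier M"
  using subgroup.subset[OF submodule.axioms(1)] by fastforce

lemma submodule_zero: "submodule U R M \<Longrightarrow> \<zero>\<^bsub>M\<^esub> \<in> U"
  using subgroup.one_closed[OF submodule.axioms(1)] by fastforce

lemma submodule_add: "submodule U R M \<Longrightarrow> x \<in> U \<Longrightarrow> y \<in> U \<Longrightarrow> x \<oplus>\<^bsub>M\<^esub> y \<in> U"
  using subgroup.m_closed[OF submodule.axioms(1)] by fastforce

lemma submodule_uminus: "submodule U R M \<Longrightarrow> x \<in> U \<Longrightarrow> \<ominus>\<^bsub>M\<^esub> x \<in> U"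
  using subgroup.m_inv_closed[OF submodule.axioms(1)] by (fastforce simp: a_inv_def)

lemma submodule_smult: "submodule U R M \<Longrightarrow> a \<in> carrier R \<Longrightarrow> x \<in> U \<Longrightarrow> a \<odot>\<^bsub>M\<^esub> x \<in> U"
  using submodule.smult_closed by fastforce

lemmas submodule_simps = submodule_zero submodule_add submodule_uminus submodule_smult

lemma set_add_iff: "w \<in> U <+>\<^bsub>M\<^esub> V \<longleftrightarrow> (\<exists>u\<in>U. \<exists>v\<in>V. w = u \<oplus>\<^bsub>M\<^esub> v)"
  by (simp add: set_add_def set_mult_def)

lemma left_submoduleI:
  assumes "left_module R M" "U \<subseteq> carrier M" "\<zero>\<^bsub>M\<^esub> \<in> U"
    and "\<And>x y. x \<in> U \<Longrightarrow> y \<in> U \<Longrightarrow> x \<oplus>\<^bsub>M\<^esub> y \<in> U"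
    and smult: "\<And>a x. a \<in> carrier R \<Longrightarrow> x \<in> U \<Longrightarrow> a \<odot>\<^bsub>M\<^esub> x \<in> U"
  shows "submodule U R M"
proof -
  interpret left_module R M by fact
  show ?thesis
  proof (intro submodule.intro subgroup.intro submodule_axioms.intro)
    show "inv\<^bsub>add_monoid M\<^esub> x \<in> U" if "x \<in> U" for x
      using smult[of "\<ominus>\<^bsub>R\<^esub> \<one>\<^bsub>R\<^esub>" x] that assms(2) smult_uminus_one[of x]
      by (auto simp: a_inv_def[symmetric] subset_iff)
  qed (use assms in auto)
qed

lemma left_module_submodule:
  assumes "left_module R M" "submodule U R M"
  shows "left_module R (M\<lparr>carrier := U\<rparr>)"
proof -
  interpret left_module R M by fact
  note U = submodule_simps[OF assms(2)]
  have Uc: "\<And>x. x \<in> U \<Longrightarrow> x \<in> carrier M" using submodule_subset[OF assms(2)] by auto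
  interpret N: abelian_group "M\<lparr>carrier := U\<rparr>"
  proof (rule abelian_groupI)
    show "\<exists>y\<in>carrier (M\<lparr>carrier := U\<rparr>). y \<oplus>\<^bsub>M\<lparr>carrier := U\<rparr>\<^esub> x = \<zero>\<^bsub>M\<lparr>carrier := U\<rparr>\<^esub>"
      if "x \<in> carrier (M\<lparr>carrier := U\<rparr>)" for x
      using that U Uc by (intro bexI[of _ "\<ominus>\<^bsub>M\<^esub> x"]) (auto simp: M.l_neg)
  qed (use U Uc in \<open>auto simp: M.a_ac\<close>)
  show ?thesis
    by unfold_locales
      (use U Uc in \<open>auto simp: smult_l_distr smult_r_distr smult_assoc1\<close>)
qed

lemma submodule_kernel:
  assumes "left_module R M" "left_module R N" "f \<in> lmod_hom R M N"
  shows "submodule (lmod_kernel M N f) R M"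
proof -
  interpret M: left_module R M by fact
  interpret N: left_module R N by fact
  show ?thesis
    by (rule left_submoduleI[OF assms(1)])
      (auto simp: lmod_kernel_def lmod_homD[OF assms(3)] lmod_hom_zero[OF assms])
qed

lemma submodule_image:
  assumes "left_module R M" "left_module R N" "f \<in> lmod_hom R M N" "submodule U R M"
  shows "submodule (f ` U) R N"
proof -
  note f = lmod_homD[OF assms(3)]
  have Uc: "\<And>x. x \<in> U \<Longrightarrow> x \<in> carrier M" using submodule_subset[OF assms(4)] by auto
  show ?thesis
  proof (rule left_submoduleI[OF assms(2)])
    show "f ` U \<subseteq> carrier N" using f(1) Uc by auto
    show "\<zero>\<^bsub>N\<^esub> \<in> f ` U" 
      using lmod_hom_zero[OF assms(1-3)] submodule_zero[OF assms(4)] by (metis imageI)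
    show "x \<oplus>\<^bsub>N\<^esub> y \<in> f ` U" if xy: "x \<in> f ` U" "y \<in> f ` U" for x y
    proof -
      obtain u v where "x = f u" "y = f v" "u \<in> U" "v \<in> U" using xy by blast
      then show ?thesis
        using f(2)[of u v] Uc submodule_add[OF assms(4)] by (metis imageI)
    qed
    show "a \<odot>\<^bsub>N\<^esub> x \<in> f ` U" if "a \<in> carrier R" "x \<in> f ` U" for a x
      using f(3) Uc submodule_smult[OF assms(4)] that by (metis (no_types, lifting) image_iff)
  qed
qed

lemma submodule_carrier: "left_module R M \<Longrightarrow> submodule (carrier M) R M"
proof -
  assume M: "left_module R M"
  interpret left_module R M by fact
  show ?thesis by (rule left_submoduleI[OF M]) auto
qed

lemma lmod_hom_inj_onI:
  assumes "left_module R M" "left_module R N" "f \<in> lmod_hom R M N"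
    and ker: "\<And>x. x \<in> carrier M \<Longrightarrow> f x = \<zero>\<^bsub>N\<^esub> \<Longrightarrow> x = \<zero>\<^bsub>M\<^esub>"
  shows "inj_on f (carrier M)"
proof (rule inj_onI)
  interpret M: left_module R M by fact
  interpret N: left_module R N by fact
  fix x y assume xy: "x \<in> carrier M" "y \<in> carrier M" "f x = f y"
  then have "f (x \<ominus>\<^bsub>M\<^esub> y) = \<zero>\<^bsub>N\<^esub>"
    using lmod_hom_minus[OF assms(1-3)] lmod_homD(1)[OF assms(3)] by (simp add: N.M.r_neg a_minus_def)
  then have "x \<ominus>\<^bsub>M\<^esub> y = \<zero>\<^bsub>M\<^esub>" using ker xy by simp
  then show "x = y" using xy by (simp add: M.diff_eq_zero_iff)
qed

text \<open>The homomorphism theorem. The image of \<open>d\<close> with the operations of \<open>Q\<close> stands for the quotient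
  of \<open>P\<close> by the kernel of \<open>d\<close>, so that no quotient modules have to be formed.\<close>

lemma lmod_hom_factor:
  assumes P: "left_module R P" and Q: "left_module R Q" and N: "left_module R N"
    and d: "d \<in> lmod_hom R P Q" and f: "f \<in> lmod_hom R P N"
    and ker: "\<And>x. x \<in> carrier P \<Longrightarrow> d x = \<zero>\<^bsub>Q\<^esub> \<Longrightarrow> f x = \<zero>\<^bsub>N\<^esub>"
  obtains g where "g \<in> lmod_hom R (Q\<lparr>carrier := d ` carrier P\<rparr>) N"
    and "\<And>x. x \<in> carrier P \<Longrightarrow> g (d x) = f x"
proof -
  interpret P: left_module R P by fact
  interpret Q: left_module R Q by fact
  interpret N: left_module R N by fact
  note D = lmod_homD[OF d] and F = lmod_homD[OF f]
  have eq: "f x = f y" if "x \<in> carrier P" "y \<in> carrier P" "d x = d y" for x y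
  proof -
    have "d (x \<ominus>\<^bsub>P\<^esub> y) = \<zero>\<^bsub>Q\<^esub>"
      using lmod_hom_minus[OF P Q d] D(1) that by (simp add: Q.M.r_neg a_minus_def)
    then have "f (x \<ominus>\<^bsub>P\<^esub> y) = \<zero>\<^bsub>N\<^esub>" using ker that by simp
    then show ?thesis using lmod_hom_minus[OF P N f] F(1) that by (simp add: N.diff_eq_zero_iff)
  qed
  let ?S = "Q\<lparr>carrier := d ` carrier P\<rparr>"
  define g where "g = (\<lambda>z. f (SOME x. x \<in> carrier P \<and> d x = z))"
  have g: "g (d x) = f x" if "x \<in> carrier P" for x
  proof -
    have "(SOME x'. x' \<in> carrier P \<and> d x' = d x) \<in> carrier P \<and> d (SOME x'. x' \<in> carrier P \<and> d x' = d x) = d x"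
      by (rule someI[of _ x]) (simp add: that)
    then show ?thesis unfolding g_def using eq that by blast
  qed
  have S: "left_module R ?S"
    by (rule left_module_submodule[OF Q submodule_image[OF P Q d submodule_carrier[OF P]]])
  have "restrict g (carrier ?S) \<in> lmod_hom R ?S N"
  proof (rule lmod_hom_restrictI[OF S])
    show "g x \<in> carrier N" if "x \<in> carrier ?S" for x using that g F(1) by auto
    show "g (x \<oplus>\<^bsub>?S\<^esub> y) = g x \<oplus>\<^bsub>N\<^esub> g y" if xy: "x \<in> carrier ?S" "y \<in> carrier ?S" for x y
    proof -
      obtain u v where uv: "x = d u" "y = d v" "u \<in> carrier P" "v \<in> carrier P" using xy by auto
      show ?thesis using g[of "u \<oplus>\<^bsub>P\<^esub> v"] g uv D(2) F(2) by simp
    qed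
    show "g (a \<odot>\<^bsub>?S\<^esub> x) = a \<odot>\<^bsub>N\<^esub> g x" if ax: "a \<in> carrier R" "x \<in> carrier ?S" for a x
    proof -
      obtain u where u: "x = d u" "u \<in> carrier P" using ax by auto
      show ?thesis using g[of "a \<odot>\<^bsub>P\<^esub> u"] g u ax D(3) F(3) by simp
    qed
  qed
  then show ?thesis using g by (intro that[of "restrict g (carrier ?S)"]) auto
qed

lemma lmod_hom_into_submodule:
  assumes "f \<in> lmod_hom R M N" "f ` carrier M \<subseteq> U"
  shows "f \<in> lmod_hom R M (N\<lparr>carrier := U\<rparr>)"
  using assms by (auto simp: lmod_hom_def PiE_def)

lemma lmod_hom_from_submodule_codomain:
  assumes "f \<in> lmod_hom R M (N\<lparr>carrier := U\<rparr>)" "U \<subseteq> carrier N"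
  shows "f \<in> lmod_hom R M N"
  using assms by (auto simp: lmod_hom_def PiE_def)

lemma lmod_hom_restrict_submodule:
  assumes "left_module R M" "submodule U R M" "f \<in> lmod_hom R M N"
  shows "restrict f U \<in> lmod_hom R (M\<lparr>carrier := U\<rparr>) N"
proof -
  have "restrict f (carrier (M\<lparr>carrier := U\<rparr>)) \<in> lmod_hom R (M\<lparr>carrier := U\<rparr>) N"
    using submodule_subset[OF assms(2)]
    by (intro lmod_hom_restrictI left_module_submodule[OF assms(1,2)])
      (auto simp: lmod_homD[OF assms(3)] subset_iff)
  then show ?thesis by simp
qed


section \<open>Isomorphisms\<close>

lemma lmod_iso_refl: 
  assumes "left_module R M" 
  shows "lmod_iso R M M"
  unfolding lmod_iso_def
  by (rule bexI[of _ "\<lambda>x\<in>carrier M. x"])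
    (auto simp: bij_betw_def inj_on_def intro: lmod_hom_restrictI[OF assms])

lemma lmod_iso_sym:
  assumes M: "left_module R M" and N: "left_module R N" and iso: "lmod_iso R M N"
  shows "lmod_iso R N M"
proof -
  interpret M: left_module R M by fact
  interpret N: left_module R N by fact
  obtain f where f: "f \<in> lmod_hom R M N" and bij: "bij_betw f (carrier M) (carrier N)"
    using iso by (auto simp: lmod_iso_def)
  note F = lmod_homD[OF f]
  define g where "g = the_inv_into (carrier M) f"
  have inj: "inj_on f (carrier M)" and im: "f ` carrier M = carrier N" using bij by (auto simp: bij_betw_def)
  have gf: "g (f x) = x" if "x \<in> carrier M" for x using that inj by (simp add: g_def the_inv_into_f_f)
  have "restrict g (carrier N) \<in> lmod_hom R N M"
  proof (rule lmod_hom_restrictI[OF N])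
    show "g x \<in> carrier M" if "x \<in> carrier N" for x using that gf unfolding im[symmetric] by auto
    show "g (x \<oplus>\<^bsub>N\<^esub> y) = g x \<oplus>\<^bsub>M\<^esub> g y" if xy: "x \<in> carrier N" "y \<in> carrier N" for x y
    proof -
      obtain u v where uv: "x = f u" "y = f v" "u \<in> carrier M" "v \<in> carrier M" using xy im by blast
      show ?thesis using gf[of "u \<oplus>\<^bsub>M\<^esub> v"] gf uv F(2) by simp
    qed
    show "g (a \<odot>\<^bsub>N\<^esub> x) = a \<odot>\<^bsub>M\<^esub> g x" if ax: "a \<in> carrier R" "x \<in> carrier N" for a x
    proof -
      obtain u where u: "x = f u" "u \<in> carrier M" using ax im by blast
      show ?thesis using gf[of "a \<odot>\<^bsub>M\<^esub> u"] gf u ax F(3) by simp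
    qed
  qed
  moreover have "bij_betw (restrict g (carrier N)) (carrier N) (carrier M)"
    using bij_betw_the_inv_into[OF bij] unfolding g_def by (subst bij_betw_cong[of _ _ "the_inv_into (carrier M) f"]) auto
  ultimately show ?thesis unfolding lmod_iso_def by blast
qed

lemma lmod_iso_trans:
  assumes M: "left_module R M" and "lmod_iso R M N" "lmod_iso R N L"
  shows "lmod_iso R M L"
proof -
  obtain f g where f: "f \<in> lmod_hom R M N" "bij_betw f (carrier M) (carrier N)"
    and g: "g \<in> lmod_hom R N L" "bij_betw g (carrier N) (carrier L)"
    using assms(2,3) by (auto simp: lmod_iso_def)
  have "bij_betw (compose (carrier M) g f) (carrier M) (carrier L)"
    using bij_betw_trans[OF f(2) g(2)] by (subst bij_betw_cong[of _ _ "g \<circ> f"]) (auto simp: compose_def)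
  then show ?thesis using lmod_hom_compose[OF M f(1) g(1)] unfolding lmod_iso_def by blast
qed

lemma iso_class_eq_iff:
  assumes M: "left_module R M" and N: "left_module R N"
  shows "iso_class R M = iso_class R N \<longleftrightarrow> lmod_iso R M N"
proof
  assume "iso_class R M = iso_class R N"
  moreover have "N \<in> iso_class R N" using N lmod_iso_refl[OF N] by (simp add: iso_class_def)
  ultimately show "lmod_iso R M N" by (auto simp: iso_class_def)
next
  assume iso: "lmod_iso R M N"
  then have "lmod_iso R N M" by (rule lmod_iso_sym[OF M N])
  then show "iso_class R M = iso_class R N"
    using iso lmod_iso_trans[OF M] lmod_iso_trans[OF N] by (auto simp: iso_class_def)
qed

text \<open>Both modules are the quotient of \<open>P\<close> by the common kernel.\<close>

lemma lmod_iso_of_same_kernel: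
  assumes P: "left_module R P" and N: "left_module R N" and L: "left_module R L"
    and f: "f \<in> lmod_hom R P N" "f ` carrier P = carrier N"
    and g: "g \<in> lmod_hom R P L" "g ` carrier P = carrier L"
    and ker: "\<And>x. x \<in> carrier P \<Longrightarrow> f x = \<zero>\<^bsub>N\<^esub> \<longleftrightarrow> g x = \<zero>\<^bsub>L\<^esub>"
  shows "lmod_iso R N L"
proof -
  obtain h where h: "h \<in> lmod_hom R (N\<lparr>carrier := f ` carrier P\<rparr>) L"
    and hf: "\<And>x. x \<in> carrier P \<Longrightarrow> h (f x) = g x"
    using lmod_hom_factor[OF P N L f(1) g(1)] ker by blast
  have h': "h \<in> lmod_hom R N L" using h unfolding f(2) by simp
  have "inj_on h (carrier N)"
  proof (rule lmod_hom_inj_onI[OF N L h'])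
    fix x assume "x \<in> carrier N" "h x = \<zero>\<^bsub>L\<^esub>"
    then obtain u where "x = f u" "u \<in> carrier P" "g u = \<zero>\<^bsub>L\<^esub>" using hf f(2) by (metis imageE)
    then show "x = \<zero>\<^bsub>N\<^esub>" using ker by simp
  qed
  moreover have "h ` carrier N = carrier L"
    using hf f(2) g(2) by (metis (no_types, lifting) image_cong image_image)
  ultimately show ?thesis using h' unfolding lmod_iso_def bij_betw_def by blast
qed


section \<open>Extension groups\<close>

lemma fl_module_left_module: "fl_module R M \<Longrightarrow> left_module R M"
  by (simp add: fl_module_def)

lemma projective_fl_module: "projective R P \<Longrightarrow> fl_module R P"
  by (simp add: projective_def)

lemmas projective_left_module = fl_module_left_module[OF projective_fl_module]

lemma projective_lift:
  fixes P M N :: "('r, 'm) module"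
  assumes "projective R P" "fl_module R M" "fl_module R N" "g \<in> lmod_hom R M N"
    "g ` carrier M = carrier N" "f \<in> lmod_hom R P N"
  obtains h where "h \<in> lmod_hom R P M" "\<And>x. x \<in> carrier P \<Longrightarrow> g (h x) = f x"
  using assms unfolding projective_def by blast

lemma projective_resolutionD:
  assumes "projective_resolution R M P d"
  shows "\<And>i. projective R (P i)" "d 0 \<in> lmod_hom R (P 0) M" "d 0 ` carrier (P 0) = carrier M"
    "\<And>i. d (Suc i) \<in> lmod_hom R (P (Suc i)) (P i)"
    "d (Suc 0) ` carrier (P (Suc 0)) = lmod_kernel (P 0) M (d 0)"
    "\<And>i. d (Suc (Suc i)) ` carrier (P (Suc (Suc i))) = lmod_kernel (P (Suc i)) (P i) (d (Suc i))"
  using assms unfolding projective_resolution_def by simp_all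

lemma projective_resolution_complex:
  assumes "projective_resolution R M P d" "x \<in> carrier (P (Suc (Suc i)))"
  shows "d (Suc i) (d (Suc (Suc i)) x) = \<zero>\<^bsub>P i\<^esub>"
  using projective_resolutionD(6)[OF assms(1), of i] assms(2) by (auto simp: lmod_kernel_def)

text \<open>A cocycle \<open>a\<close> lies in its coset \<open>H #> a\<close> since \<open>H\<close> contains zero, and the coset of a coboundary is
  \<open>H\<close> since coboundaries are closed under sums and differences.\<close>
lemma coboundary_quotient_trivial_iff:
  fixes j :: nat
  assumes res: "projective_resolution R M P d" and N: "left_module R N"
  defines "G \<equiv> (Hom_group R (P (Suc j)) N)\<lparr>carrier := cocycles R P d N (Suc j)\<rparr>"
    and "H \<equiv> coboundaries R P d N (Suc j)"
  shows "carrier (G Mod H) = {\<one>\<^bsub>G Mod H\<^esub>} \<longleftrightarrow> cocycles R P d N (Suc j) \<subseteq> H"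
proof -
  interpret N: left_module R N by fact
  note r = projective_resolutionD[OF res]
  let ?P = "P (Suc j)" and ?Q = "P j" and ?d = "d (Suc j)"
  have P: "left_module R ?P" and Q: "left_module R ?Q" by (rule projective_left_module[OF r(1)])+
  let ?C = "cocycles R P d N (Suc j)" and ?z = "\<lambda>x\<in>carrier ?P. \<zero>\<^bsub>N\<^esub>"
  have carr: "carrier (G Mod H) = (\<lambda>a. H #>\<^bsub>G\<^esub> a) ` ?C" and one: "\<one>\<^bsub>G Mod H\<^esub> = H"
    by (auto simp: FactGroup_def RCOSETS_def G_def)
  have coset: "H #>\<^bsub>G\<^esub> a = (\<lambda>h. \<lambda>x\<in>carrier ?P. h x \<oplus>\<^bsub>N\<^esub> a x) ` H" for a
    by (auto simp: r_coset_def G_def Hom_group_def)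
  have H: "H = (\<lambda>g. compose (carrier ?P) g ?d) ` lmod_hom R ?Q N" by (simp add: H_def)
  have dc: "?d x \<in> carrier ?Q" if "x \<in> carrier ?P" for x using lmod_homD(1)[OF r(4)] that by simp
  have z0: "(\<lambda>x\<in>carrier L. \<zero>\<^bsub>N\<^esub>) \<in> lmod_hom R L N" if "left_module R L" for L
    by (rule lmod_hom_restrictI[OF that]) auto
  have zH: "?z \<in> H"
    unfolding H by (rule image_eqI[OF _ z0[OF Q]]) (auto simp: compose_def dc intro!: restrict_ext)
  have zC: "?z \<in> ?C"
    using z0[OF P] lmod_homD(1)[OF r(4)] by (auto simp: cocycles_def)
  show ?thesis
  proof
    assume triv: "carrier (G Mod H) = {\<one>\<^bsub>G Mod H\<^esub>}"
    show "?C \<subseteq> H"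
    proof
      fix a assume a: "a \<in> ?C"
      then have ah: "a \<in> lmod_hom R ?P N" by (simp add: cocycles_def)
      have "H #>\<^bsub>G\<^esub> a = H" using triv a unfolding carr one by blast
      moreover have "(\<lambda>x\<in>carrier ?P. ?z x \<oplus>\<^bsub>N\<^esub> a x) \<in> H #>\<^bsub>G\<^esub> a"
        unfolding coset using zH by (rule imageI)
      moreover have "(\<lambda>x\<in>carrier ?P. ?z x \<oplus>\<^bsub>N\<^esub> a x) = a"
        using lmod_homD(1,4)[OF ah] by (intro extensionalityI[of _ "carrier ?P"]) auto
      ultimately show "a \<in> H" by simp
    qed
  next
    assume sub: "?C \<subseteq> H"
    have "H #>\<^bsub>G\<^esub> a = H" if aC: "a \<in> ?C" for a
    proof
      obtain g where g: "g \<in> lmod_hom R ?Q N" "a = compose (carrier ?P) g ?d"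
        using aC sub unfolding H by blast
      note gD = lmod_homD(1)[OF g(1)]
      show "H #>\<^bsub>G\<^esub> a \<subseteq> H"
      proof
        fix b assume "b \<in> H #>\<^bsub>G\<^esub> a"
        then obtain h where h: "h \<in> lmod_hom R ?Q N"
          "b = (\<lambda>x\<in>carrier ?P. compose (carrier ?P) h ?d x \<oplus>\<^bsub>N\<^esub> a x)"
          unfolding coset unfolding H by blast
        have "b = compose (carrier ?P) (\<lambda>x\<in>carrier ?Q. h x \<oplus>\<^bsub>N\<^esub> g x) ?d"
          using dc unfolding h(2) g(2) by (auto simp: compose_def intro!: restrict_ext)
        then show "b \<in> H" unfolding H using lmod_hom_add[OF Q N h(1) g(1)] by blast
      qed
      show "H \<subseteq> H #>\<^bsub>G\<^esub> a"
      proof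
        fix b assume "b \<in> H"
        then obtain h where h: "h \<in> lmod_hom R ?Q N" "b = compose (carrier ?P) h ?d"
          unfolding H by blast
        note hD = lmod_homD(1)[OF h(1)]
        let ?k = "\<lambda>x\<in>carrier ?Q. h x \<ominus>\<^bsub>N\<^esub> g x"
        have "compose (carrier ?P) ?k ?d \<in> H"
          unfolding H using lmod_hom_diff[OF Q N h(1) g(1)] by blast
        moreover have "b = (\<lambda>x\<in>carrier ?P. compose (carrier ?P) ?k ?d x \<oplus>\<^bsub>N\<^esub> a x)"
          using dc hD gD unfolding h(2) g(2)
          by (auto simp: compose_def a_minus_def N.M.a_assoc N.M.l_neg intro!: restrict_ext)
        ultimately show "b \<in> H #>\<^bsub>G\<^esub> a" unfolding coset by blast
      qed
    qed
    then show "carrier (G Mod H) = {\<one>\<^bsub>G Mod H\<^esub>}" unfolding carr one using zC by auto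
  qed
qed

text \<open>The resolution in the definition of the extension groups is the result of an arbitrary choice.
  It is the same for all degrees and all second arguments, and only the axioms of a projective
  resolution are known of it.\<close>

lemma Ext_zero_resolution:
  fixes M :: "('r, 'm) module"
  assumes "projective_resolution R M P0 d0"
  obtains P d where "projective_resolution R M P d"
    and "\<And>j (N :: ('r, 'n, 'd) module_scheme). left_module R N \<Longrightarrow>
      Ext_zero R (Suc j) M N \<longleftrightarrow> cocycles R P d N (Suc j) \<subseteq> coboundaries R P d N (Suc j)"
proof -
  define Pd where "Pd = (SOME (P :: nat \<Rightarrow> ('r, 'm) module, d). projective_resolution R M P d)"
  obtain P d where Pd: "Pd = (P, d)" by (cases Pd)
  have "case Pd of (P, d) \<Rightarrow> projective_resolution R M P d"
    unfolding Pd_def by (rule someI[of _ "(P0, d0)"]) (simp add: assms)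
  then have res: "projective_resolution R M P d" by (simp add: Pd)
  have eq: "Ext R i M N = (Hom_group R (P i) N)\<lparr>carrier := cocycles R P d N i\<rparr> Mod coboundaries R P d N i"
    for i and N :: "('r, 'n, 'd) module_scheme"
    unfolding Ext_def using Pd unfolding Pd_def by simp
  show ?thesis
    by (rule that[OF res], unfold eq, rule coboundary_quotient_trivial_iff[OF res])
qed

text \<open>By exactness a cocycle of degree \<open>Suc i\<close> is the same as a homomorphism on the image of
  \<open>d (Suc i)\<close>, and it is a coboundary if this homomorphism extends to all of \<open>P i\<close>.\<close>
lemma cocycles_subset_coboundaries_iff:
  assumes res: "projective_resolution R M P d" and N: "left_module R N"
  shows "cocycles R P d N (Suc i) \<subseteq> coboundaries R P d N (Suc i) \<longleftrightarrow>
    (\<forall>f\<in>lmod_hom R ((P i)\<lparr>carrier := d (Suc i) ` carrier (P (Suc i))\<rparr>) N.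
       \<exists>F\<in>lmod_hom R (P i) N. \<forall>x\<in>d (Suc i) ` carrier (P (Suc i)). F x = f x)"
    (is "_ \<longleftrightarrow> (\<forall>f\<in>lmod_hom R ?B N. _)")
proof -
  note r = projective_resolutionD[OF res]
  have lm: "left_module R (P k)" for k by (rule projective_left_module[OF r(1)])
  let ?P = "P (Suc i)" and ?d = "d (Suc i)"
  have B: "?d \<in> lmod_hom R ?P ?B" by (rule lmod_hom_into_submodule[OF r(4)]) simp
  have subB: "submodule (?d ` carrier ?P) R (P i)"
    by (rule submodule_image[OF lm lm r(4) submodule_carrier[OF lm]])
  have lB: "left_module R ?B" by (rule left_module_submodule[OF lm subB])
  show ?thesis
  proof (intro iffI ballI)
    fix f assume sub: "cocycles R P d N (Suc i) \<subseteq> coboundaries R P d N (Suc i)"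
      and f: "f \<in> lmod_hom R ?B N"
    have "compose (carrier ?P) f ?d \<in> cocycles R P d N (Suc i)"
      using lmod_hom_compose[OF lm B f] projective_resolution_complex[OF res]
        lmod_homD(1)[OF r(4)] lmod_hom_zero[OF lB N f]
      by (auto simp: cocycles_def compose_eq)
    then obtain F where F: "F \<in> lmod_hom R (P i) N"
      "compose (carrier ?P) f ?d = compose (carrier ?P) F ?d" using sub by auto
    have "\<forall>x\<in>?d ` carrier ?P. F x = f x"
      using fun_cong[OF F(2)] by (auto simp: compose_def split: if_splits) metis
    then show "\<exists>F\<in>lmod_hom R (P i) N. \<forall>x\<in>?d ` carrier ?P. F x = f x" using F(1) by blast
  next
    assume ext: "\<forall>f\<in>lmod_hom R ?B N. \<exists>F\<in>lmod_hom R (P i) N. \<forall>x\<in>?d ` carrier ?P. F x = f x"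
    show "cocycles R P d N (Suc i) \<subseteq> coboundaries R P d N (Suc i)"
    proof
      fix c assume "c \<in> cocycles R P d N (Suc i)"
      then have c: "c \<in> lmod_hom R ?P N"
        and c0: "\<And>x. x \<in> carrier (P (Suc (Suc i))) \<Longrightarrow> c (d (Suc (Suc i)) x) = \<zero>\<^bsub>N\<^esub>"
        by (auto simp: cocycles_def)
      have "c x = \<zero>\<^bsub>N\<^esub>" if "x \<in> carrier ?P" "?d x = \<zero>\<^bsub>P i\<^esub>" for x
      proof -
        have "x \<in> d (Suc (Suc i)) ` carrier (P (Suc (Suc i)))"
          using r(6)[of i] that by (simp add: lmod_kernel_def)
        then show ?thesis using c0 by auto
      qed
      then obtain f where f: "f \<in> lmod_hom R ?B N" "\<And>x. x \<in> carrier ?P \<Longrightarrow> f (?d x) = c x"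
        using lmod_hom_factor[OF lm lm N r(4) c] by blast
      then obtain F where F: "F \<in> lmod_hom R (P i) N" "\<forall>x\<in>?d ` carrier ?P. F x = f x" using ext by blast
      have "c = compose (carrier ?P) F ?d"
        using lmod_homD(4)[OF c] F(2) f(2)
        by (intro extensionalityI[of _ "carrier ?P"]) (auto simp: compose_eq)
      then show "c \<in> coboundaries R P d N (Suc i)" using F(1) by auto
    qed
  qed
qed

lemma first_cocycles_subset_coboundaries_iff:
  assumes res: "projective_resolution R M P d" and N: "left_module R N"
  shows "cocycles R P d N (Suc 0) \<subseteq> coboundaries R P d N (Suc 0) \<longleftrightarrow>
    (\<forall>f\<in>lmod_hom R ((P 0)\<lparr>carrier := lmod_kernel (P 0) M (d 0)\<rparr>) N.
       \<exists>F\<in>lmod_hom R (P 0) N. \<forall>x\<in>lmod_kernel (P 0) M (d 0). F x = f x)"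
  using cocycles_subset_coboundaries_iff[OF res N, of 0] unfolding projective_resolutionD(5)[OF res] .

text \<open>Independence of the first extension group of the chosen projective presentation: two lifts
  \<open>h\<close> and \<open>g\<close> of the identity of \<open>Z\<close> compose to a map \<open>g h\<close> that differs from the identity by a
  map into the kernel of \<open>p'\<close>, to which \<open>f\<close> can be applied.\<close>

lemma extension_from_kernel_transfer:
  fixes P P' Z :: "('r, 'm) module"
  assumes P: "projective R P" and P': "projective R P'" and Z: "fl_module R Z" and N: "left_module R N"
    and p: "p \<in> lmod_hom R P Z" "p ` carrier P = carrier Z"
    and p': "p' \<in> lmod_hom R P' Z" "p' ` carrier P' = carrier Z"
    and ext: "\<And>f. f \<in> lmod_hom R (P\<lparr>carrier := lmod_kernel P Z p\<rparr>) N \<Longrightarrow>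
      \<exists>F\<in>lmod_hom R P N. \<forall>x\<in>lmod_kernel P Z p. F x = f x"
    and f: "f \<in> lmod_hom R (P'\<lparr>carrier := lmod_kernel P' Z p'\<rparr>) N"
  shows "\<exists>F\<in>lmod_hom R P' N. \<forall>x\<in>lmod_kernel P' Z p'. F x = f x"
proof -
  let ?K = "lmod_kernel P Z p" and ?K' = "lmod_kernel P' Z p'"
  note lP = projective_left_module[OF P] and lP' = projective_left_module[OF P']
    and lZ = fl_module_left_module[OF Z]
  interpret P': left_module R P' by (rule lP')
  interpret Z: left_module R Z by (rule lZ)
  interpret N: left_module R N by (rule N)
  obtain h where h: "h \<in> lmod_hom R P' P" "\<And>x. x \<in> carrier P' \<Longrightarrow> p (h x) = p' x"
    using projective_lift[OF P' projective_fl_module[OF P] Z p p'(1)] by blast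
  obtain g where g: "g \<in> lmod_hom R P P'" "\<And>x. x \<in> carrier P \<Longrightarrow> p' (g x) = p x"
    using projective_lift[OF P projective_fl_module[OF P'] Z p' p(1)] by blast
  note hD = lmod_homD[OF h(1)] and gD = lmod_homD[OF g(1)]
  have K: "submodule ?K R P" and K': "submodule ?K' R P'"
    using submodule_kernel[OF lP lZ p(1)] submodule_kernel[OF lP' lZ p'(1)] .
  let ?P'K = "P'\<lparr>carrier := ?K'\<rparr>"
  have g': "restrict g ?K \<in> lmod_hom R (P\<lparr>carrier := ?K\<rparr>) ?P'K"
    by (rule lmod_hom_into_submodule[OF lmod_hom_restrict_submodule[OF lP K g(1)]])
      (use g(2) gD(1) in \<open>auto simp: lmod_kernel_def\<close>)
  have "compose ?K f (restrict g ?K) \<in> lmod_hom R (P\<lparr>carrier := ?K\<rparr>) N"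
    using lmod_hom_compose[OF left_module_submodule[OF lP K] g' f] by simp
  then obtain F where F: "F \<in> lmod_hom R P N" "\<And>x. x \<in> ?K \<Longrightarrow> F x = f (g x)"
    using ext by (force simp: compose_def)
  have gh: "compose (carrier P') g h \<in> lmod_hom R P' P'" by (rule lmod_hom_compose[OF lP' h(1) g(1)])
  have id: "(\<lambda>x\<in>carrier P'. x) \<in> lmod_hom R P' P'" by (rule lmod_hom_restrictI[OF lP']) auto
  let ?e = "\<lambda>x\<in>carrier P'. compose (carrier P') g h x \<ominus>\<^bsub>P'\<^esub> (\<lambda>x\<in>carrier P'. x) x"
  have ee: "?e x = g (h x) \<ominus>\<^bsub>P'\<^esub> x" if "x \<in> carrier P'" for x using that by (simp add: compose_eq)
  have e: "?e \<in> lmod_hom R P' ?P'K"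
  proof (rule lmod_hom_into_submodule[OF lmod_hom_diff[OF lP' lP' gh id]])
    show "?e ` carrier P' \<subseteq> ?K'"
    proof
      fix y assume "y \<in> ?e ` carrier P'"
      then obtain x where x: "x \<in> carrier P'" "y = g (h x) \<ominus>\<^bsub>P'\<^esub> x" using ee by auto
      have "p' y = p' x \<ominus>\<^bsub>Z\<^esub> p' x"
        using lmod_hom_minus[OF lP' lZ p'(1)] x g(2) h(2) gD(1) hD(1) by simp
      then show "y \<in> ?K'" using x gD(1) hD(1) lmod_homD(1)[OF p'(1)]
        by (simp add: lmod_kernel_def Z.diff_eq_zero_iff)
    qed
  qed
  let ?F = "\<lambda>x\<in>carrier P'. compose (carrier P') F h x \<ominus>\<^bsub>N\<^esub> compose (carrier P') f ?e x"
  have "?F \<in> lmod_hom R P' N"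
    by (rule lmod_hom_diff[OF lP' N lmod_hom_compose[OF lP' h(1) F(1)] lmod_hom_compose[OF lP' e f]])
  moreover have "?F x = f x" if x: "x \<in> ?K'" for x
  proof -
    have xc: "x \<in> carrier P'" using x by (simp add: lmod_kernel_def)
    have "h x \<in> ?K" using x h(2) hD(1) by (simp add: lmod_kernel_def)
    then have ghx: "g (h x) \<in> ?K'" and Fh: "F (h x) = f (g (h x))"
      using lmod_homD(1)[OF g', of "h x"] F(2) by auto
    have "f (g (h x) \<ominus>\<^bsub>P'\<^esub> x) = f (g (h x)) \<ominus>\<^bsub>N\<^esub> f x"
    proof -
      interpret K': left_module R ?P'K by (rule left_module_submodule[OF lP' K'])
      have "\<ominus>\<^bsub>?P'K\<^esub> x = \<ominus>\<^bsub>P'\<^esub> x"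
        by (rule K'.M.minus_equality)
          (use x xc submodule_uminus[OF K'] in \<open>simp_all add: P'.M.l_neg\<close>)
      then show ?thesis
        using lmod_hom_minus[OF left_module_submodule[OF lP' K'] N f, of "g (h x)" x] ghx x
        by (simp add: a_minus_def)
    qed
    then have "?F x = f (g (h x)) \<ominus>\<^bsub>N\<^esub> (f (g (h x)) \<ominus>\<^bsub>N\<^esub> f x)"
      using xc Fh by (simp add: compose_eq)
    then show ?thesis
      using lmod_homD(1)[OF f, simplified, OF ghx] lmod_homD(1)[OF f, simplified, OF x]
      by (simp add: a_minus_def N.M.minus_add N.M.a_assoc[symmetric] N.M.r_neg)
  qed
  ultimately show ?thesis by blast
qed


section \<open>The regular module\<close>

lemma regular_module_simps [simp]:
  "carrier (regular_module R) = carrier R" "\<zero>\<^bsub>regular_module R\<^esub> = \<zero>\<^bsub>R\<^esub>"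
  "add (regular_module R) = add R" "smult (regular_module R) = monoid.mult R"
  by (simp_all add: regular_module_def)

lemma left_module_regular:
  assumes "ring R"
  shows "left_module R (regular_module R)"
proof -
  interpret ring R by fact
  interpret M: abelian_group "regular_module R"
    by (rule abelian_groupI) (auto simp: a_ac intro: bexI[of _ "\<ominus>\<^bsub>R\<^esub> _"] l_neg)
  show ?thesis by unfold_locales (auto simp: l_distr r_distr m_assoc)
qed

lemma regular_uminus [simp]:
  assumes "ring R" "a \<in> carrier R"
  shows "\<ominus>\<^bsub>regular_module R\<^esub> a = \<ominus>\<^bsub>R\<^esub> a"
proof -
  interpret ring R by fact
  interpret M: left_module R "regular_module R" by (rule left_module_regular) fact
  show ?thesis by (rule M.M.minus_equality) (use assms(2) in \<open>simp_all add: l_neg\<close>)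
qed

lemma regular_module_hom:
  assumes "left_module R M" "m \<in> carrier M"
  shows "(\<lambda>a\<in>carrier R. a \<odot>\<^bsub>M\<^esub> m) \<in> lmod_hom R (regular_module R) M"
proof -
  interpret left_module R M by fact
  have "restrict (\<lambda>a. a \<odot>\<^bsub>M\<^esub> m) (carrier (regular_module R)) \<in> lmod_hom R (regular_module R) M"
    by (rule lmod_hom_restrictI[OF left_module_regular])
      (use assms(2) in \<open>auto simp: smult_l_distr smult_assoc1 R.ring_axioms\<close>)
  then show ?thesis by simp
qed

lemma regular_module_hom_eq:
  assumes "left_module R M" "f \<in> lmod_hom R (regular_module R) M" "a \<in> carrier R"
  shows "f a = a \<odot>\<^bsub>M\<^esub> f \<one>\<^bsub>R\<^esub>"
proof -
  interpret left_module R M by fact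
  show ?thesis using lmod_homD(3)[OF assms(2), of a "\<one>\<^bsub>R\<^esub>"] assms(3) by simp
qed

text \<open>A homomorphism from the regular module is determined by the image of \<open>1\<close>, and this image may be
  any element.\<close>
lemma projective_regular_module:
  fixes R :: "('r, 'a) ring_scheme"
  assumes R: "ring R" and fl: "fl_module R (regular_module R)"
  shows "projective R (regular_module R)"
  unfolding projective_def
proof (intro conjI allI impI fl)
  interpret R: ring R by fact
  fix M N :: "('r, 'r) module" and g f
  assume asm: "fl_module R M \<and> fl_module R N \<and> g \<in> lmod_hom R M N \<and> g ` carrier M = carrier N \<and>
    f \<in> lmod_hom R (regular_module R) N"
  then have lM: "left_module R M" and lN: "left_module R N" by (simp_all add: fl_module_def)
  have "f \<one>\<^bsub>R\<^esub> \<in> carrier N" using asm lmod_homD(1)[of f R "regular_module R" N] by simp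
  then obtain m where m: "m \<in> carrier M" "g m = f \<one>\<^bsub>R\<^esub>" using asm by (metis imageE)
  have "g (a \<odot>\<^bsub>M\<^esub> m) = f a" if "a \<in> carrier R" for a
    using lmod_homD(3)[of g R M N a m] regular_module_hom_eq[OF lN, of f a] asm m that by simp
  then show "\<exists>h\<in>lmod_hom R (regular_module R) M. \<forall>x\<in>carrier (regular_module R). g (h x) = f x"
    by (intro bexI[OF _ regular_module_hom[OF lM m(1)]]) simp
qed


section \<open>A basis of the quantum exterior algebra\<close>

lemma fa_simps [simp]:
  "carrier free_algebra = {f :: 'g list \<Rightarrow> 'k::field. finite {w. f w \<noteq> 0}}"
  "\<zero>\<^bsub>free_algebra\<^esub> = (\<lambda>w :: 'g list. 0 :: 'k)"
  "\<one>\<^bsub>free_algebra\<^esub> = (\<lambda>w :: 'g list. if w = [] then 1 else 0 :: 'k)"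
  "f \<oplus>\<^bsub>free_algebra\<^esub> g = (\<lambda>w. f w + g w)"
  "f \<otimes>\<^bsub>free_algebra\<^esub> g = (\<lambda>w. \<Sum>i\<le>length w. f (take i w) * g (drop i w))"
  by (simp_all add: free_algebra_def)

lemma fa_minus [simp]:
  fixes f g :: "'g list \<Rightarrow> 'k::field"
  assumes "f \<in> carrier free_algebra"
  shows "\<ominus>\<^bsub>free_algebra\<^esub> f = (\<lambda>w. - f w)"
proof -
  interpret ring "free_algebra :: ('g list \<Rightarrow> 'k) ring" by (rule ring_free_algebra)
  show ?thesis by (rule add.inv_equality[folded a_inv_def, simplified]) (use assms in auto)
qed

lemma monomial_carrier [simp]: "finite {w. monomial c u w \<noteq> 0}"
  by (rule finite_subset[of _ "{u}"]) (auto simp: monomial_def)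

lemma monomial_mult:
  "monomial c u \<otimes>\<^bsub>free_algebra\<^esub> monomial d v = monomial (c * d) (u @ v)"
proof
  fix w
  have "(monomial c u \<otimes>\<^bsub>free_algebra\<^esub> monomial d v) w
      = (\<Sum>i\<le>length w. if i = length u then (if w = u @ v then c * d else 0) else 0)"
    unfolding fa_simps
  proof (rule sum.cong)
    fix i assume i: "i \<in> {..length w}"
    have "take i w = u \<and> drop i w = v \<longleftrightarrow> i = length u \<and> w = u @ v"
      using i append_take_drop_id[of i w] by (auto simp: min_def)
    moreover have "monomial c u (take i w) * monomial d v (drop i w)
        = (if take i w = u \<and> drop i w = v then c * d else 0)"
      by (simp add: monomial_def)
    ultimately show "monomial c u (take i w) * monomial d v (drop i w)
        = (if i = length u then if w = u @ v then c * d else 0 else 0)"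
      by simp
  qed simp
  also have "\<dots> = monomial (c * d) (u @ v) w" by (auto simp: monomial_def)
  finally show "(monomial c u \<otimes>\<^bsub>free_algebra\<^esub> monomial d v) w = monomial (c * d) (u @ v) w" .
qed

lemma qext_relations_carrier: "qext_relations q \<subseteq> carrier free_algebra"
  by (auto simp: qext_relations_def monomial_def
      intro: finite_subset[of _ "{[gen_x, gen_y], [gen_y, gen_x]}"])

lemma ideal_qext_ideal: "ideal (qext_ideal q) free_algebra"
  unfolding qext_ideal_def by (rule ring.genideal_ideal[OF ring_free_algebra qext_relations_carrier])

text \<open>This description of the ideal is what gives the basis \<open>1, x, y, y x\<close> of the algebra. The right-hand
  side is an ideal, because the coefficients of a product at words of length at most two only
  involve coefficients at such words. Conversely, a word outside \<open>1, x, y, x y, y x\<close> contains \<open>x x\<close>,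
  \<open>y y\<close>, \<open>x y x\<close> or \<open>y x y\<close>, and all of these lie in the ideal. What remains of an element of the
  right-hand side after removing these words is a multiple of \<open>x y + q y x\<close>.\<close>
lemma qext_ideal_eq:
  "qext_ideal q = {f \<in> carrier free_algebra.
     f [] = 0 \<and> f [gen_x] = 0 \<and> f [gen_y] = 0 \<and> f [gen_y, gen_x] = q * f [gen_x, gen_y]}" (is "_ = ?J")
proof
  interpret F: ring "free_algebra :: (gen list \<Rightarrow> 'a) ring" by (rule ring_free_algebra)
  have "ideal ?J free_algebra"
  proof (rule idealI[OF ring_free_algebra])
    have "finite {w. x w + y w \<noteq> 0}" if "finite {w. x w \<noteq> 0}" "finite {w. y w \<noteq> 0}" for x y :: "gen list \<Rightarrow> 'a"
      using F.add.m_closed[of x y] that by simp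
    moreover have "inv\<^bsub>add_monoid free_algebra\<^esub> x = (\<lambda>w. - x w)" if "x \<in> ?J" for x
      using fa_minus[of x] that by (simp add: a_inv_def)
    ultimately show "subgroup ?J (add_monoid free_algebra)"
      by (intro subgroup.intro) (auto simp: algebra_simps)
    have fin: "finite {w. (x \<otimes>\<^bsub>free_algebra\<^esub> a) w \<noteq> 0}"
      if "finite {w. x w \<noteq> 0}" "finite {w. a w \<noteq> 0}" for x a :: "gen list \<Rightarrow> 'a"
      using F.m_closed[of x a] that by simp
    show "x \<otimes>\<^bsub>free_algebra\<^esub> a \<in> ?J" "a \<otimes>\<^bsub>free_algebra\<^esub> x \<in> ?J"
      if "a \<in> ?J" "x \<in> carrier free_algebra" for a x
      using that fin[of x a] fin[of a x] by (auto simp: atMost_Suc algebra_simps)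
  qed
  moreover have "qext_relations q \<subseteq> ?J"
    using qext_relations_carrier[of q] by (auto simp: qext_relations_def monomial_def)
  ultimately show "qext_ideal q \<subseteq> ?J"
    unfolding qext_ideal_def by (rule F.genideal_minimal)
next
  interpret F: ring "free_algebra :: (gen list \<Rightarrow> 'a) ring" by (rule ring_free_algebra)
  interpret I: ideal "qext_ideal q" free_algebra by (rule ideal_qext_ideal)
  let ?m = "monomial :: 'a \<Rightarrow> gen list \<Rightarrow> gen list \<Rightarrow> 'a"
  have rel: "r \<in> qext_ideal q" if "r \<in> qext_relations q" for r
    using F.genideal_self[OF qext_relations_carrier] that unfolding qext_ideal_def by blast
  have sq: "?m 1 [a, a] \<in> qext_ideal q" for a
    by (cases a) (auto intro!: rel simp: qext_relations_def)
  have ctx: "?m (c * d * e) (u @ v @ w) \<in> qext_ideal q" if "?m d v \<in> qext_ideal q" for c d e u v w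
  proof -
    have "?m c u \<otimes>\<^bsub>free_algebra\<^esub> (?m d v \<otimes>\<^bsub>free_algebra\<^esub> ?m e w) \<in> qext_ideal q"
      using that by (intro I.I_l_closed I.I_r_closed) auto
    then show ?thesis unfolding monomial_mult by (simp add: mult.assoc)
  qed
  let ?r = "?m 1 [gen_x, gen_y] \<oplus>\<^bsub>free_algebra\<^esub> ?m q [gen_y, gen_x]"
  have r: "?r \<in> qext_ideal q" by (rule rel) (simp add: qext_relations_def)
  have sum_mem: "f \<in> qext_ideal q"
    if "g \<in> qext_ideal q" "h \<in> qext_ideal q" "f = (\<lambda>w. g w + h w)" for f g h
    using I.a_closed[OF that(1,2)] that(3) by simp
  have mult_r: "?m c u \<otimes>\<^bsub>free_algebra\<^esub> ?r
      = (\<lambda>w. ?m c (u @ [gen_x, gen_y]) w + ?m (c * q) (u @ [gen_y, gen_x]) w)" for c u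
  proof -
    have "?m c u \<otimes>\<^bsub>free_algebra\<^esub> ?r = ?m c u \<otimes>\<^bsub>free_algebra\<^esub> ?m 1 [gen_x, gen_y]
        \<oplus>\<^bsub>free_algebra\<^esub> ?m c u \<otimes>\<^bsub>free_algebra\<^esub> ?m q [gen_y, gen_x]"
      by (rule F.r_distr) simp_all
    then show ?thesis unfolding monomial_mult fa_simps(4) by simp
  qed
  have r_mult: "?r \<otimes>\<^bsub>free_algebra\<^esub> ?m c u
      = (\<lambda>w. ?m c ([gen_x, gen_y] @ u) w + ?m (q * c) ([gen_y, gen_x] @ u) w)" for c u
  proof -
    have "?r \<otimes>\<^bsub>free_algebra\<^esub> ?m c u = ?m 1 [gen_x, gen_y] \<otimes>\<^bsub>free_algebra\<^esub> ?m c u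
        \<oplus>\<^bsub>free_algebra\<^esub> ?m q [gen_y, gen_x] \<otimes>\<^bsub>free_algebra\<^esub> ?m c u"
      by (rule F.l_distr) simp_all
    then show ?thesis unfolding monomial_mult fa_simps(4) by simp
  qed
  have xyx: "?m 1 [gen_x, gen_y, gen_x] \<in> qext_ideal q"
  proof (rule sum_mem)
    show "?r \<otimes>\<^bsub>free_algebra\<^esub> ?m 1 [gen_x] \<in> qext_ideal q" using r by (rule I.I_r_closed) simp
    show "?m (- q) [gen_y, gen_x, gen_x] \<in> qext_ideal q"
      using ctx[OF sq, of "-q" 1 "[gen_y]" gen_x "[]"] by simp
    show "?m 1 [gen_x, gen_y, gen_x] = (\<lambda>w. (?r \<otimes>\<^bsub>free_algebra\<^esub> ?m 1 [gen_x]) w + ?m (- q) [gen_y, gen_x, gen_x] w)"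
      unfolding r_mult by (auto simp: monomial_def fun_eq_iff)
  qed
  have yxy: "?m 1 [gen_y, gen_x, gen_y] \<in> qext_ideal q"
  proof (rule sum_mem)
    show "?m 1 [gen_y] \<otimes>\<^bsub>free_algebra\<^esub> ?r \<in> qext_ideal q" using r by (rule I.I_l_closed) simp
    show "?m (- q) [gen_y, gen_y, gen_x] \<in> qext_ideal q"
      using ctx[OF sq, of "-q" 1 "[]" gen_y "[gen_x]"] by simp
    show "?m 1 [gen_y, gen_x, gen_y] = (\<lambda>w. (?m 1 [gen_y] \<otimes>\<^bsub>free_algebra\<^esub> ?r) w + ?m (- q) [gen_y, gen_y, gen_x] w)"
      unfolding mult_r by (auto simp: monomial_def fun_eq_iff)
  qed
  let ?B = "{[], [gen_x], [gen_y], [gen_x, gen_y], [gen_y, gen_x]} :: gen list set"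
  have mono: "?m c w \<in> qext_ideal q" if notin: "w \<notin> ?B" for c w
  proof -
    obtain a v where av: "w = a # v" using notin by (cases w) auto
    then have "v \<noteq> []" using notin by (cases a) auto
    then obtain b w' where w: "w = a # b # w'" using av by (cases v) auto
    show ?thesis
    proof (cases "a = b")
      case True
      then show ?thesis using ctx[OF sq, of c 1 "[]" a w'] w by simp
    next
      case ab: False
      then have "w' \<noteq> []" using notin w by (cases a; cases b) auto
      then obtain d w'' where w': "w' = d # w''" by (cases w') auto
      show ?thesis
      proof (cases "b = d")
        case True
        then show ?thesis using ctx[OF sq, of c 1 "[a]" b w''] w w' by simp
      next
        case False
        then have "[a, b, d] = [gen_x, gen_y, gen_x] \<or> [a, b, d] = [gen_y, gen_x, gen_y]"
          using ab by (cases a; cases b; cases d) auto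
        then have "?m 1 [a, b, d] \<in> qext_ideal q" using xyx yxy by auto
        then show ?thesis using ctx[of 1 "[a, b, d]" c 1 "[]" w''] w w' by simp
      qed
    qed
  qed
  have supp: "f \<in> qext_ideal q" if "finite S" "S \<inter> ?B = {}" "{w. f w \<noteq> 0} \<subseteq> S" for S f
    using that
  proof (induction S arbitrary: f)
    case empty
    then have "f = \<zero>\<^bsub>free_algebra\<^esub>" by auto
    then show ?case using I.zero_closed by simp
  next
    case (insert w S)
    show ?case
    proof (rule sum_mem)
      show "f(w := 0) \<in> qext_ideal q" using insert.prems by (intro insert.IH) auto
      show "?m (f w) w \<in> qext_ideal q" using insert.prems by (intro mono) auto
      show "f = (\<lambda>v. (f(w := 0)) v + ?m (f w) w v)" by (auto simp: monomial_def)
    qed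
  qed
  show "?J \<subseteq> qext_ideal q"
  proof
    fix f assume f: "f \<in> ?J"
    define c where "c = f [gen_x, gen_y]"
    define s where "s = ?m c [] \<otimes>\<^bsub>free_algebra\<^esub> ?r"
    have s: "s = (\<lambda>w. ?m c [gen_x, gen_y] w + ?m (c * q) [gen_y, gen_x] w)"
      unfolding s_def mult_r by simp
    have smem: "s \<in> qext_ideal q" unfolding s_def using r by (rule I.I_l_closed) simp
    have fs: "(\<lambda>w. f w - s w) \<in> qext_ideal q"
    proof (rule supp)
      show "finite ({w. f w \<noteq> 0} - ?B)" using f by simp
      show "({w. f w \<noteq> 0} - ?B) \<inter> ?B = {}" by (subst Int_commute) (rule Diff_disjoint)
      show "{w. f w - s w \<noteq> 0} \<subseteq> {w. f w \<noteq> 0} - ?B"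
      proof
        fix w assume "w \<in> {w. f w - s w \<noteq> 0}"
        then have w: "f w \<noteq> s w" by simp
        have "w \<notin> ?B"
        proof
          assume "w \<in> ?B"
          then have "w = [] \<or> w = [gen_x] \<or> w = [gen_y] \<or> w = [gen_x, gen_y] \<or> w = [gen_y, gen_x]" by simp
          then show False using w f by (elim disjE) (simp_all add: s monomial_def c_def mult.commute)
        qed
        moreover from this have "s w = 0" by (simp add: s monomial_def)
        ultimately show "w \<in> {w. f w \<noteq> 0} - ?B" using w by simp
      qed
    qed
    have "f = (\<lambda>w. (f w - s w) + s w)" by (rule ext) (simp only: diff_add_cancel)
    with fs smem show "f \<in> qext_ideal q" by (rule sum_mem)
  qed
qed


text \<open>The normal form \<open>a + b x + c y + d y x\<close> and its class in the algebra.\<close>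
definition nform :: "'k \<Rightarrow> 'k \<Rightarrow> 'k \<Rightarrow> 'k \<Rightarrow> gen list \<Rightarrow> 'k::field" where
  "nform a b c d = (\<lambda>w. if w = [] then a else if w = [gen_x] then b else if w = [gen_y] then c
     else if w = [gen_y, gen_x] then d else 0)"

definition qel :: "'k::field \<Rightarrow> 'k \<Rightarrow> 'k \<Rightarrow> 'k \<Rightarrow> 'k \<Rightarrow> 'k qext" where
  "qel q a b c d = qext_ideal q +>\<^bsub>free_algebra\<^esub> nform a b c d"

lemma nform_carrier [simp]: "finite {w. nform a b c d w \<noteq> 0}"
  by (rule finite_subset[of _ "{[], [gen_x], [gen_y], [gen_y, gen_x]}"]) (auto simp: nform_def)

lemma nform_uminus: "\<ominus>\<^bsub>free_algebra\<^esub> nform a b c d = (\<lambda>w. - nform a b c d w)"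
  by (rule fa_minus) simp

lemma coset_eq_qel:
  assumes "f \<in> carrier free_algebra"
  shows "qext_ideal q +>\<^bsub>free_algebra\<^esub> f
    = qel q (f []) (f [gen_x]) (f [gen_y]) (f [gen_y, gen_x] - q * f [gen_x, gen_y])" (is "_ = qel q ?a ?b ?c ?d")
proof -
  interpret F: ring "free_algebra :: (gen list \<Rightarrow> 'a) ring" by (rule ring_free_algebra)
  have "f \<ominus>\<^bsub>free_algebra\<^esub> nform ?a ?b ?c ?d \<in> carrier free_algebra"
    by (rule F.minus_closed) (use assms in auto)
  then have "f \<ominus>\<^bsub>free_algebra\<^esub> nform ?a ?b ?c ?d \<in> qext_ideal q"
    by (simp add: qext_ideal_eq a_minus_def nform_uminus) (simp add: nform_def)
  then show ?thesis
    unfolding qel_def using assms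
    by (subst (asm) F.quotient_eq_iff_same_a_r_cos[OF ideal_qext_ideal]) auto
qed

lemma qel_eq_iff [simp]:
  "qel q a b c d = qel q a' b' c' d' \<longleftrightarrow> a = a' \<and> b = b' \<and> c = c' \<and> d = d'"
proof
  interpret F: ring "free_algebra :: (gen list \<Rightarrow> 'a) ring" by (rule ring_free_algebra)
  assume "qel q a b c d = qel q a' b' c' d'"
  then have "nform a b c d \<ominus>\<^bsub>free_algebra\<^esub> nform a' b' c' d' \<in> qext_ideal q"
    unfolding qel_def by (subst F.quotient_eq_iff_same_a_r_cos[OF ideal_qext_ideal]) auto
  then show "a = a' \<and> b = b' \<and> c = c' \<and> d = d'"
    by (simp add: qext_ideal_eq a_minus_def nform_uminus) (simp add: nform_def)
qed simp

lemma carrier_qext: "carrier (qext q) = {qel q a b c d | a b c d. True}"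
proof -
  have "carrier (qext q) = {qext_ideal q +>\<^bsub>free_algebra\<^esub> f | f. f \<in> carrier free_algebra}"
    by (auto simp: qext_def FactRing_def A_RCOSETS_def')
  also have "\<dots> = {qel q a b c d | a b c d. True}"
  proof (intro equalityI subsetI)
    fix u assume "u \<in> {qext_ideal q +>\<^bsub>free_algebra\<^esub> f | f. f \<in> carrier free_algebra}"
    then obtain f where "u = qext_ideal q +>\<^bsub>free_algebra\<^esub> f" "f \<in> carrier free_algebra" by blast
    then show "u \<in> {qel q a b c d | a b c d. True}" using coset_eq_qel by blast
  next
    fix u assume "u \<in> {qel q a b c d | a b c d. True}"
    then show "u \<in> {qext_ideal q +>\<^bsub>free_algebra\<^esub> f | f. f \<in> carrier free_algebra}"
      unfolding qel_def by force
  qed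
  finally show ?thesis .
qed

lemma qel_in_carrier [simp, intro]: "qel q a b c d \<in> carrier (qext q)"
  by (auto simp: carrier_qext)

lemma qext_cases:
  assumes "u \<in> carrier (qext q)"
  obtains a b c d where "u = qel q a b c d"
  using assms by (auto simp: carrier_qext)

lemma qel_add [simp]:
  "qel q a b c d \<oplus>\<^bsub>qext q\<^esub> qel q a' b' c' d' = qel q (a + a') (b + b') (c + c') (d + d')"
proof -
  interpret F: ring "free_algebra :: (gen list \<Rightarrow> 'a) ring" by (rule ring_free_algebra)
  have ac: "nform a b c d \<oplus>\<^bsub>free_algebra\<^esub> nform a' b' c' d' \<in> carrier free_algebra"
    by (rule F.a_closed) simp_all
  have "qel q a b c d \<oplus>\<^bsub>qext q\<^esub> qel q a' b' c' d'
      = qext_ideal q +>\<^bsub>free_algebra\<^esub> (nform a b c d \<oplus>\<^bsub>free_algebra\<^esub> nform a' b' c' d')"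
    by (simp add: qel_def qext_def FactRing_def ideal.a_rcos_sum[OF ideal_qext_ideal] del: fa_simps(4))
  also have "\<dots> = qel q (a + a') (b + b') (c + c') (d + d')"
    unfolding coset_eq_qel[OF ac]
    by (simp add: nform_def)
  finally show ?thesis .
qed

text \<open>The multiplication table, with \<open>x y = - q (y x)\<close>.\<close>

lemma qel_mult [simp]:
  "qel q a b c d \<otimes>\<^bsub>qext q\<^esub> qel q a' b' c' d'
    = qel q (a * a') (a * b' + b * a') (a * c' + c * a') (a * d' + d * a' + c * b' - q * (b * c'))"
proof -
  interpret F: ring "free_algebra :: (gen list \<Rightarrow> 'a) ring" by (rule ring_free_algebra)
  have mc: "nform a b c d \<otimes>\<^bsub>free_algebra\<^esub> nform a' b' c' d' \<in> carrier free_algebra"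
    by (rule F.m_closed) simp_all
  have "qel q a b c d \<otimes>\<^bsub>qext q\<^esub> qel q a' b' c' d'
      = qext_ideal q +>\<^bsub>free_algebra\<^esub> (nform a b c d \<otimes>\<^bsub>free_algebra\<^esub> nform a' b' c' d')"
    by (simp add: qel_def qext_def FactRing_def ideal.rcoset_mult_add[OF ideal_qext_ideal] del: fa_simps(5))
  also have "\<dots> = qel q (a * a') (a * b' + b * a') (a * c' + c * a') (a * d' + d * a' + c * b' - q * (b * c'))"
    unfolding coset_eq_qel[OF mc] by (simp add: nform_def atMost_Suc)
  finally show ?thesis .
qed

lemma qext_zero: "\<zero>\<^bsub>qext q\<^esub> = qel q 0 0 0 0"
proof -
  interpret ring "qext q" by (rule ring_qext)
  have "qel q 0 0 0 0 \<oplus>\<^bsub>qext q\<^esub> qel q 0 0 0 0 = qel q 0 0 0 0" by simp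
  then show ?thesis using add.l_cancel_one'[of "qel q 0 0 0 0" "qel q 0 0 0 0"] by simp
qed

lemma qext_one: "\<one>\<^bsub>qext q\<^esub> = qel q 1 0 0 0"
proof -
  have "\<one>\<^bsub>qext q\<^esub> = qext_ideal q +>\<^bsub>free_algebra\<^esub> \<one>\<^bsub>free_algebra\<^esub>"
    by (simp add: qext_def FactRing_def)
  then show ?thesis by (subst (asm) coset_eq_qel) simp_all
qed

lemma qext_gen_x: "qext_gen q gen_x = qel q 0 1 0 0"
  unfolding qext_gen_def by (subst coset_eq_qel) (simp_all add: monomial_def)

lemma qext_gen_y: "qext_gen q gen_y = qel q 0 0 1 0"
  unfolding qext_gen_def by (subst coset_eq_qel) (simp_all add: monomial_def)

lemma qext_scalars_eq: "qext_scalars q = {qel q c 0 0 0 | c. True}"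
proof -
  have "qext_ideal q +>\<^bsub>free_algebra\<^esub> monomial c [] = qel q c 0 0 0" for c
    by (subst coset_eq_qel) (simp_all add: monomial_def)
  then show ?thesis unfolding qext_scalars_def by auto
qed

lemma qel_uminus [simp]: "\<ominus>\<^bsub>qext q\<^esub> qel q a b c d = qel q (- a) (- b) (- c) (- d)"
proof -
  interpret ring "qext q" by (rule ring_qext)
  show ?thesis by (rule minus_equality) (simp_all add: qext_zero)
qed


section \<open>Modules over the quantum exterior algebra\<close>

locale quantum_exterior =
  fixes q :: "'k::field"
  assumes q_nonzero: "q \<noteq> 0"
begin

abbreviation "A \<equiv> qext q"
abbreviation "el \<equiv> qel q"
abbreviation "sc c \<equiv> qel q c 0 0 0"
abbreviation "xx \<equiv> qel q 0 1 0 0"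
abbreviation "yy \<equiv> qel q 0 0 1 0"
abbreviation "tt \<equiv> qel q 0 0 0 1"
abbreviation "RM \<equiv> regular_module A"

lemma ring_A: "ring A" by (rule ring_qext)

lemma left_module_RM: "left_module A RM" by (rule left_module_regular[OF ring_A])

lemma el_decomp:
  assumes "left_module A M" "z \<in> carrier M"
  shows "el a b c d \<odot>\<^bsub>M\<^esub> z = sc a \<odot>\<^bsub>M\<^esub> z \<oplus>\<^bsub>M\<^esub> sc b \<odot>\<^bsub>M\<^esub> (xx \<odot>\<^bsub>M\<^esub> z)
    \<oplus>\<^bsub>M\<^esub> sc c \<odot>\<^bsub>M\<^esub> (yy \<odot>\<^bsub>M\<^esub> z) \<oplus>\<^bsub>M\<^esub> sc d \<odot>\<^bsub>M\<^esub> (tt \<odot>\<^bsub>M\<^esub> z)"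
proof -
  interpret left_module A M by fact
  have "el a b c d = sc a \<oplus>\<^bsub>A\<^esub> sc b \<otimes>\<^bsub>A\<^esub> xx \<oplus>\<^bsub>A\<^esub> sc c \<otimes>\<^bsub>A\<^esub> yy \<oplus>\<^bsub>A\<^esub> sc d \<otimes>\<^bsub>A\<^esub> tt" by simp
  then show ?thesis using assms(2) by (simp only: smult_l_distr smult_assoc1 qel_in_carrier R.m_closed R.a_closed)
qed

text \<open>The ground field acts on a module through the elements \<open>sc c\<close> of \<open>A\<close>. Subspaces and linear
  functionals refer to this action.\<close>
definition subspace :: "('k qext, 'm, 'c) module_scheme \<Rightarrow> 'm set \<Rightarrow> bool" where
  "subspace M W \<longleftrightarrow> W \<subseteq> carrier M \<and> \<zero>\<^bsub>M\<^esub> \<in> W \<and> (\<forall>u\<in>W. \<forall>v\<in>W. u \<oplus>\<^bsub>M\<^esub> v \<in> W) \<and>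
     (\<forall>c. \<forall>u\<in>W. sc c \<odot>\<^bsub>M\<^esub> u \<in> W)"

definition functional :: "('k qext, 'm, 'c) module_scheme \<Rightarrow> 'm set \<Rightarrow> ('m \<Rightarrow> 'k) \<Rightarrow> bool" where
  "functional M W \<phi> \<longleftrightarrow> (\<forall>u\<in>W. \<forall>v\<in>W. \<phi> (u \<oplus>\<^bsub>M\<^esub> v) = \<phi> u + \<phi> v) \<and>
     (\<forall>c. \<forall>u\<in>W. \<phi> (sc c \<odot>\<^bsub>M\<^esub> u) = c * \<phi> u)"

lemma submodule_subspace: "submodule U A M \<Longrightarrow> subspace M U"
  by (auto simp: subspace_def submodule_simps dest: submodule_subset)

lemma sc_uminus_one:
  assumes "left_module A M" "z \<in> carrier M"
  shows "sc (- 1) \<odot>\<^bsub>M\<^esub> z = \<ominus>\<^bsub>M\<^esub> z"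
proof -
  interpret left_module A M by fact
  show ?thesis using smult_uminus_one[OF assms(2)] by (simp add: qext_one)
qed

lemma sc_simps:
  assumes "left_module A M" "z \<in> carrier M"
  shows "sc 0 \<odot>\<^bsub>M\<^esub> z = \<zero>\<^bsub>M\<^esub>" "sc 1 \<odot>\<^bsub>M\<^esub> z = z"
    "sc a \<odot>\<^bsub>M\<^esub> (sc b \<odot>\<^bsub>M\<^esub> z) = sc (a * b) \<odot>\<^bsub>M\<^esub> z"
    "sc a \<odot>\<^bsub>M\<^esub> z \<oplus>\<^bsub>M\<^esub> sc b \<odot>\<^bsub>M\<^esub> z = sc (a + b) \<odot>\<^bsub>M\<^esub> z"
proof -
  interpret left_module A M by fact
  show "sc 0 \<odot>\<^bsub>M\<^esub> z = \<zero>\<^bsub>M\<^esub>" "sc 1 \<odot>\<^bsub>M\<^esub> z = z"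
    using smult_zero_left[OF assms(2)] smult_one[OF assms(2)] by (simp_all add: qext_zero qext_one)
  show "sc a \<odot>\<^bsub>M\<^esub> (sc b \<odot>\<^bsub>M\<^esub> z) = sc (a * b) \<odot>\<^bsub>M\<^esub> z"
    using smult_assoc1[of "sc a" "sc b" z] assms(2) by simp
  show "sc a \<odot>\<^bsub>M\<^esub> z \<oplus>\<^bsub>M\<^esub> sc b \<odot>\<^bsub>M\<^esub> z = sc (a + b) \<odot>\<^bsub>M\<^esub> z"
    using smult_l_distr[of "sc a" "sc b" z] assms(2) by simp
qed

lemma subspace_diff_scaled:
  assumes M: "left_module A M" and W: "subspace M W" and uv: "u \<in> W" "u' \<in> W"
    and w: "w \<in> carrier M" and eq: "u \<oplus>\<^bsub>M\<^esub> sc c \<odot>\<^bsub>M\<^esub> w = u' \<oplus>\<^bsub>M\<^esub> sc c' \<odot>\<^bsub>M\<^esub> w" and ne: "c \<noteq> c'"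
  shows "w \<in> W"
proof -
  interpret left_module A M by fact
  have uc: "u \<in> carrier M" "u' \<in> carrier M" using W uv by (auto simp: subspace_def)
  have "sc (c - c') \<odot>\<^bsub>M\<^esub> w = sc c \<odot>\<^bsub>M\<^esub> w \<oplus>\<^bsub>M\<^esub> sc (- c') \<odot>\<^bsub>M\<^esub> w" using sc_simps[OF M w] by simp
  also have "sc c \<odot>\<^bsub>M\<^esub> w = u' \<oplus>\<^bsub>M\<^esub> sc c' \<odot>\<^bsub>M\<^esub> w \<oplus>\<^bsub>M\<^esub> (\<ominus>\<^bsub>M\<^esub> u)"
  proof -
    have "sc c \<odot>\<^bsub>M\<^esub> w = (\<ominus>\<^bsub>M\<^esub> u) \<oplus>\<^bsub>M\<^esub> (u \<oplus>\<^bsub>M\<^esub> sc c \<odot>\<^bsub>M\<^esub> w)"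
      using uc w by (simp add: M.a_assoc[symmetric] M.l_neg)
    then show ?thesis unfolding eq using uc w by (simp add: M.a_comm)
  qed
  also have "\<dots> \<oplus>\<^bsub>M\<^esub> sc (- c') \<odot>\<^bsub>M\<^esub> w = u' \<oplus>\<^bsub>M\<^esub> (\<ominus>\<^bsub>M\<^esub> u) \<oplus>\<^bsub>M\<^esub> (sc c' \<odot>\<^bsub>M\<^esub> w \<oplus>\<^bsub>M\<^esub> sc (- c') \<odot>\<^bsub>M\<^esub> w)"
    using uc w by (simp add: M.a_ac)
  also have "\<dots> = u' \<oplus>\<^bsub>M\<^esub> sc (- 1) \<odot>\<^bsub>M\<^esub> u"
    using sc_simps[OF M w] uc sc_uminus_one[OF M uc(1)] by simp
  finally have "sc (c - c') \<odot>\<^bsub>M\<^esub> w \<in> W" using W uv by (simp add: subspace_def)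
  then have "sc (1 / (c - c')) \<odot>\<^bsub>M\<^esub> (sc (c - c') \<odot>\<^bsub>M\<^esub> w) \<in> W" using W by (simp add: subspace_def)
  then show ?thesis using sc_simps[OF M w] ne by simp
qed

text \<open>The value \<open>t\<close> of the extension at a new vector can be prescribed. This is used to separate a
  vector from a subspace.\<close>
lemma functional_extend_one:
  assumes M: "left_module A M" and W: "subspace M W" and phi: "functional M W \<phi>"
    and w: "w \<in> carrier M"
  obtains W' \<phi>' where "subspace M W'" "functional M W' \<phi>'" "W \<subseteq> W'" "w \<in> W'"
    "\<And>u. u \<in> W \<Longrightarrow> \<phi>' u = \<phi> u" "w \<notin> W \<Longrightarrow> \<phi>' w = t"
proof (cases "w \<in> W")
  case True
  then show ?thesis using that[of W \<phi>] W phi by blast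
next
  case False
  interpret left_module A M by fact
  have Wc: "\<And>u. u \<in> W \<Longrightarrow> u \<in> carrier M" and W0: "\<zero>\<^bsub>M\<^esub> \<in> W"
    and Wadd: "\<And>u v. u \<in> W \<Longrightarrow> v \<in> W \<Longrightarrow> u \<oplus>\<^bsub>M\<^esub> v \<in> W" and Wsc: "\<And>c u. u \<in> W \<Longrightarrow> sc c \<odot>\<^bsub>M\<^esub> u \<in> W"
    using W by (auto simp: subspace_def)
  have padd: "\<And>u v. u \<in> W \<Longrightarrow> v \<in> W \<Longrightarrow> \<phi> (u \<oplus>\<^bsub>M\<^esub> v) = \<phi> u + \<phi> v"
    and psc: "\<And>c u. u \<in> W \<Longrightarrow> \<phi> (sc c \<odot>\<^bsub>M\<^esub> u) = c * \<phi> u"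
    using phi by (auto simp: functional_def)
  have p0: "\<phi> \<zero>\<^bsub>M\<^esub> = 0" using psc[OF W0, of 0] by simp
  let ?W = "{u \<oplus>\<^bsub>M\<^esub> sc c \<odot>\<^bsub>M\<^esub> w | u c. u \<in> W}"
  define \<psi> where "\<psi> z = (THE s. \<exists>u c. u \<in> W \<and> z = u \<oplus>\<^bsub>M\<^esub> sc c \<odot>\<^bsub>M\<^esub> w \<and> s = \<phi> u + c * t)" for z
  have psi: "\<psi> (u \<oplus>\<^bsub>M\<^esub> sc c \<odot>\<^bsub>M\<^esub> w) = \<phi> u + c * t" if u: "u \<in> W" for u c
    unfolding \<psi>_def
  proof (rule the_equality)
    show "\<exists>u' c'. u' \<in> W \<and> u \<oplus>\<^bsub>M\<^esub> sc c \<odot>\<^bsub>M\<^esub> w = u' \<oplus>\<^bsub>M\<^esub> sc c' \<odot>\<^bsub>M\<^esub> w \<and> \<phi> u + c * t = \<phi> u' + c' * t"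
      using u by blast
    fix s assume "\<exists>u' c'. u' \<in> W \<and> u \<oplus>\<^bsub>M\<^esub> sc c \<odot>\<^bsub>M\<^esub> w = u' \<oplus>\<^bsub>M\<^esub> sc c' \<odot>\<^bsub>M\<^esub> w \<and> s = \<phi> u' + c' * t"
    then obtain u' c' where u': "u' \<in> W" "u \<oplus>\<^bsub>M\<^esub> sc c \<odot>\<^bsub>M\<^esub> w = u' \<oplus>\<^bsub>M\<^esub> sc c' \<odot>\<^bsub>M\<^esub> w" "s = \<phi> u' + c' * t" by blast
    then have "c = c'" using subspace_diff_scaled[OF M W u u'(1) w u'(2)] False by blast
    then have "u = u'" using u'(2) Wc[OF u] Wc[OF u'(1)] w by simp
    then show "s = \<phi> u + c * t" using u'(3) \<open>c = c'\<close> by simp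
  qed
  have addW: "(u \<oplus>\<^bsub>M\<^esub> sc c \<odot>\<^bsub>M\<^esub> w) \<oplus>\<^bsub>M\<^esub> (u' \<oplus>\<^bsub>M\<^esub> sc c' \<odot>\<^bsub>M\<^esub> w) = (u \<oplus>\<^bsub>M\<^esub> u') \<oplus>\<^bsub>M\<^esub> sc (c + c') \<odot>\<^bsub>M\<^esub> w"
    if "u \<in> W" "u' \<in> W" for u u' c c'
    using Wc[OF that(1)] Wc[OF that(2)] w by (simp add: sc_simps(4)[OF M w, symmetric] M.a_ac)
  have scW: "sc b \<odot>\<^bsub>M\<^esub> (u \<oplus>\<^bsub>M\<^esub> sc c \<odot>\<^bsub>M\<^esub> w) = sc b \<odot>\<^bsub>M\<^esub> u \<oplus>\<^bsub>M\<^esub> sc (b * c) \<odot>\<^bsub>M\<^esub> w"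
    if "u \<in> W" for u b c
    using Wc[OF that] w by (simp add: smult_r_distr sc_simps(3)[OF M w])
  have inW: "u \<in> ?W" "\<psi> u = \<phi> u" if "u \<in> W" for u
  proof -
    have "u = u \<oplus>\<^bsub>M\<^esub> sc 0 \<odot>\<^bsub>M\<^esub> w" using sc_simps(1)[OF M w] Wc[OF that] by simp
    then show "u \<in> ?W" "\<psi> u = \<phi> u" using psi[OF that, of 0] that by (blast, simp)
  qed
  have ww: "w = \<zero>\<^bsub>M\<^esub> \<oplus>\<^bsub>M\<^esub> sc 1 \<odot>\<^bsub>M\<^esub> w" using sc_simps(2)[OF M w] w by simp
  show ?thesis
  proof (rule that[of ?W \<psi>])
    show "W \<subseteq> ?W" using inW(1) by blast
    show "w \<in> ?W" using ww W0 by blast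
    show "\<psi> w = t" using psi[OF W0, of 1] ww p0 by simp
    show "\<psi> u = \<phi> u" if "u \<in> W" for u using inW(2) that .
    show "subspace M ?W" unfolding subspace_def
    proof (intro conjI ballI allI)
      show "?W \<subseteq> carrier M" using Wc w by auto
      show "\<zero>\<^bsub>M\<^esub> \<in> ?W" using inW(1)[OF W0] .
      show "u \<oplus>\<^bsub>M\<^esub> v \<in> ?W" if uv: "u \<in> ?W" "v \<in> ?W" for u v
      proof -
        obtain u1 c v1 d where "u = u1 \<oplus>\<^bsub>M\<^esub> sc c \<odot>\<^bsub>M\<^esub> w" "u1 \<in> W" "v = v1 \<oplus>\<^bsub>M\<^esub> sc d \<odot>\<^bsub>M\<^esub> w" "v1 \<in> W"
          using uv by blast
        then have "u \<oplus>\<^bsub>M\<^esub> v = (u1 \<oplus>\<^bsub>M\<^esub> v1) \<oplus>\<^bsub>M\<^esub> sc (c + d) \<odot>\<^bsub>M\<^esub> w" "u1 \<oplus>\<^bsub>M\<^esub> v1 \<in> W"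
          using addW Wadd by simp_all
        then show ?thesis by blast
      qed
      show "sc c \<odot>\<^bsub>M\<^esub> u \<in> ?W" if uW: "u \<in> ?W" for c u
      proof -
        obtain u1 d where "u = u1 \<oplus>\<^bsub>M\<^esub> sc d \<odot>\<^bsub>M\<^esub> w" "u1 \<in> W" using uW by blast
        then have "sc c \<odot>\<^bsub>M\<^esub> u = sc c \<odot>\<^bsub>M\<^esub> u1 \<oplus>\<^bsub>M\<^esub> sc (c * d) \<odot>\<^bsub>M\<^esub> w" "sc c \<odot>\<^bsub>M\<^esub> u1 \<in> W"
          using scW Wsc by simp_all
        then show ?thesis by blast
      qed
    qed
    show "functional M ?W \<psi>" unfolding functional_def
    proof (intro conjI ballI allI)
      fix u assume "u \<in> ?W"
      then obtain u1 c1 where u: "u = u1 \<oplus>\<^bsub>M\<^esub> sc c1 \<odot>\<^bsub>M\<^esub> w" "u1 \<in> W" by blast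
      show "\<psi> (sc c \<odot>\<^bsub>M\<^esub> u) = c * \<psi> u" for c
        using u scW psi Wsc psc by (simp add: algebra_simps)
      fix v assume "v \<in> ?W"
      then obtain v1 d1 where v: "v = v1 \<oplus>\<^bsub>M\<^esub> sc d1 \<odot>\<^bsub>M\<^esub> w" "v1 \<in> W" by blast
      show "\<psi> (u \<oplus>\<^bsub>M\<^esub> v) = \<psi> u + \<psi> v"
        using u v addW psi Wadd padd by (simp add: algebra_simps)
    qed
  qed
qed

text \<open>By maximality of \<open>U i\<close>, any element of \<open>U (Suc i)\<close> outside \<open>U i\<close> serves as \<open>v\<close>.\<close>
lemma composition_series_step:
  assumes M: "left_module R M" and cs: "composition_series R M n U" and i: "i < n"
  obtains v where "v \<in> carrier M" "U (Suc i) = {u \<oplus>\<^bsub>M\<^esub> a \<odot>\<^bsub>M\<^esub> v | u a. u \<in> U i \<and> a \<in> carrier R}"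
proof -
  interpret left_module R M by fact
  have sub: "submodule (U i) R M" "submodule (U (Suc i)) R M" and ss: "U i \<subset> U (Suc i)"
    and mx: "\<And>V. submodule V R M \<Longrightarrow> U i \<subseteq> V \<Longrightarrow> V \<subseteq> U (Suc i) \<Longrightarrow> V = U i \<or> V = U (Suc i)"
    using cs i by (auto simp: composition_series_def)
  obtain v where v: "v \<in> U (Suc i)" "v \<notin> U i" using ss by blast
  have Uc: "\<And>u. u \<in> U (Suc i) \<Longrightarrow> u \<in> carrier M" using submodule_subset[OF sub(2)] by auto
  have vc: "v \<in> carrier M" using v Uc by auto
  let ?V = "{u \<oplus>\<^bsub>M\<^esub> a \<odot>\<^bsub>M\<^esub> v | u a. u \<in> U i \<and> a \<in> carrier R}"
  have "U i \<subseteq> ?V"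
  proof
    fix u assume u: "u \<in> U i"
    then have "u = u \<oplus>\<^bsub>M\<^esub> \<zero>\<^bsub>R\<^esub> \<odot>\<^bsub>M\<^esub> v" using vc ss Uc by auto
    then show "u \<in> ?V" using u by blast
  qed
  moreover have "v \<in> ?V"
  proof -
    have "v = \<zero>\<^bsub>M\<^esub> \<oplus>\<^bsub>M\<^esub> \<one>\<^bsub>R\<^esub> \<odot>\<^bsub>M\<^esub> v" using vc by simp
    then show ?thesis using submodule_zero[OF sub(1)] by blast
  qed
  moreover have "?V \<subseteq> U (Suc i)"
    using ss v submodule_simps[OF sub(2)] by auto
  ultimately have "U (Suc i) = ?V"
    using mx[OF submodule_extend[OF M sub(1) vc]] v by blast
  then show ?thesis using that vc by blast
qed

lemma functional_extend_list:
  assumes M: "left_module A M"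
  shows "subspace M W \<Longrightarrow> functional M W \<phi> \<Longrightarrow> set ws \<subseteq> carrier M \<Longrightarrow>
    \<exists>W' \<phi>'. subspace M W' \<and> functional M W' \<phi>' \<and> W \<subseteq> W' \<and> set ws \<subseteq> W' \<and> (\<forall>u\<in>W. \<phi>' u = \<phi> u)"
proof (induction ws arbitrary: W \<phi>)
  case Nil
  then show ?case by (intro exI[of _ W] exI[of _ \<phi>]) simp
next
  case (Cons w ws)
  obtain W1 \<phi>1 where 1: "subspace M W1" "functional M W1 \<phi>1" "W \<subseteq> W1" "w \<in> W1" "\<And>u. u \<in> W \<Longrightarrow> \<phi>1 u = \<phi> u"
    using functional_extend_one[OF M Cons.prems(1,2), of w 0] Cons.prems(3) by (metis list.set_intros(1) subsetD)
  obtain W2 \<phi>2 where 2: "subspace M W2" "functional M W2 \<phi>2" "W1 \<subseteq> W2" "set ws \<subseteq> W2" "\<forall>u\<in>W1. \<phi>2 u = \<phi>1 u"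
    using Cons.IH[OF 1(1,2)] Cons.prems(3) by auto
  have "\<forall>u\<in>W. \<phi>2 u = \<phi> u" using 1(3,5) 2(5) by (simp add: subset_iff)
  moreover have "W \<subseteq> W2" "set (w # ws) \<subseteq> W2" using 1(3,4) 2(3,4) by auto
  ultimately show ?case using 2(1,2) by blast
qed

text \<open>Finite length provides a finite generating set: each step of a composition series is generated
  over the previous one by a single element \<open>v\<close>, hence spanned by \<open>v\<close>, \<open>x v\<close>, \<open>y v\<close> and \<open>y x v\<close>.\<close>
lemma functional_extend:
  assumes fl: "fl_module A M" and W: "subspace M W" and phi: "functional M W \<phi>"
  obtains \<psi> where "functional M (carrier M) \<psi>" "\<And>u. u \<in> W \<Longrightarrow> \<psi> u = \<phi> u"
proof -
  have M: "left_module A M" using fl by (rule fl_module_left_module)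
  interpret left_module A M by fact
  obtain n U where cs: "composition_series A M n U" using fl by (auto simp: fl_module_def)
  have "\<exists>W' \<psi>. subspace M W' \<and> functional M W' \<psi> \<and> W \<subseteq> W' \<and> U i \<subseteq> W' \<and> (\<forall>u\<in>W. \<psi> u = \<phi> u)"
    if "i \<le> n" for i
    using that
  proof (induction i)
    case 0
    then show ?case using W phi cs by (intro exI[of _ W] exI[of _ \<phi>]) (auto simp: composition_series_def subspace_def)
  next
    case (Suc i)
    then obtain W0 \<phi>0 where 0: "subspace M W0" "functional M W0 \<phi>0" "W \<subseteq> W0" "U i \<subseteq> W0" "\<forall>u\<in>W. \<phi>0 u = \<phi> u" by auto
    obtain v where v: "v \<in> carrier M" "U (Suc i) = {u \<oplus>\<^bsub>M\<^esub> a \<odot>\<^bsub>M\<^esub> v | u a. u \<in> U i \<and> a \<in> carrier A}"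
      using composition_series_step[OF M cs, of i] Suc.prems by auto
    have "set [v, xx \<odot>\<^bsub>M\<^esub> v, yy \<odot>\<^bsub>M\<^esub> v, tt \<odot>\<^bsub>M\<^esub> v] \<subseteq> carrier M" using v(1) by simp
    from functional_extend_list[OF M 0(1,2) this] obtain W1 \<phi>1 where
      1: "subspace M W1" "functional M W1 \<phi>1" "W0 \<subseteq> W1" "\<forall>u\<in>W0. \<phi>1 u = \<phi>0 u"
      and gens: "v \<in> W1" "xx \<odot>\<^bsub>M\<^esub> v \<in> W1" "yy \<odot>\<^bsub>M\<^esub> v \<in> W1" "tt \<odot>\<^bsub>M\<^esub> v \<in> W1"
      by auto
    have add: "\<And>u w. u \<in> W1 \<Longrightarrow> w \<in> W1 \<Longrightarrow> u \<oplus>\<^bsub>M\<^esub> w \<in> W1" and sc: "\<And>c u. u \<in> W1 \<Longrightarrow> sc c \<odot>\<^bsub>M\<^esub> u \<in> W1"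
      using 1(1) by (auto simp: subspace_def)
    have "U (Suc i) \<subseteq> W1"
    proof
      fix z assume "z \<in> U (Suc i)"
      then obtain u a where z: "z = u \<oplus>\<^bsub>M\<^esub> a \<odot>\<^bsub>M\<^esub> v" "u \<in> U i" "a \<in> carrier A" using v(2) by auto
      obtain a0 a1 a2 a3 where a: "a = el a0 a1 a2 a3" using z(3) by (rule qext_cases)
      have "a \<odot>\<^bsub>M\<^esub> v \<in> W1"
        unfolding a by (subst el_decomp[OF M v(1)]) (intro add sc gens)
      moreover have "u \<in> W1" using z(2) 0(4) 1(3) by blast
      ultimately show "z \<in> W1" using z(1) add by simp
    qed
    moreover have "\<forall>u\<in>W. \<phi>1 u = \<phi> u" using 0(3,5) 1(4) by (simp add: subset_iff)
    moreover have "W \<subseteq> W1" using 0(3) 1(3) by blast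
    ultimately show ?case using 1(1,2) by blast
  qed
  from this[of n] obtain W' \<psi> where W': "subspace M W'" "functional M W' \<psi>" "U n \<subseteq> W'" "\<forall>u\<in>W. \<psi> u = \<phi> u" by auto
  have "W' = carrier M" using W'(1,3) cs by (auto simp: subspace_def composition_series_def)
  then show ?thesis using that[of \<psi>] W'(2,4) by simp
qed

text \<open>The Frobenius property. If \<open>f\<close> is a homomorphism to \<open>A\<close> and \<open>\<phi> z\<close> is the coefficient of \<open>y x\<close> in
  \<open>f z\<close>, then the other coefficients of \<open>f z\<close> are the coefficients of \<open>y x\<close> in \<open>y x f z\<close>, in \<open>y f z\<close>
  and, up to the factor \<open>- q\<close>, in \<open>x f z\<close>; this forces the formula. That it does define a
  homomorphism is a calculation with the multiplication table.\<close>
lemma hom_of_functional: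
  assumes M: "left_module A M" and phi: "functional M (carrier M) \<phi>"
  shows "(\<lambda>z\<in>carrier M. el (\<phi> (tt \<odot>\<^bsub>M\<^esub> z)) (\<phi> (yy \<odot>\<^bsub>M\<^esub> z)) (- \<phi> (xx \<odot>\<^bsub>M\<^esub> z) / q) (\<phi> z)) \<in> lmod_hom A M RM"
proof (rule lmod_hom_restrictI[OF M])
  interpret left_module A M by fact
  have padd: "\<And>u v. u \<in> carrier M \<Longrightarrow> v \<in> carrier M \<Longrightarrow> \<phi> (u \<oplus>\<^bsub>M\<^esub> v) = \<phi> u + \<phi> v"
    and psc: "\<And>c u. u \<in> carrier M \<Longrightarrow> \<phi> (sc c \<odot>\<^bsub>M\<^esub> u) = c * \<phi> u"
    using phi by (auto simp: functional_def)
  have exp: "\<phi> (el a b c d \<odot>\<^bsub>M\<^esub> z) = a * \<phi> z + b * \<phi> (xx \<odot>\<^bsub>M\<^esub> z) + c * \<phi> (yy \<odot>\<^bsub>M\<^esub> z) + d * \<phi> (tt \<odot>\<^bsub>M\<^esub> z)"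
    if "z \<in> carrier M" for a b c d z
    using that by (subst el_decomp[OF M that]) (simp add: padd psc)
  fix z assume z: "z \<in> carrier M"
  show "el (\<phi> (tt \<odot>\<^bsub>M\<^esub> z)) (\<phi> (yy \<odot>\<^bsub>M\<^esub> z)) (- \<phi> (xx \<odot>\<^bsub>M\<^esub> z) / q) (\<phi> z) \<in> carrier RM" by simp
  show "el (\<phi> (tt \<odot>\<^bsub>M\<^esub> (z \<oplus>\<^bsub>M\<^esub> z'))) (\<phi> (yy \<odot>\<^bsub>M\<^esub> (z \<oplus>\<^bsub>M\<^esub> z'))) (- \<phi> (xx \<odot>\<^bsub>M\<^esub> (z \<oplus>\<^bsub>M\<^esub> z')) / q) (\<phi> (z \<oplus>\<^bsub>M\<^esub> z'))
    = el (\<phi> (tt \<odot>\<^bsub>M\<^esub> z)) (\<phi> (yy \<odot>\<^bsub>M\<^esub> z)) (- \<phi> (xx \<odot>\<^bsub>M\<^esub> z) / q) (\<phi> z) \<oplus>\<^bsub>RM\<^esub>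
      el (\<phi> (tt \<odot>\<^bsub>M\<^esub> z')) (\<phi> (yy \<odot>\<^bsub>M\<^esub> z')) (- \<phi> (xx \<odot>\<^bsub>M\<^esub> z') / q) (\<phi> z')" if "z' \<in> carrier M" for z'
    using z that by (simp add: smult_r_distr padd diff_divide_distrib)
  fix a assume "a \<in> carrier A"
  then obtain a0 a1 a2 a3 where a: "a = el a0 a1 a2 a3" by (rule qext_cases)
  have r: "\<phi> (r \<odot>\<^bsub>M\<^esub> (a \<odot>\<^bsub>M\<^esub> z)) = \<phi> ((r \<otimes>\<^bsub>A\<^esub> a) \<odot>\<^bsub>M\<^esub> z)" if "r \<in> carrier A" for r
    using smult_assoc1[OF that _ z, of a] a by simp
  have t: "\<phi> (tt \<odot>\<^bsub>M\<^esub> (a \<odot>\<^bsub>M\<^esub> z)) = a0 * \<phi> (tt \<odot>\<^bsub>M\<^esub> z)"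
    using r[of tt] exp[OF z, of 0 0 0 a0] a by simp
  have y: "\<phi> (yy \<odot>\<^bsub>M\<^esub> (a \<odot>\<^bsub>M\<^esub> z)) = a0 * \<phi> (yy \<odot>\<^bsub>M\<^esub> z) + a1 * \<phi> (tt \<odot>\<^bsub>M\<^esub> z)"
    using r[of yy] exp[OF z, of 0 0 a0 a1] a by simp
  have x: "\<phi> (xx \<odot>\<^bsub>M\<^esub> (a \<odot>\<^bsub>M\<^esub> z)) = a0 * \<phi> (xx \<odot>\<^bsub>M\<^esub> z) - q * a2 * \<phi> (tt \<odot>\<^bsub>M\<^esub> z)"
    using r[of xx] exp[OF z, of 0 a0 0 "- (q * a2)"] a by simp
  note coeffs = t y x exp[OF z, of a0 a1 a2 a3, folded a]
  show "el (\<phi> (tt \<odot>\<^bsub>M\<^esub> (a \<odot>\<^bsub>M\<^esub> z))) (\<phi> (yy \<odot>\<^bsub>M\<^esub> (a \<odot>\<^bsub>M\<^esub> z))) (- \<phi> (xx \<odot>\<^bsub>M\<^esub> (a \<odot>\<^bsub>M\<^esub> z)) / q) (\<phi> (a \<odot>\<^bsub>M\<^esub> z))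
    = a \<odot>\<^bsub>RM\<^esub> el (\<phi> (tt \<odot>\<^bsub>M\<^esub> z)) (\<phi> (yy \<odot>\<^bsub>M\<^esub> z)) (- \<phi> (xx \<odot>\<^bsub>M\<^esub> z) / q) (\<phi> z)"
    unfolding coeffs using q_nonzero a by (simp add: field_simps)
qed

definition top_coeff :: "'k qext \<Rightarrow> 'k" where
  "top_coeff u = (THE d. \<exists>a b c. u = el a b c d)"

lemma top_coeff [simp]: "top_coeff (el a b c d) = d"
  unfolding top_coeff_def by (rule the_equality) auto

text \<open>Self-injectivity of \<open>A\<close>: a homomorphism to \<open>A\<close> is recovered from the functional formed by its
  coefficients of \<open>y x\<close>, so it suffices to extend that functional.\<close>

lemma regular_module_injective:
  assumes fl: "fl_module A M" and U: "submodule U A M" and f: "f \<in> lmod_hom A (M\<lparr>carrier := U\<rparr>) RM"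
  obtains F where "F \<in> lmod_hom A M RM" "\<And>u. u \<in> U \<Longrightarrow> F u = f u"
proof -
  have M: "left_module A M" using fl by (rule fl_module_left_module)
  interpret left_module A M by fact
  note fD = lmod_homD[OF f, simplified]
  have Uc: "\<And>u. u \<in> U \<Longrightarrow> u \<in> carrier M" using submodule_subset[OF U] by auto
  have lin: "functional M U (\<lambda>u. top_coeff (f u))"
    unfolding functional_def
  proof (intro conjI ballI allI)
    fix u assume u: "u \<in> U"
    obtain a0 a1 a2 a3 where a: "f u = el a0 a1 a2 a3" using qext_cases[OF fD(1)[OF u]] .
    show "top_coeff (f (sc c \<odot>\<^bsub>M\<^esub> u)) = c * top_coeff (f u)" for c using fD(3)[OF _ u, of "sc c"] a by simp
    fix v assume v: "v \<in> U"
    obtain b0 b1 b2 b3 where b: "f v = el b0 b1 b2 b3" using qext_cases[OF fD(1)[OF v]] .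
    show "top_coeff (f (u \<oplus>\<^bsub>M\<^esub> v)) = top_coeff (f u) + top_coeff (f v)" using fD(2)[OF u v] a b by simp
  qed
  obtain \<psi> where psi: "functional M (carrier M) \<psi>" "\<And>u. u \<in> U \<Longrightarrow> \<psi> u = top_coeff (f u)"
    by (rule functional_extend[OF fl submodule_subspace[OF U] lin]) blast
  show ?thesis
  proof (rule that[OF hom_of_functional[OF M psi(1)]])
    fix u assume u: "u \<in> U"
    obtain a0 a1 a2 a3 where a: "f u = el a0 a1 a2 a3" using qext_cases[OF fD(1)[OF u]] .
    have "\<psi> (r \<odot>\<^bsub>M\<^esub> u) = top_coeff (r \<otimes>\<^bsub>A\<^esub> f u)" if "r \<in> carrier A" for r
      using psi(2)[OF submodule_smult[OF U that u]] fD(3)[OF that u] by simp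
    then show "(\<lambda>z\<in>carrier M. el (\<psi> (tt \<odot>\<^bsub>M\<^esub> z)) (\<psi> (yy \<odot>\<^bsub>M\<^esub> z)) (- \<psi> (xx \<odot>\<^bsub>M\<^esub> z) / q) (\<psi> z)) u = f u"
      using Uc[OF u] psi(2)[OF u] q_nonzero a by simp
  qed
qed


section \<open>The modules A(x + \<alpha> y)\<close>

abbreviation "I \<alpha> \<equiv> principal_left_ideal A (el 0 1 \<alpha> 0)"

lemma carrier_I: "carrier (I \<alpha>) = {el 0 c (c * \<alpha>) d | c d. True}"
proof (intro equalityI subsetI)
  fix u assume "u \<in> carrier (I \<alpha>)"
  then obtain a where "a \<in> carrier A" "u = a \<otimes>\<^bsub>A\<^esub> el 0 1 \<alpha> 0" by (auto simp: principal_left_ideal_def)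
  then show "u \<in> {el 0 c (c * \<alpha>) d | c d. True}" by (auto elim!: qext_cases)
next
  fix u assume "u \<in> {el 0 c (c * \<alpha>) d | c d. True}"
  then obtain c d where "u = el 0 c (c * \<alpha>) d" by blast
  then have "u = el c 0 d 0 \<otimes>\<^bsub>A\<^esub> el 0 1 \<alpha> 0" by simp
  then have "\<exists>a. u = a \<otimes>\<^bsub>A\<^esub> el 0 1 \<alpha> 0 \<and> a \<in> carrier A" using qel_in_carrier by blast
  then show "u \<in> carrier (I \<alpha>)" unfolding principal_left_ideal_def by simp
qed

lemma I_simps [simp]:
  "\<zero>\<^bsub>I \<alpha>\<^esub> = el 0 0 0 0" "add (I \<alpha>) = add A" "smult (I \<alpha>) = monoid.mult A"
  by (simp_all add: principal_left_ideal_def qext_zero)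

lemma I_mem_iff [simp]: "el a b c d \<in> carrier (I \<alpha>) \<longleftrightarrow> a = 0 \<and> c = b * \<alpha>"
  by (auto simp: carrier_I)

lemma I_cases:
  assumes "u \<in> carrier (I \<alpha>)"
  obtains c d where "u = el 0 c (c * \<alpha>) d"
  using assms unfolding carrier_I by blast

lemma I_in_A: "u \<in> carrier (I \<alpha>) \<Longrightarrow> u \<in> carrier A"
  by (auto elim: I_cases)

lemma I_eq: "RM\<lparr>carrier := carrier (I \<alpha>)\<rparr> = I \<alpha>"
  by (simp add: principal_left_ideal_def)

lemma submodule_I: "submodule (carrier (I \<alpha>)) A RM"
proof (rule left_submoduleI[OF left_module_RM])
  show "a \<odot>\<^bsub>RM\<^esub> u \<in> carrier (I \<alpha>)" if "a \<in> carrier A" "u \<in> carrier (I \<alpha>)" for a u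
    using that by (auto elim!: qext_cases I_cases)
qed (auto simp: qext_zero algebra_simps elim!: I_cases)

lemma left_module_I: "left_module A (I \<alpha>)"
  using left_module_submodule[OF left_module_RM submodule_I] by (simp only: I_eq)

text \<open>If \<open>W\<close> has dimension at most one over \<open>U\<close>, there is no room for a submodule between them.\<close>
lemma submodule_between:
  assumes M: "left_module A M" and U: "submodule U A M" and V: "submodule V A M"
    and UV: "U \<subseteq> V" "V \<subseteq> W" and v: "v \<in> carrier M"
    and W: "\<And>w. w \<in> W \<Longrightarrow> \<exists>u\<in>U. \<exists>c. w = u \<oplus>\<^bsub>M\<^esub> sc c \<odot>\<^bsub>M\<^esub> v"
  shows "V = U \<or> V = W"
proof (rule disjCI)
  interpret left_module A M by fact
  assume "V \<noteq> W"
  then obtain z where z: "z \<in> W" "z \<notin> V" using UV by blast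
  have "v \<notin> V"
  proof
    assume "v \<in> V"
    obtain u c where "u \<in> U" "z = u \<oplus>\<^bsub>M\<^esub> sc c \<odot>\<^bsub>M\<^esub> v" using W[OF z(1)] by blast
    then show False using z(2) \<open>v \<in> V\<close> UV(1) submodule_add[OF V] submodule_smult[OF V qel_in_carrier] by auto
  qed
  have "V \<subseteq> U"
  proof
    fix w assume w: "w \<in> V"
    then obtain u c where uc: "u \<in> U" "w = u \<oplus>\<^bsub>M\<^esub> sc c \<odot>\<^bsub>M\<^esub> v" using W UV(2) by blast
    have wc: "w \<in> carrier M" "u \<in> carrier M" using w uc(1) UV(1) submodule_subset[OF V] by auto
    have "c = 0"
    proof (rule ccontr)
      assume "c \<noteq> 0"
      moreover have "u \<oplus>\<^bsub>M\<^esub> sc c \<odot>\<^bsub>M\<^esub> v = w \<oplus>\<^bsub>M\<^esub> sc 0 \<odot>\<^bsub>M\<^esub> v"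
        using uc wc sc_simps(1)[OF M v] by simp
      ultimately have "v \<in> V"
        using subspace_diff_scaled[OF M submodule_subspace[OF V] _ w v] uc(1) UV(1) by blast
      then show False using \<open>v \<notin> V\<close> by simp
    qed
    then show "w \<in> U" using uc wc sc_simps(1)[OF M v] by simp
  qed
  then show "V = U" using UV(1) by simp
qed

lemma fl_module_RM: "fl_module A RM"
proof -
  define U where "U i = {el a b c d | a b c d.
    (i < 4 \<longrightarrow> a = 0) \<and> (i < 3 \<longrightarrow> c = 0) \<and> (i < 2 \<longrightarrow> b = 0) \<and> (i < 1 \<longrightarrow> d = 0)}" for i :: nat
  define v where "v i = el (if i = 3 then 1 else 0) (if i = 1 then 1 else 0) (if i = 2 then 1 else 0)
    (if i = 0 then 1 else 0)" for i :: nat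
  have Uel: "el a b c d \<in> U i \<longleftrightarrow> 
    (i < 4 \<longrightarrow> a = 0) \<and> (i < 3 \<longrightarrow> c = 0) \<and> (i < 2 \<longrightarrow> b = 0) \<and> (i < 1 \<longrightarrow> d = 0)" for a b c d i
    by (auto simp: U_def)
  have Uc: "u \<in> U i \<Longrightarrow> u \<in> carrier A" for u i by (auto simp: U_def)
  have sub: "submodule (U i) A RM" for i
  proof (rule left_submoduleI[OF left_module_RM])
    show "U i \<subseteq> carrier RM" using Uc by auto
    show "\<zero>\<^bsub>RM\<^esub> \<in> U i" by (simp add: qext_zero Uel)
    fix u assume u: "u \<in> U i"
    then obtain a b c d where u': "u = el a b c d" using Uc qext_cases by metis
    show "u \<oplus>\<^bsub>RM\<^esub> w \<in> U i" if w: "w \<in> U i" for w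
    proof -
      obtain a' b' c' d' where "w = el a' b' c' d'" using w Uc qext_cases by metis
      then show ?thesis using u w unfolding u' by (simp add: Uel)
    qed
    show "r \<odot>\<^bsub>RM\<^esub> u \<in> U i" if r: "r \<in> carrier A" for r
    proof -
      obtain a' b' c' d' where "r = el a' b' c' d'" using r qext_cases by metis
      then show ?thesis using u unfolding u' by (auto simp: Uel)
    qed
  qed
  \<comment> \<open>\<open>U i\<close> is spanned by the first \<open>i\<close> of the elements \<open>y x\<close>, \<open>x\<close>, \<open>y\<close>, \<open>1\<close>, and \<open>v i\<close> is the next one.\<close>
  have "composition_series A RM 4 U"
    unfolding composition_series_def
  proof (intro conjI allI impI sub)
    show "U 0 = {\<zero>\<^bsub>RM\<^esub>}" by (auto simp: U_def qext_zero)
    show "U 4 = carrier RM" by (auto simp: U_def carrier_qext)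
    fix i :: nat assume i: "i < 4"
    have "v i \<in> U (Suc i) - U i" using i by (auto simp: v_def Uel)
    moreover have "U i \<subseteq> U (Suc i)" by (auto simp: U_def)
    ultimately show "U i \<subset> U (Suc i)" by blast
    fix V assume V: "submodule V A RM \<and> U i \<subseteq> V \<and> V \<subseteq> U (Suc i)"
    show "V = U i \<or> V = U (Suc i)"
    proof (rule submodule_between[OF left_module_RM sub])
      show "v i \<in> carrier RM" by (simp add: v_def)
      fix w assume w: "w \<in> U (Suc i)"
      then obtain a b c d where w': "w = el a b c d" using Uc qext_cases by metis
      show "\<exists>u\<in>U i. \<exists>s. w = u \<oplus>\<^bsub>RM\<^esub> sc s \<odot>\<^bsub>RM\<^esub> v i"
        by (rule bexI[of _ "el (if i = 3 then 0 else a) (if i = 1 then 0 else b) (if i = 2 then 0 else c)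
            (if i = 0 then 0 else d)"],
            rule exI[of _ "if i = 3 then a else if i = 2 then c else if i = 1 then b else d"])
          (use i w in \<open>auto simp: w' v_def Uel\<close>)
    qed (use V in auto)
  qed
  then show ?thesis using left_module_RM unfolding fl_module_def by blast
qed

lemma projective_RM: "projective A RM"
  by (rule projective_regular_module[OF ring_A fl_module_RM])

lemma fl_module_I: "fl_module A (I \<alpha>)"
proof -
  define U where "U i = {el 0 c (c * \<alpha>) d | c d. (i < 2 \<longrightarrow> c = 0) \<and> (i < 1 \<longrightarrow> d = 0)}" for i :: nat
  define v where "v i = (if i = 0 then tt else el 0 1 \<alpha> 0)" for i :: nat
  have Uel: "el a c b d \<in> U i \<longleftrightarrow> a = 0 \<and> b = c * \<alpha> \<and> (i < 2 \<longrightarrow> c = 0) \<and> (i < 1 \<longrightarrow> d = 0)" for a b c d i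
    by (auto simp: U_def)
  have Ucases: "\<exists>c d. u = el 0 c (c * \<alpha>) d" if "u \<in> U i" for u i using that by (auto simp: U_def)
  have sub: "submodule (U i) A (I \<alpha>)" for i
  proof (rule left_submoduleI[OF left_module_I])
    show "U i \<subseteq> carrier (I \<alpha>)" by (auto simp: U_def)
    show "\<zero>\<^bsub>I \<alpha>\<^esub> \<in> U i" by (simp add: Uel)
    fix u assume u: "u \<in> U i"
    then obtain c d where u': "u = el 0 c (c * \<alpha>) d" using Ucases by metis
    show "u \<oplus>\<^bsub>I \<alpha>\<^esub> w \<in> U i" if w: "w \<in> U i" for w
    proof -
      obtain c' d' where "w = el 0 c' (c' * \<alpha>) d'" using w Ucases by metis
      then show ?thesis using u w unfolding u' by (simp add: Uel algebra_simps)
    qed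
    show "r \<odot>\<^bsub>I \<alpha>\<^esub> u \<in> U i" if r: "r \<in> carrier A" for r
    proof -
      obtain a' b' c' d' where "r = el a' b' c' d'" using r qext_cases by metis
      then show ?thesis using u unfolding u' by (auto simp: Uel)
    qed
  qed
  have "composition_series A (I \<alpha>) 2 U"
    unfolding composition_series_def
  proof (intro conjI allI impI sub)
    show "U 0 = {\<zero>\<^bsub>I \<alpha>\<^esub>}" by (auto simp: U_def)
    show "U 2 = carrier (I \<alpha>)" by (auto simp: U_def carrier_I)
    fix i :: nat assume i: "i < 2"
    have "v i \<in> U (Suc i) - U i" using i by (auto simp: v_def Uel)
    moreover have "U i \<subseteq> U (Suc i)" by (auto simp: U_def)
    ultimately show "U i \<subset> U (Suc i)" by blast
    fix V assume V: "submodule V A (I \<alpha>) \<and> U i \<subseteq> V \<and> V \<subseteq> U (Suc i)"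
    show "V = U i \<or> V = U (Suc i)"
    proof (rule submodule_between[OF left_module_I sub])
      show "v i \<in> carrier (I \<alpha>)" by (simp add: v_def)
      fix w assume w: "w \<in> U (Suc i)"
      then obtain c d where w': "w = el 0 c (c * \<alpha>) d" using Ucases by metis
      show "\<exists>u\<in>U i. \<exists>s. w = u \<oplus>\<^bsub>I \<alpha>\<^esub> sc s \<odot>\<^bsub>I \<alpha>\<^esub> v i"
        by (rule bexI[of _ "if i = 0 then el 0 0 0 0 else el 0 0 0 d"], rule exI[of _ "if i = 0 then d else c"])
          (use i w in \<open>auto simp: w' v_def Uel\<close>)
    qed (use V in auto)
  qed
  then show ?thesis using left_module_I unfolding fl_module_def by blast
qed

text \<open>Right multiplication by \<open>x + \<alpha> y\<close> is a surjection with kernel \<open>A(x + q \<alpha> y)\<close>; this is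
  the relation \<open>(x + \<beta> y)(x + \<alpha> y) = (\<beta> - q \<alpha>) y x\<close>.\<close>

definition cover :: "'k \<Rightarrow> 'k qext \<Rightarrow> 'k qext" where
  "cover \<alpha> = (\<lambda>a\<in>carrier A. a \<otimes>\<^bsub>A\<^esub> el 0 1 \<alpha> 0)"

lemma cover_el [simp]: "cover \<alpha> (el a b c d) = el 0 a (a * \<alpha>) (c - q * (b * \<alpha>))"
  by (simp add: cover_def)

lemma cover_hom: "cover \<alpha> \<in> lmod_hom A RM (I \<alpha>)"
  using regular_module_hom[OF left_module_I, of "el 0 1 \<alpha> 0" \<alpha>] by (simp add: cover_def)

lemma cover_image: "cover \<alpha> ` carrier A = carrier (I \<alpha>)"
proof
  show "cover \<alpha> ` carrier A \<subseteq> carrier (I \<alpha>)" using lmod_homD(1)[OF cover_hom] by auto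
  show "carrier (I \<alpha>) \<subseteq> cover \<alpha> ` carrier A"
  proof
    fix u assume "u \<in> carrier (I \<alpha>)"
    then obtain c d where "u = el 0 c (c * \<alpha>) d" by (rule I_cases)
    then have "u = cover \<alpha> (el c 0 d 0)" by simp
    then show "u \<in> cover \<alpha> ` carrier A" by blast
  qed
qed

lemma cover_kernel: "lmod_kernel RM (I \<alpha>) (cover \<alpha>) = carrier (I (q * \<alpha>))"
proof (intro equalityI subsetI)
  fix u assume "u \<in> lmod_kernel RM (I \<alpha>) (cover \<alpha>)"
  then have u: "u \<in> carrier A" "cover \<alpha> u = el 0 0 0 0" by (simp_all add: lmod_kernel_def)
  obtain a b c d where "u = el a b c d" using u(1) by (rule qext_cases)
  then show "u \<in> carrier (I (q * \<alpha>))" using u(2) by simp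
next
  fix u assume "u \<in> carrier (I (q * \<alpha>))"
  then obtain c d where "u = el 0 c (c * (q * \<alpha>)) d" by (rule I_cases)
  then show "u \<in> lmod_kernel RM (I \<alpha>) (cover \<alpha>)" by (simp add: lmod_kernel_def)
qed

text \<open>Since \<open>x\<close>, \<open>y\<close> and \<open>y x\<close> are nilpotent, elements with constant coefficient \<open>1\<close> are units. In
  other words, \<open>A\<close> is local.\<close>
lemma left_inverse: "el 1 (- b) (- c) (c * b - d - q * (b * c)) \<otimes>\<^bsub>A\<^esub> el 1 b c d = sc 1"
  by (simp add: algebra_simps)

lemma submodule_with_unit:
  assumes U: "submodule U A RM" and u: "el 1 b c d \<in> U"
  shows "U = carrier A"
proof -
  have "sc 1 \<in> U" using submodule_smult[OF U _ u] left_inverse[of b c d] by (metis qel_in_carrier regular_module_simps(4))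
  then have "a \<otimes>\<^bsub>A\<^esub> sc 1 \<in> U" if "a \<in> carrier A" for a using submodule_smult[OF U that] by simp
  moreover have "a \<otimes>\<^bsub>A\<^esub> sc 1 = a" if "a \<in> carrier A" for a using that by (auto elim: qext_cases)
  ultimately show ?thesis using submodule_subset[OF U] by auto
qed

text \<open>The line spanned by \<open>y x\<close> is the socle of \<open>A\<close>: multiplying a nonzero element by \<open>y x\<close>, \<open>y\<close>, \<open>x\<close>
  or \<open>1\<close>, according to its first nonzero coefficient, gives a nonzero multiple of \<open>y x\<close>.\<close>

lemma nonzero_submodule_contains_tt:
  assumes U: "submodule U A RM" and u: "u \<in> U" "u \<noteq> el 0 0 0 0"
  shows "tt \<in> U"
proof -
  have "u \<in> carrier A" using submodule_subset[OF U] u by auto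
  then obtain a b c d where u': "u = el a b c d" by (rule qext_cases)
  have sm: "r \<otimes>\<^bsub>A\<^esub> u \<in> U" if "r \<in> carrier A" for r using submodule_smult[OF U that u(1)] by simp
  consider "a \<noteq> 0" | "a = 0" "b \<noteq> 0" | "a = 0" "b = 0" "c \<noteq> 0" | "a = 0" "b = 0" "c = 0" "d \<noteq> 0"
    using u(2) u' by auto
  then show ?thesis
  proof cases
    case 1 then show ?thesis using sm[of "el 0 0 0 (1 / a)"] u' by simp
  next
    case 2 then show ?thesis using sm[of "el 0 0 (1 / b) 0"] u' by simp
  next
    case 3 then show ?thesis using sm[of "el 0 (- 1 / (q * c)) 0 0"] u' q_nonzero by simp
  next
    case 4 then show ?thesis using sm[of "sc (1 / d)"] u' by simp
  qed
qed

lemma submodule_of_I: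
  assumes "submodule U A (I \<alpha>)"
  shows "submodule U A RM"
proof (rule left_submoduleI[OF left_module_RM])
  show "U \<subseteq> carrier RM" using submodule_subset[OF assms] I_in_A by auto
qed (use submodule_simps[OF assms] in \<open>auto simp: qext_zero\<close>)

text \<open>Two nonzero submodules have \<open>y x\<close> in common.\<close>
lemma indecomposable_I: "indecomposable A (I \<alpha>)"
  unfolding indecomposable_def
proof (intro conjI allI impI fl_module_I)
  have "tt \<in> carrier (I \<alpha>)" "tt \<noteq> \<zero>\<^bsub>I \<alpha>\<^esub>" by simp_all
  then show "carrier (I \<alpha>) \<noteq> {\<zero>\<^bsub>I \<alpha>\<^esub>}" by blast
  fix U V
  assume UV: "submodule U A (I \<alpha>) \<and> submodule V A (I \<alpha>) \<and> U \<inter> V = {\<zero>\<^bsub>I \<alpha>\<^esub>} \<and> U <+>\<^bsub>I \<alpha>\<^esub> V = carrier (I \<alpha>)"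
  show "U = {\<zero>\<^bsub>I \<alpha>\<^esub>} \<or> V = {\<zero>\<^bsub>I \<alpha>\<^esub>}"
  proof (rule ccontr)
    assume "\<not> (U = {\<zero>\<^bsub>I \<alpha>\<^esub>} \<or> V = {\<zero>\<^bsub>I \<alpha>\<^esub>})"
    moreover have "tt \<in> W" if W: "submodule W A (I \<alpha>)" "W \<noteq> {\<zero>\<^bsub>I \<alpha>\<^esub>}" for W
    proof -
      have "\<exists>w\<in>W. w \<noteq> \<zero>\<^bsub>I \<alpha>\<^esub>" using submodule_zero[OF W(1)] W(2) by blast
      then show ?thesis using nonzero_submodule_contains_tt[OF submodule_of_I[OF W(1)]] by auto
    qed
    ultimately have "tt \<in> U" "tt \<in> V" using UV by simp_all
    then have "tt \<in> U \<inter> V" by (rule IntI)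
    then have "tt = el 0 0 0 0" using UV by simp
    then show False by simp
  qed
qed

text \<open>A section \<open>h\<close> of the covering \<open>A \<rightarrow> I(\<alpha>)\<close> would map \<open>x + \<alpha> y\<close> to an element with constant
  coefficient \<open>1\<close>. But \<open>x + q \<alpha> y\<close> annihilates the former and not the latter.\<close>
lemma not_projective_I: "\<not> projective A (I \<alpha>)"
proof
  assume P: "projective A (I \<alpha>)"
  have id: "(\<lambda>u\<in>carrier (I \<alpha>). u) \<in> lmod_hom A (I \<alpha>) (I \<alpha>)"
    by (rule lmod_hom_restrictI[OF left_module_I]) auto
  obtain h where h: "h \<in> lmod_hom A (I \<alpha>) RM" "\<And>u. u \<in> carrier (I \<alpha>) \<Longrightarrow> cover \<alpha> (h u) = (\<lambda>u\<in>carrier (I \<alpha>). u) u"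
    using projective_lift[OF P fl_module_RM fl_module_I cover_hom _ id] cover_image by auto
  let ?g = "el 0 1 \<alpha> 0"
  have "h ?g \<in> carrier A" using lmod_homD(1)[OF h(1), of ?g] by simp
  then obtain a b c d where hg: "h ?g = el a b c d" by (rule qext_cases)
  have a: "a = 1" using h(2)[of ?g] hg by simp
  have "h (el 0 1 (q * \<alpha>) 0 \<otimes>\<^bsub>A\<^esub> ?g) = el 0 1 (q * \<alpha>) 0 \<otimes>\<^bsub>A\<^esub> h ?g"
    using lmod_homD(3)[OF h(1), of "el 0 1 (q * \<alpha>) 0" ?g] by simp
  moreover have "h (el 0 0 0 0) = el 0 0 0 0"
    using lmod_hom_zero[OF left_module_I left_module_RM h(1)] by (simp add: qext_zero)
  ultimately show False using hg a by simp
qed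

text \<open>Isomorphic modules have the same annihilator, and \<open>x + \<gamma> y\<close> annihilates \<open>I(\<alpha>)\<close> only for
  \<open>\<gamma> = q \<alpha>\<close>.\<close>
lemma lmod_iso_I_imp_eq:
  assumes "lmod_iso A (I \<alpha>) (I \<beta>)"
  shows "\<alpha> = \<beta>"
proof -
  obtain f where f: "f \<in> lmod_hom A (I \<alpha>) (I \<beta>)" "f ` carrier (I \<alpha>) = carrier (I \<beta>)"
    using assms by (auto simp: lmod_iso_def bij_betw_def)
  have "el 0 1 \<beta> 0 \<in> f ` carrier (I \<alpha>)" unfolding f(2) by simp
  then obtain u where u: "u \<in> carrier (I \<alpha>)" "f u = el 0 1 \<beta> 0" by fastforce
  obtain c d where u': "u = el 0 c (c * \<alpha>) d" using u(1) by (rule I_cases)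
  have "f (el 0 1 (q * \<alpha>) 0 \<otimes>\<^bsub>A\<^esub> u) = el 0 1 (q * \<alpha>) 0 \<otimes>\<^bsub>A\<^esub> el 0 1 \<beta> 0"
    using lmod_homD(3)[OF f(1) _ u(1), of "el 0 1 (q * \<alpha>) 0"] u(2) by simp
  moreover have "f (el 0 0 0 0) = el 0 0 0 0"
    using lmod_hom_zero[OF left_module_I left_module_I f(1)] by simp
  ultimately show ?thesis using u' q_nonzero by simp
qed

text \<open>The kernel consists of nonunits of the local ring \<open>A\<close>, so a left ideal that spans \<open>A\<close> together
  with it contains a unit.\<close>
lemma projective_cover_I: "projective_cover A (I \<alpha>) RM (cover \<alpha>)"
  unfolding projective_cover_def
proof (intro conjI allI impI projective_RM cover_hom)
  show "cover \<alpha> ` carrier RM = carrier (I \<alpha>)" using cover_image by simp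
  fix U assume asm: "submodule U A RM \<and> U <+>\<^bsub>RM\<^esub> lmod_kernel RM (I \<alpha>) (cover \<alpha>) = carrier RM"
  then have U: "submodule U A RM" ..
  have sum: "U <+>\<^bsub>RM\<^esub> carrier (I (q * \<alpha>)) = carrier A"
    using asm unfolding cover_kernel regular_module_simps(1) ..
  have "sc 1 \<in> U <+>\<^bsub>RM\<^esub> carrier (I (q * \<alpha>))" unfolding sum by (rule qel_in_carrier)
  then have "\<exists>u\<in>U. \<exists>v\<in>carrier (I (q * \<alpha>)). sc 1 = u \<oplus>\<^bsub>A\<^esub> v" unfolding set_add_iff regular_module_simps .
  then obtain u v where uv: "u \<in> U" "v \<in> carrier (I (q * \<alpha>))" "sc 1 = u \<oplus>\<^bsub>A\<^esub> v" by blast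
  have "u \<in> carrier A" using uv(1) submodule_subset[OF U] by auto
  then obtain a b c d where u: "u = el a b c d" by (rule qext_cases)
  obtain c' d' where v: "v = el 0 c' (c' * (q * \<alpha>)) d'" using uv(2) by (rule I_cases)
  have "a = 1" using uv(3) unfolding u v by simp
  then show "U = carrier RM" using submodule_with_unit[OF U, of b c d] uv(1) u by simp
qed

lemma is_syzygy_I: "is_syzygy A (I \<alpha>) (I (q * \<alpha>))"
proof -
  have eq: "RM\<lparr>carrier := lmod_kernel RM (I \<alpha>) (cover \<alpha>)\<rparr> = I (q * \<alpha>)"
    using I_eq[of "q * \<alpha>"] unfolding cover_kernel .
  have "lmod_iso A (I (q * \<alpha>)) (RM\<lparr>carrier := lmod_kernel RM (I \<alpha>) (cover \<alpha>)\<rparr>)"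
    unfolding eq by (rule lmod_iso_refl[OF left_module_I])
  with projective_cover_I show ?thesis unfolding is_syzygy_def by blast
qed


section \<open>Syzygies and the modules A(x + \<alpha> y)\<close>

text \<open>In \<open>A\<close>, and hence in every projective module, what \<open>x + q \<alpha> y\<close> annihilates is a multiple of
  \<open>x + \<alpha> y\<close>. The proof avoids free modules of larger rank. If \<open>p\<close> is not in the subspace
  \<open>(x + \<alpha> y) P\<close>, there is a functional \<open>\<psi>\<close> on \<open>P\<close> that vanishes on this subspace and has the value \<open>1\<close> at
  \<open>p\<close>. The corresponding homomorphism \<open>P \<rightarrow> A\<close> has its image in \<open>I(\<alpha> / q)\<close>, since
  \<open>(x + \<alpha> y)(x + (\<alpha> / q) y) = 0\<close>. As \<open>P\<close> is projective, it lifts along the covering \<open>A \<rightarrow> I(\<alpha> / q)\<close> to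
  some \<open>f'\<close>. Now \<open>f' p\<close> is annihilated by \<open>x + q \<alpha> y\<close>, hence has the form \<open>b (x + \<alpha> y) + d y x\<close>, and so
  the covering maps it to zero. This contradicts \<open>\<psi> p = 1\<close>.\<close>
lemma projective_annihilator:
  fixes P :: "('k qext, 'k qext) module"
  assumes P: "projective A P" and p: "p \<in> carrier P" and ann: "el 0 1 (q * \<alpha>) 0 \<odot>\<^bsub>P\<^esub> p = \<zero>\<^bsub>P\<^esub>"
  obtains p' where "p' \<in> carrier P" "p = el 0 1 \<alpha> 0 \<odot>\<^bsub>P\<^esub> p'"
proof (cases "\<exists>p'\<in>carrier P. p = el 0 1 \<alpha> 0 \<odot>\<^bsub>P\<^esub> p'")
  case True
  then show ?thesis using that by blast
next
  case False
  have fl: "fl_module A P" using P by (rule projective_fl_module)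
  have lP: "left_module A P" using fl by (rule fl_module_left_module)
  interpret left_module A P by (rule lP)
  let ?g = "el 0 1 \<alpha> 0"
  let ?W = "{?g \<odot>\<^bsub>P\<^esub> z | z. z \<in> carrier P}"
  have pW: "p \<notin> ?W" using False by blast
  have W: "subspace P ?W" unfolding subspace_def
  proof (intro conjI ballI allI)
    show "?W \<subseteq> carrier P" by auto
    have "\<zero>\<^bsub>P\<^esub> = ?g \<odot>\<^bsub>P\<^esub> \<zero>\<^bsub>P\<^esub>" by simp
    then show "\<zero>\<^bsub>P\<^esub> \<in> ?W" by blast
    fix u assume "u \<in> ?W"
    then obtain z where u: "u = ?g \<odot>\<^bsub>P\<^esub> z" and z: "z \<in> carrier P" by blast
    show "sc c \<odot>\<^bsub>P\<^esub> u \<in> ?W" for c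
    proof -
      have "sc c \<odot>\<^bsub>P\<^esub> u = ?g \<odot>\<^bsub>P\<^esub> (sc c \<odot>\<^bsub>P\<^esub> z)"
        unfolding u using smult_assoc1[of "sc c" ?g z] smult_assoc1[of ?g "sc c" z] z by (simp add: mult.commute)
      then show ?thesis using z by blast
    qed
    fix v assume "v \<in> ?W"
    then obtain z' where v: "v = ?g \<odot>\<^bsub>P\<^esub> z'" and z': "z' \<in> carrier P" by blast
    have "u \<oplus>\<^bsub>P\<^esub> v = ?g \<odot>\<^bsub>P\<^esub> (z \<oplus>\<^bsub>P\<^esub> z')" unfolding u v using z z' by (simp add: smult_r_distr)
    then show "u \<oplus>\<^bsub>P\<^esub> v \<in> ?W" using z z' by blast
  qed
  have lin: "functional P ?W (\<lambda>u. 0)" by (simp add: functional_def)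
  obtain W' \<phi> where W': "subspace P W'" "functional P W' \<phi>" "?W \<subseteq> W'" "p \<in> W'"
    and phi: "\<And>u. u \<in> ?W \<Longrightarrow> \<phi> u = 0" "p \<notin> ?W \<Longrightarrow> \<phi> p = 1"
    by (rule functional_extend_one[OF lP W lin p, of 1]) blast
  obtain \<psi> where psi: "functional P (carrier P) \<psi>" and psi_eq: "\<And>u. u \<in> W' \<Longrightarrow> \<psi> u = \<phi> u"
    by (rule functional_extend[OF fl W'(1,2)]) blast
  have psi_p: "\<psi> p = 1" using psi_eq[OF W'(4)] phi(2)[OF pW] by simp
  have psi_W: "\<psi> (?g \<odot>\<^bsub>P\<^esub> z) = 0" if "z \<in> carrier P" for z
  proof -
    have gz: "?g \<odot>\<^bsub>P\<^esub> z \<in> ?W" using that by blast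
    show ?thesis using psi_eq[OF subsetD[OF W'(3) gz]] phi(1)[OF gz] by simp
  qed
  have padd: "\<And>u v. u \<in> carrier P \<Longrightarrow> v \<in> carrier P \<Longrightarrow> \<psi> (u \<oplus>\<^bsub>P\<^esub> v) = \<psi> u + \<psi> v"
    and psc: "\<And>c u. u \<in> carrier P \<Longrightarrow> \<psi> (sc c \<odot>\<^bsub>P\<^esub> u) = c * \<psi> u"
    using psi by (auto simp: functional_def)
  have x_eq: "\<psi> (xx \<odot>\<^bsub>P\<^esub> z) = - \<alpha> * \<psi> (yy \<odot>\<^bsub>P\<^esub> z)" if z: "z \<in> carrier P" for z
  proof -
    have "?g = xx \<oplus>\<^bsub>A\<^esub> sc \<alpha> \<otimes>\<^bsub>A\<^esub> yy" by simp
    then have "?g \<odot>\<^bsub>P\<^esub> z = xx \<odot>\<^bsub>P\<^esub> z \<oplus>\<^bsub>P\<^esub> sc \<alpha> \<odot>\<^bsub>P\<^esub> (yy \<odot>\<^bsub>P\<^esub> z)"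
      using z by (simp only: smult_l_distr smult_assoc1 qel_in_carrier R.m_closed)
    then have "0 = \<psi> (xx \<odot>\<^bsub>P\<^esub> z) + \<alpha> * \<psi> (yy \<odot>\<^bsub>P\<^esub> z)" using psi_W[OF z] z by (simp add: padd psc)
    then show ?thesis by (simp add: eq_neg_iff_add_eq_0)
  qed
  have t_eq: "\<psi> (tt \<odot>\<^bsub>P\<^esub> z) = 0" if z: "z \<in> carrier P" for z
  proof -
    have "?g \<odot>\<^bsub>P\<^esub> (yy \<odot>\<^bsub>P\<^esub> z) = sc (- q) \<odot>\<^bsub>P\<^esub> (tt \<odot>\<^bsub>P\<^esub> z)"
      using smult_assoc1[of ?g yy z] smult_assoc1[of "sc (- q)" tt z] z by simp
    then have "- q * \<psi> (tt \<odot>\<^bsub>P\<^esub> z) = 0" using psi_W[of "yy \<odot>\<^bsub>P\<^esub> z"] z psc[of "tt \<odot>\<^bsub>P\<^esub> z" "- q"] by simp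
    then show ?thesis using q_nonzero by simp
  qed
  let ?f = "\<lambda>z\<in>carrier P. el (\<psi> (tt \<odot>\<^bsub>P\<^esub> z)) (\<psi> (yy \<odot>\<^bsub>P\<^esub> z)) (- \<psi> (xx \<odot>\<^bsub>P\<^esub> z) / q) (\<psi> z)"
  have "?f \<in> lmod_hom A P (RM\<lparr>carrier := carrier (I (\<alpha> / q))\<rparr>)"
  proof (rule lmod_hom_into_submodule[OF hom_of_functional[OF lP psi]])
    show "?f ` carrier P \<subseteq> carrier (I (\<alpha> / q))"
    proof (rule image_subsetI)
      fix z assume z: "z \<in> carrier P"
      then have "?f z = el (\<psi> (tt \<odot>\<^bsub>P\<^esub> z)) (\<psi> (yy \<odot>\<^bsub>P\<^esub> z)) (- \<psi> (xx \<odot>\<^bsub>P\<^esub> z) / q) (\<psi> z)" by (rule restrict_apply')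
      then show "?f z \<in> carrier (I (\<alpha> / q))" using x_eq[OF z] t_eq[OF z] by simp
    qed
  qed
  then have f: "?f \<in> lmod_hom A P (I (\<alpha> / q))" by (simp only: I_eq)
  obtain f' where f': "f' \<in> lmod_hom A P RM" "\<And>z. z \<in> carrier P \<Longrightarrow> cover (\<alpha> / q) (f' z) = ?f z"
    using projective_lift[OF P fl_module_RM fl_module_I cover_hom _ f] cover_image by auto
  have "f' p \<in> carrier A" using lmod_homD(1)[OF f'(1) p] by simp
  then obtain a b c d where fp: "f' p = el a b c d" by (rule qext_cases)
  have "el 0 1 (q * \<alpha>) 0 \<otimes>\<^bsub>A\<^esub> f' p = \<zero>\<^bsub>A\<^esub>"
    using lmod_homD(3)[OF f'(1) _ p, of "el 0 1 (q * \<alpha>) 0"] ann lmod_hom_zero[OF lP left_module_RM f'(1)] by simp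
  then have "a = 0" "c = \<alpha> * b" using fp q_nonzero by (simp_all add: qext_zero)
  then have "cover (\<alpha> / q) (f' p) = el 0 0 0 0" using fp q_nonzero by simp
  then have "el (\<psi> (tt \<odot>\<^bsub>P\<^esub> p)) (\<psi> (yy \<odot>\<^bsub>P\<^esub> p)) (- \<psi> (xx \<odot>\<^bsub>P\<^esub> p) / q) (\<psi> p) = el 0 0 0 0"
    using f'(2)[OF p] p by (simp only: restrict_apply')
  then show ?thesis using psi_p by simp
qed

text \<open>Uniqueness of projective covers. The lift \<open>h\<close> of \<open>P \<rightarrow> I(\<alpha>)\<close> to \<open>A\<close> reaches a unit of the local ring
  \<open>A\<close>, so it has a section \<open>s\<close>. The image of \<open>s\<close> supplements the kernel of \<open>P \<rightarrow> Z\<close>, hence is all of \<open>P\<close>,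
  and \<open>h\<close> is an isomorphism that maps the kernel onto \<open>I(q \<alpha>)\<close>.\<close>
lemma syzygy_of_I_unique:
  fixes P Z X :: "('k qext, 'k qext) module"
  assumes Z: "left_module A Z" and X: "left_module A X"
    and iso: "lmod_iso A Z (I \<alpha>)" and syz: "is_syzygy A Z X"
  shows "lmod_iso A X (I (q * \<alpha>))"
proof -
  obtain P p where cov: "projective_cover A Z P p"
    and XK: "lmod_iso A X (P\<lparr>carrier := lmod_kernel P Z p\<rparr>)"
    using syz by (auto simp: is_syzygy_def)
  have P: "projective A P" and p: "p \<in> lmod_hom A P Z" "p ` carrier P = carrier Z"
    and sup: "\<And>U. submodule U A P \<Longrightarrow> U <+>\<^bsub>P\<^esub> lmod_kernel P Z p = carrier P \<Longrightarrow> U = carrier P"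
    using cov by (auto simp: projective_cover_def)
  have lP: "left_module A P" using P by (rule projective_left_module)
  interpret P: left_module A P by (rule lP)
  interpret RM: left_module A RM by (rule left_module_RM)
  obtain i where i: "i \<in> lmod_hom A Z (I \<alpha>)" "bij_betw i (carrier Z) (carrier (I \<alpha>))"
    using iso by (auto simp: lmod_iso_def)
  define p' where "p' = compose (carrier P) i p"
  have p': "p' \<in> lmod_hom A P (I \<alpha>)" unfolding p'_def by (rule lmod_hom_compose[OF lP p(1) i(1)])
  have ip: "p' w = i (p w)" if "w \<in> carrier P" for w using that by (simp add: p'_def compose_eq)
  have ker: "p w = \<zero>\<^bsub>Z\<^esub> \<longleftrightarrow> p' w = el 0 0 0 0" if "w \<in> carrier P" for w
  proof -
    have "i \<zero>\<^bsub>Z\<^esub> = el 0 0 0 0" using lmod_hom_zero[OF Z left_module_I i(1)] by simp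
    moreover have "p w \<in> carrier Z" "\<zero>\<^bsub>Z\<^esub> \<in> carrier Z"
      using lmod_homD(1)[OF p(1) that] submodule_zero[OF submodule_carrier[OF Z]] .
    ultimately show ?thesis using ip[OF that] i(2) by (metis bij_betw_imp_inj_on inj_onD)
  qed
  obtain h where h: "h \<in> lmod_hom A P RM" "\<And>w. w \<in> carrier P \<Longrightarrow> cover \<alpha> (h w) = p' w"
    using projective_lift[OF P fl_module_RM fl_module_I cover_hom _ p'] cover_image by auto
  note hD = lmod_homD[OF h(1), simplified]
  have "p' ` carrier P = carrier (I \<alpha>)"
    using p(2) i(2) ip by (metis (no_types, lifting) bij_betw_imp_surj_on image_cong image_image)
  moreover have "el 0 1 \<alpha> 0 \<in> carrier (I \<alpha>)" by simp
  ultimately obtain z where z: "z \<in> carrier P" "p' z = el 0 1 \<alpha> 0" by (metis imageE)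
  obtain a b c d where hz: "h z = el a b c d" using hD(1)[OF z(1)] by (rule qext_cases)
  have "a = 1" using h(2)[OF z(1)] z(2) hz by simp
  define z1 where "z1 = el 1 (- b) (- c) (c * b - d - q * (b * c)) \<odot>\<^bsub>P\<^esub> z"
  have z1: "z1 \<in> carrier P" using z(1) by (simp add: z1_def)
  have hz1: "h z1 = sc 1"
    unfolding z1_def using hD(3)[OF _ z(1)] hz \<open>a = 1\<close> left_inverse[of b c d] by simp
  define s where "s = (\<lambda>a\<in>carrier A. a \<odot>\<^bsub>P\<^esub> z1)"
  have s: "s \<in> lmod_hom A RM P" unfolding s_def by (rule regular_module_hom[OF lP z1])
  have hs: "h (s a) = a" if "a \<in> carrier A" for a
  proof -
    have "h (s a) = a \<otimes>\<^bsub>A\<^esub> sc 1" using hD(3)[OF that z1] hz1 that by (simp add: s_def)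
    then show ?thesis using P.R.r_one[OF that] by (simp add: qext_one)
  qed
  have sc: "s a \<in> carrier P" if "a \<in> carrier A" for a using lmod_homD(1)[OF s] that by simp
  have sub: "submodule (s ` carrier A) A P"
    using submodule_image[OF left_module_RM lP s submodule_carrier[OF left_module_RM]] by simp
  have "s ` carrier A = carrier P"
  proof (rule sup[OF sub], intro equalityI subsetI)
    fix w assume "w \<in> s ` carrier A <+>\<^bsub>P\<^esub> lmod_kernel P Z p"
    then show "w \<in> carrier P" unfolding set_add_iff using sc by (auto simp: lmod_kernel_def)
  next
    fix w assume w: "w \<in> carrier P"
    let ?k = "w \<ominus>\<^bsub>P\<^esub> s (h w)"
    have hw: "h w \<in> carrier A" using hD(1)[OF w] .
    have k: "?k \<in> carrier P" using w sc[OF hw] by simp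
    have "h ?k = h w \<ominus>\<^bsub>RM\<^esub> h w"
      using lmod_hom_minus[OF lP left_module_RM h(1) w sc[OF hw]] hs[OF hw] by simp
    then have "h ?k = el 0 0 0 0" using RM.diff_eq_zero_iff[of "h w" "h w"] hw by (simp add: qext_zero)
    then have "p' ?k = el 0 0 0 0" using h(2)[OF k] by simp
    then have "?k \<in> lmod_kernel P Z p" using ker[OF k] k by (simp add: lmod_kernel_def)
    moreover have "w = s (h w) \<oplus>\<^bsub>P\<^esub> ?k"
      using w sc[OF hw] by (simp add: a_minus_def P.M.a_lcomm[of _ w] P.M.r_neg)
    ultimately show "w \<in> s ` carrier A <+>\<^bsub>P\<^esub> lmod_kernel P Z p" unfolding set_add_iff using hw by blast
  qed
  then have sh: "s (h w) = w" if "w \<in> carrier P" for w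
  proof -
    have "w \<in> s ` carrier A" using that \<open>s ` carrier A = carrier P\<close> by simp
    then obtain a where "w = s a" "a \<in> carrier A" by blast
    then show ?thesis using hs by simp
  qed
  let ?K = "lmod_kernel P Z p"
  have K: "submodule ?K A P" by (rule submodule_kernel[OF lP Z p(1)])
  have hK: "h w \<in> carrier (I (q * \<alpha>)) \<longleftrightarrow> w \<in> ?K" if w: "w \<in> carrier P" for w
  proof -
    have "h w \<in> carrier (I (q * \<alpha>)) \<longleftrightarrow> cover \<alpha> (h w) = el 0 0 0 0"
      using hD(1)[OF w] unfolding cover_kernel[symmetric] by (simp add: lmod_kernel_def)
    then show ?thesis using ker[OF w] h(2)[OF w] w by (simp add: lmod_kernel_def)
  qed
  have Kc: "w \<in> carrier P" if "w \<in> ?K" for w using that by (simp add: lmod_kernel_def)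
  have im: "restrict h ?K ` ?K = carrier (I (q * \<alpha>))"
  proof (intro equalityI subsetI)
    fix u assume "u \<in> restrict h ?K ` ?K"
    then show "u \<in> carrier (I (q * \<alpha>))" using hK Kc by auto
  next
    fix u assume u: "u \<in> carrier (I (q * \<alpha>))"
    then have uA: "u \<in> carrier A" by (rule I_in_A)
    then have "s u \<in> ?K" "h (s u) = u" using hK[OF sc[OF uA]] hs[OF uA] u by simp_all
    then show "u \<in> restrict h ?K ` ?K" by (metis image_eqI restrict_apply')
  qed
  have "restrict h ?K \<in> lmod_hom A (P\<lparr>carrier := ?K\<rparr>) (RM\<lparr>carrier := carrier (I (q * \<alpha>))\<rparr>)"
    by (rule lmod_hom_into_submodule[OF lmod_hom_restrict_submodule[OF lP K h(1)]]) (use im in simp)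
  then have "restrict h ?K \<in> lmod_hom A (P\<lparr>carrier := ?K\<rparr>) (I (q * \<alpha>))" by (simp only: I_eq)
  moreover have "bij_betw (restrict h ?K) (carrier (P\<lparr>carrier := ?K\<rparr>)) (carrier (I (q * \<alpha>)))"
  proof -
    have "inj_on (restrict h ?K) ?K"
    proof (rule inj_onI)
      fix u v assume "u \<in> ?K" "v \<in> ?K" "restrict h ?K u = restrict h ?K v"
      then have "h u = h v" by simp
      then have "s (h u) = s (h v)" by simp
      then show "u = v" using sh Kc \<open>u \<in> ?K\<close> \<open>v \<in> ?K\<close> by simp
    qed
    then show ?thesis using im by (simp add: bij_betw_def)
  qed
  ultimately have "lmod_iso A (P\<lparr>carrier := ?K\<rparr>) (I (q * \<alpha>))" unfolding lmod_iso_def by blast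
  with XK show ?thesis by (rule lmod_iso_trans[OF X])
qed

text \<open>The kernel of \<open>P \<rightarrow> Z\<close> is a copy of \<open>I(\<alpha>)\<close>, whose generator \<open>p0\<close> can be written as \<open>(x + \<alpha> y) p'\<close>.
  Then \<open>h a = a p'\<close> embeds \<open>A\<close> into \<open>P\<close> and extends the embedding \<open>t\<close> of \<open>I(\<alpha>)\<close>; it is injective on
  \<open>A\<close> because it is so on \<open>y x\<close>. Injectivity of \<open>A\<close> provides a retraction \<open>r\<close> of \<open>h\<close>, so that \<open>P\<close>
  is the direct sum of the image \<open>B\<close> of \<open>h\<close> and the kernel \<open>N\<close> of \<open>r\<close>. Since the kernel of \<open>P \<rightarrow> Z\<close> lies in
  \<open>B\<close>, this induces a decomposition of \<open>Z\<close>. Indecomposability forces \<open>N\<close> to vanish.\<close>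
lemma syzygy_I_preimage:
  fixes Z X :: "('k qext, 'k qext) module"
  assumes Z: "indecomposable A Z" and X: "left_module A X"
    and iso: "lmod_iso A X (I (q * \<beta>))" and syz: "is_syzygy A Z X"
  shows "lmod_iso A Z (I \<beta>)"
proof -
  define \<alpha> where "\<alpha> = q * \<beta>"
  obtain P p where cov: "projective_cover A Z P p"
    and XK: "lmod_iso A X (P\<lparr>carrier := lmod_kernel P Z p\<rparr>)"
    using syz by (auto simp: is_syzygy_def)
  have P: "projective A P" and p: "p \<in> lmod_hom A P Z" "p ` carrier P = carrier Z"
    using cov by (auto simp: projective_cover_def)
  have lZ: "left_module A Z" using Z by (simp add: indecomposable_def fl_module_def)
  have flP: "fl_module A P" using P by (rule projective_fl_module)
  have lP: "left_module A P" using P by (rule projective_left_module)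
  interpret P: left_module A P by (rule lP)
  interpret Z: left_module A Z by (rule lZ)
  interpret RM: left_module A RM by (rule left_module_RM)
  note pD = lmod_homD[OF p(1)]
  let ?K = "lmod_kernel P Z p"
  have K: "submodule ?K A P" by (rule submodule_kernel[OF lP lZ p(1)])
  have lK: "left_module A (P\<lparr>carrier := ?K\<rparr>)" by (rule left_module_submodule[OF lP K])
  have "lmod_iso A (I \<alpha>) (P\<lparr>carrier := ?K\<rparr>)"
    using lmod_iso_trans[OF left_module_I lmod_iso_sym[OF X left_module_I iso] XK] by (simp add: \<alpha>_def)
  then obtain t where t: "t \<in> lmod_hom A (I \<alpha>) (P\<lparr>carrier := ?K\<rparr>)" "bij_betw t (carrier (I \<alpha>)) ?K"
    by (auto simp: lmod_iso_def)
  note tD = lmod_homD[OF t(1), simplified]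
  have t0: "t (el 0 0 0 0) = \<zero>\<^bsub>P\<^esub>" using lmod_hom_zero[OF left_module_I lK t(1)] by simp
  let ?g = "el 0 1 \<alpha> 0"
  have g: "?g \<in> carrier (I \<alpha>)" by simp
  define p0 where "p0 = t ?g"
  have Kc: "\<And>w. w \<in> ?K \<Longrightarrow> w \<in> carrier P" by (simp add: lmod_kernel_def)
  have p0: "p0 \<in> carrier P" unfolding p0_def using Kc[OF tD(1)[OF g]] .
  have "el 0 1 (q * \<alpha>) 0 \<odot>\<^bsub>P\<^esub> p0 = \<zero>\<^bsub>P\<^esub>"
    unfolding p0_def using tD(3)[OF _ g, of "el 0 1 (q * \<alpha>) 0"] t0 by simp
  then obtain p' where p': "p' \<in> carrier P" "p0 = ?g \<odot>\<^bsub>P\<^esub> p'"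
    using projective_annihilator[OF P p0] by blast
  define h where "h = (\<lambda>a\<in>carrier A. a \<odot>\<^bsub>P\<^esub> p')"
  have h: "h \<in> lmod_hom A RM P" unfolding h_def by (rule regular_module_hom[OF lP p'(1)])
  note hD = lmod_homD[OF h, simplified]
  have ht: "h u = t u" if "u \<in> carrier (I \<alpha>)" for u
  proof -
    obtain c d where "u = el 0 c (c * \<alpha>) d" using \<open>u \<in> carrier (I \<alpha>)\<close> by (rule I_cases)
    then have u: "u = el c 0 d 0 \<otimes>\<^bsub>A\<^esub> ?g" by simp
    have "t u = el c 0 d 0 \<odot>\<^bsub>P\<^esub> p0" unfolding u p0_def by (rule tD(3)[OF qel_in_carrier g])
    also have "\<dots> = (el c 0 d 0 \<otimes>\<^bsub>A\<^esub> ?g) \<odot>\<^bsub>P\<^esub> p'"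
      unfolding p'(2) by (rule P.smult_assoc1[symmetric, OF qel_in_carrier qel_in_carrier p'(1)])
    also have "\<dots> = h u" unfolding h_def u by (rule restrict_apply'[symmetric]) (rule P.R.m_closed[OF qel_in_carrier qel_in_carrier])
    finally show ?thesis ..
  qed
  have K_eq: "?K = h ` carrier (I \<alpha>)"
    using t(2) ht by (metis (no_types, lifting) bij_betw_imp_surj_on image_cong)
  have h_inj: "inj_on h (carrier A)"
  proof -
    have "inj_on h (carrier RM)"
    proof (rule lmod_hom_inj_onI[OF left_module_RM lP h], rule ccontr)
      fix a assume a: "a \<in> carrier RM" "h a = \<zero>\<^bsub>P\<^esub>" "a \<noteq> \<zero>\<^bsub>RM\<^esub>"
      have "tt \<in> lmod_kernel RM P h"
        by (rule nonzero_submodule_contains_tt[OF submodule_kernel[OF left_module_RM lP h], of a])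
          (use a in \<open>simp_all add: lmod_kernel_def qext_zero\<close>)
      then have "t tt = t (el 0 0 0 0)" using ht[of tt] t0 by (simp add: lmod_kernel_def)
      moreover have "inj_on t (carrier (I \<alpha>))" using t(2) by (rule bij_betw_imp_inj_on)
      ultimately have "tt = el 0 0 0 0" using inj_onD[of t "carrier (I \<alpha>)" tt "el 0 0 0 0"] by simp
      then show False by simp
    qed
    then show ?thesis by simp
  qed
  let ?B = "h ` carrier A"
  have B: "submodule ?B A P"
    using submodule_image[OF left_module_RM lP h submodule_carrier[OF left_module_RM]] by simp
  have id: "(\<lambda>a\<in>carrier A. a) \<in> lmod_hom A RM RM"
    using lmod_hom_restrictI[OF left_module_RM, of "\<lambda>a. a" RM] by simp
  have h0: "a = \<zero>\<^bsub>A\<^esub>" if "a \<in> carrier A" "h a = \<zero>\<^bsub>P\<^esub>" for a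
    using inj_onD[OF h_inj, of a "\<zero>\<^bsub>A\<^esub>"] lmod_hom_zero[OF left_module_RM lP h] that by simp
  obtain s where s: "s \<in> lmod_hom A (P\<lparr>carrier := ?B\<rparr>) RM" "\<And>a. a \<in> carrier A \<Longrightarrow> s (h a) = a"
    using lmod_hom_factor[OF left_module_RM lP left_module_RM h id] h0 by auto
  obtain r where r: "r \<in> lmod_hom A P RM" "\<And>w. w \<in> ?B \<Longrightarrow> r w = s w"
    by (rule regular_module_injective[OF flP B s(1)]) blast
  have rh: "r (h a) = a" if "a \<in> carrier A" for a using r(2)[of "h a"] s(2) that by simp
  note rD = lmod_homD[OF r(1), simplified]
  let ?N = "lmod_kernel P RM r"
  have N: "submodule ?N A P" by (rule submodule_kernel[OF lP left_module_RM r(1)])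
  have BN: "w = \<zero>\<^bsub>P\<^esub>" if "w \<in> ?B" "w \<in> ?N" for w
  proof -
    obtain a where a: "w = h a" "a \<in> carrier A" using \<open>w \<in> ?B\<close> by blast
    have "a = \<zero>\<^bsub>A\<^esub>" using rh[OF a(2)] \<open>w \<in> ?N\<close> a(1) by (simp add: lmod_kernel_def)
    then show ?thesis using a(1) lmod_hom_zero[OF left_module_RM lP h] by simp
  qed
  have decomp: "w \<ominus>\<^bsub>P\<^esub> h (r w) \<in> ?N" "w = h (r w) \<oplus>\<^bsub>P\<^esub> (w \<ominus>\<^bsub>P\<^esub> h (r w))" if w: "w \<in> carrier P" for w
  proof -
    have hr: "h (r w) \<in> carrier P" using hD(1)[OF rD(1)[OF w]] .
    have "r (w \<ominus>\<^bsub>P\<^esub> h (r w)) = r w \<ominus>\<^bsub>RM\<^esub> r w"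
      using lmod_hom_minus[OF lP left_module_RM r(1) w hr] rh[OF rD(1)[OF w]] by simp
    then show "w \<ominus>\<^bsub>P\<^esub> h (r w) \<in> ?N"
      using RM.diff_eq_zero_iff[of "r w" "r w"] rD(1)[OF w] w hr by (simp add: lmod_kernel_def)
    show "w = h (r w) \<oplus>\<^bsub>P\<^esub> (w \<ominus>\<^bsub>P\<^esub> h (r w))"
      using w hr by (simp add: a_minus_def P.M.a_lcomm[of _ w] P.M.r_neg)
  qed
  have KB: "?K \<subseteq> ?B" unfolding K_eq using I_in_A by blast
  have U: "submodule (p ` ?B) A Z" and V: "submodule (p ` ?N) A Z"
    using submodule_image[OF lP lZ p(1) B] submodule_image[OF lP lZ p(1) N] .
  have Bc: "\<And>w. w \<in> ?B \<Longrightarrow> w \<in> carrier P" and Nc: "\<And>w. w \<in> ?N \<Longrightarrow> w \<in> carrier P"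
    using submodule_subset[OF B] submodule_subset[OF N] by blast+
  have "p ` ?B \<inter> p ` ?N = {\<zero>\<^bsub>Z\<^esub>}"
  proof (intro equalityI subsetI)
    fix z assume "z \<in> p ` ?B \<inter> p ` ?N"
    then obtain b n where bn: "z = p b" "z = p n" "b \<in> ?B" "n \<in> ?N" by blast
    have c: "b \<in> carrier P" "n \<in> carrier P" using Bc[OF bn(3)] Nc[OF bn(4)] .
    have "p (b \<ominus>\<^bsub>P\<^esub> n) = p b \<ominus>\<^bsub>Z\<^esub> p b"
      using lmod_hom_minus[OF lP lZ p(1) c] bn(1,2) by simp
    then have "b \<ominus>\<^bsub>P\<^esub> n \<in> ?K"
      using Z.diff_eq_zero_iff[of "p b" "p b"] pD(1)[OF c(1)] c by (simp add: lmod_kernel_def)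
    then have "b \<ominus>\<^bsub>P\<^esub> n \<in> ?B" by (rule subsetD[OF KB])
    then have "(\<ominus>\<^bsub>P\<^esub> (b \<ominus>\<^bsub>P\<^esub> n)) \<oplus>\<^bsub>P\<^esub> b \<in> ?B"
      by (rule submodule_add[OF B submodule_uminus[OF B] bn(3)])
    moreover have "(\<ominus>\<^bsub>P\<^esub> (b \<ominus>\<^bsub>P\<^esub> n)) \<oplus>\<^bsub>P\<^esub> b = n"
      using c by (simp add: a_minus_def P.M.minus_add P.M.a_comm[of "\<ominus>\<^bsub>P\<^esub> b" n] P.M.a_assoc P.M.l_neg)
    ultimately have "n = \<zero>\<^bsub>P\<^esub>" using BN bn(4) by simp
    then show "z \<in> {\<zero>\<^bsub>Z\<^esub>}" using bn(2) lmod_hom_zero[OF lP lZ p(1)] by simp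
  next
    fix z assume "z \<in> {\<zero>\<^bsub>Z\<^esub>}"
    then have "z = \<zero>\<^bsub>Z\<^esub>" by simp
    then show "z \<in> p ` ?B \<inter> p ` ?N" using submodule_zero[OF U] submodule_zero[OF V] by (simp only: Int_iff)
  qed
  moreover have "p ` ?B <+>\<^bsub>Z\<^esub> p ` ?N = carrier Z"
  proof (intro equalityI subsetI)
    fix z assume "z \<in> p ` ?B <+>\<^bsub>Z\<^esub> p ` ?N"
    then obtain b n where "b \<in> ?B" "n \<in> ?N" "z = p b \<oplus>\<^bsub>Z\<^esub> p n" unfolding set_add_iff by blast
    then show "z \<in> carrier Z" using pD(1)[OF Bc] pD(1)[OF Nc] by simp
  next
    fix z assume "z \<in> carrier Z"
    then obtain w where w: "z = p w" "w \<in> carrier P" using p(2) by blast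
    have hr: "h (r w) \<in> ?B" using rD(1)[OF w(2)] by blast
    have "z = p (h (r w)) \<oplus>\<^bsub>Z\<^esub> p (w \<ominus>\<^bsub>P\<^esub> h (r w))"
      using pD(2)[OF Bc[OF hr] Nc[OF decomp(1)[OF w(2)]]] decomp(2)[OF w(2)] w(1) by simp
    then show "z \<in> p ` ?B <+>\<^bsub>Z\<^esub> p ` ?N" unfolding set_add_iff using hr decomp(1)[OF w(2)] by blast
  qed
  ultimately have "p ` ?B = {\<zero>\<^bsub>Z\<^esub>} \<or> p ` ?N = {\<zero>\<^bsub>Z\<^esub>}"
    using U V by (intro Z[unfolded indecomposable_def, THEN conjunct2, THEN conjunct2, rule_format] conjI)
  moreover have "p ` ?B \<noteq> {\<zero>\<^bsub>Z\<^esub>}"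
  proof
    assume "p ` ?B = {\<zero>\<^bsub>Z\<^esub>}"
    moreover have "p (h (sc 1)) \<in> p ` ?B" by (intro imageI qel_in_carrier)
    ultimately have "p (h (sc 1)) = \<zero>\<^bsub>Z\<^esub>" by simp
    then have "h (sc 1) \<in> ?K" using hD(1)[of "sc 1"] by (simp add: lmod_kernel_def)
    then obtain u where u: "u \<in> carrier (I \<alpha>)" "h (sc 1) = h u" unfolding K_eq by blast
    then have "sc 1 = u" using inj_onD[OF h_inj u(2)] I_in_A by blast
    then have "sc 1 \<in> carrier (I \<alpha>)" using u(1) by simp
    then show False by simp
  qed
  ultimately have pN: "p ` ?N = {\<zero>\<^bsub>Z\<^esub>}" by blast
  have surj: "h (r w) = w" if w: "w \<in> carrier P" for w
  proof -
    have n: "w \<ominus>\<^bsub>P\<^esub> h (r w) \<in> ?N" by (rule decomp(1)[OF w])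
    then have "p (w \<ominus>\<^bsub>P\<^esub> h (r w)) \<in> p ` ?N" by (rule imageI)
    then have "p (w \<ominus>\<^bsub>P\<^esub> h (r w)) = \<zero>\<^bsub>Z\<^esub>" unfolding pN by simp
    then have "w \<ominus>\<^bsub>P\<^esub> h (r w) \<in> ?K" using Nc[OF n] by (simp add: lmod_kernel_def)
    then have "w \<ominus>\<^bsub>P\<^esub> h (r w) = \<zero>\<^bsub>P\<^esub>" by (intro BN[OF _ n] subsetD[OF KB])
    then show ?thesis using P.diff_eq_zero_iff[OF w hD(1)[OF rD(1)[OF w]]] by simp
  qed
  let ?f = "compose (carrier RM) p h"
  have f: "?f \<in> lmod_hom A RM Z" by (rule lmod_hom_compose[OF left_module_RM h p(1)])
  have fa: "?f a = p (h a)" if "a \<in> carrier A" for a using that by (simp add: compose_eq)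
  show ?thesis
  proof (rule lmod_iso_of_same_kernel[OF left_module_RM lZ left_module_I f _ cover_hom])
    show "cover \<beta> ` carrier RM = carrier (I \<beta>)" using cover_image by simp
    show "?f ` carrier RM = carrier Z"
    proof (intro equalityI subsetI)
      fix z assume "z \<in> ?f ` carrier RM"
      then show "z \<in> carrier Z" using lmod_homD(1)[OF f] by auto
    next
      fix z assume "z \<in> carrier Z"
      then obtain w where w: "z = p w" "w \<in> carrier P" using p(2) by blast
      then have "z = ?f (r w)" using surj[OF w(2)] fa[OF rD(1)[OF w(2)]] by simp
      then show "z \<in> ?f ` carrier RM" using rD(1)[OF w(2)] by simp
    qed
    fix a assume "a \<in> carrier RM"
    then have a: "a \<in> carrier A" by simp
    have "?f a = \<zero>\<^bsub>Z\<^esub> \<longleftrightarrow> h a \<in> ?K" using fa[OF a] hD(1)[OF a] by (simp add: lmod_kernel_def)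
    also have "\<dots> \<longleftrightarrow> a \<in> carrier (I \<alpha>)"
      unfolding K_eq using inj_on_image_mem_iff[OF h_inj a, of "carrier (I \<alpha>)"] I_in_A by blast
    also have "\<dots> \<longleftrightarrow> cover \<beta> a = \<zero>\<^bsub>I \<beta>\<^esub>"
      unfolding \<alpha>_def cover_kernel[symmetric] using a by (simp add: lmod_kernel_def)
    finally show "?f a = \<zero>\<^bsub>Z\<^esub> \<longleftrightarrow> cover \<beta> a = \<zero>\<^bsub>I \<beta>\<^esub>" .
  qed
qed


section \<open>Extensions between the modules A(x + \<alpha> y)\<close>

lemma cover_hom_RM: "cover \<alpha> \<in> lmod_hom A RM RM"
proof (rule lmod_hom_from_submodule_codomain)
  show "cover \<alpha> \<in> lmod_hom A RM (RM\<lparr>carrier := carrier (I \<alpha>)\<rparr>)" unfolding I_eq by (rule cover_hom)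
  show "carrier (I \<alpha>) \<subseteq> carrier RM" by (simp add: subset_iff I_in_A)
qed

text \<open>The term of index \<open>0\<close> is the covering \<open>A \<rightarrow> I(\<alpha>)\<close>, and the \<open>i\<close>-th differential \<open>A \<rightarrow> A\<close> is the covering of
  \<open>I(q\<^sup>i \<alpha>)\<close>, composed with the inclusion into \<open>A\<close>.\<close>
lemma resolution_I: "projective_resolution A (I \<alpha>) (\<lambda>i. RM) (\<lambda>i. cover (q ^ i * \<alpha>))"
proof -
  have ker: "lmod_kernel RM RM (cover \<beta>) = carrier (I (q * \<beta>))" for \<beta>
    unfolding cover_kernel[symmetric] by (simp add: lmod_kernel_def qext_zero)
  show ?thesis
    unfolding projective_resolution_def
    by (simp add: projective_RM cover_hom cover_hom_RM cover_image cover_kernel ker mult.assoc)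
qed

lemma cocycles_RM:
  assumes res: "projective_resolution A M P d"
  shows "cocycles A P d RM (Suc j) \<subseteq> coboundaries A P d RM (Suc j)"
  unfolding cocycles_subset_coboundaries_iff[OF res left_module_RM]
proof
  note r = projective_resolutionD[OF res]
  have lm: "left_module A (P k)" for k by (rule projective_left_module[OF r(1)])
  let ?B = "d (Suc j) ` carrier (P (Suc j))"
  have B: "submodule ?B A (P j)"
    by (rule submodule_image[OF lm lm r(4) submodule_carrier[OF lm]])
  fix f assume f: "f \<in> lmod_hom A ((P j)\<lparr>carrier := ?B\<rparr>) RM"
  obtain F where "F \<in> lmod_hom A (P j) RM" "\<And>u. u \<in> ?B \<Longrightarrow> F u = f u"
    by (rule regular_module_injective[OF projective_fl_module[OF r(1)] B f]) blast
  then show "\<exists>F\<in>lmod_hom A (P j) RM. \<forall>x\<in>?B. F x = f x" by blast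
qed

lemma Ext_RM_zero: "Ext_zero A (Suc j) (I \<alpha>) RM"
proof -
  obtain P d where res: "projective_resolution A (I \<alpha>) P d"
    and Ext: "\<And>j (N :: ('k qext, 'k qext) module). left_module A N \<Longrightarrow>
      Ext_zero A (Suc j) (I \<alpha>) N \<longleftrightarrow> cocycles A P d N (Suc j) \<subseteq> coboundaries A P d N (Suc j)"
    by (rule Ext_zero_resolution[OF resolution_I[of \<alpha>]]) blast
  show ?thesis unfolding Ext[OF left_module_RM] by (rule cocycles_RM[OF res])
qed

text \<open>Dimension shift along \<open>0 \<rightarrow> I(q \<gamma>) \<rightarrow> A \<rightarrow> I(\<gamma>) \<rightarrow> 0\<close>, carried out by a diagram chase inside a fixed
  resolution. The cocycle \<open>c\<close> becomes a coboundary \<open>G \<circ> d\<close> in \<open>A\<close>. The image of \<open>G\<close> in \<open>I(\<gamma>)\<close> is a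
  cocycle one degree lower, hence a coboundary \<open>H \<circ> d\<close>. Correcting \<open>G\<close> by a lift of \<open>H\<close> makes it take
  its values in \<open>I(q \<gamma>)\<close> without changing \<open>G \<circ> d\<close>.\<close>
lemma cocycles_shift:
  fixes M :: "('k qext, 'k qext) module"
  assumes res: "projective_resolution A M P d"
    and sub: "cocycles A P d (I \<gamma>) (Suc j) \<subseteq> coboundaries A P d (I \<gamma>) (Suc j)"
  shows "cocycles A P d (I (q * \<gamma>)) (Suc (Suc j)) \<subseteq> coboundaries A P d (I (q * \<gamma>)) (Suc (Suc j))"
proof
  note r = projective_resolutionD[OF res]
  have lm: "left_module A (P k)" for k by (rule projective_left_module[OF r(1)])
  let ?P = "P (Suc (Suc j))" and ?Q = "P (Suc j)" and ?S = "P j"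
  let ?d = "d (Suc (Suc j))" and ?e = "d (Suc j)"
  interpret RM: left_module A RM by (rule left_module_RM)
  interpret I: left_module A "I \<gamma>" by (rule left_module_I)
  have dc: "?d x \<in> carrier ?Q" if "x \<in> carrier ?P" for x using lmod_homD(1)[OF r(4) that] .
  have ec: "?e x \<in> carrier ?S" if "x \<in> carrier ?Q" for x using lmod_homD(1)[OF r(4) that] .
  have ker: "cover \<gamma> u = el 0 0 0 0 \<longleftrightarrow> u \<in> carrier (I (q * \<gamma>))" if "u \<in> carrier A" for u
    using that unfolding cover_kernel[symmetric] by (simp add: lmod_kernel_def)
  fix c assume "c \<in> cocycles A P d (I (q * \<gamma>)) (Suc (Suc j))"
  then have c: "c \<in> lmod_hom A ?P (I (q * \<gamma>))"
    and c0: "\<forall>x\<in>carrier (P (Suc (Suc (Suc j)))). c (d (Suc (Suc (Suc j))) x) = \<zero>\<^bsub>A\<^esub>"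
    by (simp_all add: cocycles_def qext_zero)
  note cD = lmod_homD[OF c]
  have "c \<in> lmod_hom A ?P (RM\<lparr>carrier := carrier (I (q * \<gamma>))\<rparr>)" unfolding I_eq by (rule c)
  then have "c \<in> lmod_hom A ?P RM"
    by (rule lmod_hom_from_submodule_codomain) (simp add: subset_iff I_in_A)
  then have "c \<in> cocycles A P d RM (Suc (Suc j))" using c0 by (simp add: cocycles_def)
  then obtain G where G: "G \<in> lmod_hom A ?Q RM" "c = compose (carrier ?P) G ?d"
    using cocycles_RM[OF res, of "Suc j"] by auto
  note GD = lmod_homD[OF G(1), simplified]
  have Gd: "G (?d x) = c x" if "x \<in> carrier ?P" for x using that by (simp add: G(2) compose_eq)
  let ?g = "compose (carrier ?Q) (cover \<gamma>) G"
  have g: "?g \<in> lmod_hom A ?Q (I \<gamma>)" by (rule lmod_hom_compose[OF lm G(1) cover_hom])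
  have "?g (?d x) = el 0 0 0 0" if x: "x \<in> carrier ?P" for x
  proof -
    have "c x \<in> carrier (I (q * \<gamma>))" by (rule cD(1)[OF x])
    then show ?thesis using ker[OF I_in_A] Gd[OF x] dc[OF x] by (simp add: compose_eq)
  qed
  then have "?g \<in> cocycles A P d (I \<gamma>) (Suc j)" using g by (simp add: cocycles_def)
  then obtain H where H: "H \<in> lmod_hom A ?S (I \<gamma>)" "?g = compose (carrier ?Q) H ?e"
    using sub by auto
  obtain H' where H': "H' \<in> lmod_hom A ?S RM" "\<And>x. x \<in> carrier ?S \<Longrightarrow> cover \<gamma> (H' x) = H x"
    using projective_lift[OF r(1) fl_module_RM fl_module_I cover_hom _ H(1)] cover_image by auto
  note HD = lmod_homD[OF H'(1), simplified]
  let ?F = "\<lambda>x\<in>carrier ?Q. G x \<ominus>\<^bsub>RM\<^esub> compose (carrier ?Q) H' ?e x"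
  have F: "?F \<in> lmod_hom A ?Q RM"
    by (rule lmod_hom_diff[OF lm left_module_RM G(1) lmod_hom_compose[OF lm r(4) H'(1)]])
  have Fx: "?F x = G x \<ominus>\<^bsub>RM\<^esub> H' (?e x)" if "x \<in> carrier ?Q" for x using that by (simp add: compose_eq)
  have "?F \<in> lmod_hom A ?Q (RM\<lparr>carrier := carrier (I (q * \<gamma>))\<rparr>)"
  proof (rule lmod_hom_into_submodule[OF F], rule image_subsetI)
    fix x assume x: "x \<in> carrier ?Q"
    have HA: "H' (?e x) \<in> carrier RM" using HD(1)[OF ec[OF x]] by simp
    have GA: "G x \<in> carrier RM" using GD(1)[OF x] by simp
    have "cover \<gamma> (G x) = H (?e x)" using fun_cong[OF H(2), of x] x by (simp add: compose_eq)
    then have "cover \<gamma> (G x \<ominus>\<^bsub>RM\<^esub> H' (?e x)) = H (?e x) \<ominus>\<^bsub>I \<gamma>\<^esub> H (?e x)"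
      using lmod_hom_minus[OF left_module_RM left_module_I cover_hom GA HA] H'(2)[OF ec[OF x]] by simp
    then have "cover \<gamma> (?F x) = el 0 0 0 0"
      using I.diff_eq_zero_iff lmod_homD(1)[OF H(1) ec[OF x]] Fx[OF x] by simp
    moreover have "?F x \<in> carrier A" using lmod_homD(1)[OF F x] by simp
    ultimately show "?F x \<in> carrier (I (q * \<gamma>))" using ker by simp
  qed
  then have F': "?F \<in> lmod_hom A ?Q (I (q * \<gamma>))" unfolding I_eq .
  have "?F (?d x) = c x" if x: "x \<in> carrier ?P" for x
  proof -
    have "?F (?d x) = c x \<ominus>\<^bsub>RM\<^esub> \<zero>\<^bsub>RM\<^esub>"
      using Fx[OF dc[OF x]] Gd[OF x] projective_resolution_complex[OF res x]
        lmod_hom_zero[OF lm left_module_RM H'(1)] by simp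
    also have "\<dots> = c x"
    proof -
      obtain a b where "c x = el 0 a (a * (q * \<gamma>)) b" using cD(1)[OF x] by (rule I_cases)
      then show ?thesis by (simp add: a_minus_def qext_zero ring_A)
    qed
    finally show ?thesis .
  qed
  then have "c = compose (carrier ?P) ?F ?d"
    using cD(4) by (intro extensionalityI[of c "carrier ?P"]) (simp_all add: compose_eq)
  then show "c \<in> coboundaries A P d (I (q * \<gamma>)) (Suc (Suc j))" using F' by simp
qed

text \<open>The image of the generator \<open>x + q \<alpha> y\<close> is annihilated by \<open>x + q\<^sup>2 \<alpha> y\<close>. For \<open>\<beta> \<noteq> q \<alpha>\<close> this
  leaves only the multiples \<open>d y x\<close>, and for \<open>\<beta> \<noteq> \<alpha>\<close> the element \<open>y x\<close> is a multiple of
  \<open>(x + q \<alpha> y)(x + \<beta> y) = q (\<alpha> - \<beta>) y x\<close>. Therefore \<open>1\<close> can be mapped to \<open>e (x + \<beta> y)\<close>.\<close>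
lemma extend_from_I:
  assumes f: "f \<in> lmod_hom A (I (q * \<alpha>)) (I \<beta>)" and ne: "\<beta> \<noteq> \<alpha>" "\<beta> \<noteq> q * \<alpha>"
  shows "\<exists>F\<in>lmod_hom A RM (I \<beta>). \<forall>u\<in>carrier (I (q * \<alpha>)). F u = f u"
proof -
  note fD = lmod_homD[OF f, simplified]
  let ?g = "el 0 1 (q * \<alpha>) 0"
  have g: "?g \<in> carrier (I (q * \<alpha>))" by simp
  obtain c d where m: "f ?g = el 0 c (c * \<beta>) d" using fD(1)[OF g] by (rule I_cases)
  have "f (el 0 1 (q * (q * \<alpha>)) 0 \<otimes>\<^bsub>A\<^esub> ?g) = el 0 1 (q * (q * \<alpha>)) 0 \<otimes>\<^bsub>A\<^esub> f ?g"
    by (rule fD(3)[OF qel_in_carrier g])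
  moreover have "f (el 0 0 0 0) = el 0 0 0 0"
    using lmod_hom_zero[OF left_module_I left_module_I f] by simp
  ultimately have "q * (q * \<alpha>) * c = q * (c * \<beta>)" using m by simp
  then have c: "c = 0" using q_nonzero ne(2) by simp
  define e where "e = d / (q * (\<alpha> - \<beta>))"
  have "q * \<alpha> * e - q * (e * \<beta>) = q * (\<alpha> - \<beta>) * e" by (simp add: algebra_simps)
  then have e: "q * \<alpha> * e - q * (e * \<beta>) = d" using q_nonzero ne(1) by (simp add: e_def)
  let ?F = "\<lambda>a\<in>carrier A. a \<otimes>\<^bsub>A\<^esub> el 0 e (e * \<beta>) 0"
  have "?F \<in> lmod_hom A RM (I \<beta>)"
    using regular_module_hom[OF left_module_I, of "el 0 e (e * \<beta>) 0" \<beta>] by simp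
  moreover have "?F u = f u" if u: "u \<in> carrier (I (q * \<alpha>))" for u
  proof -
    obtain c' d' where u': "u = el 0 c' (c' * (q * \<alpha>)) d'" using u by (rule I_cases)
    then have "u = el c' 0 d' 0 \<otimes>\<^bsub>A\<^esub> ?g" by simp
    then have "f u = el c' 0 d' 0 \<otimes>\<^bsub>A\<^esub> f ?g" using fD(3)[OF qel_in_carrier g] by simp
    then have "f u = el 0 0 0 (c' * d)" using m c by simp
    moreover have "?F u = el 0 0 0 (c' * (q * \<alpha> * e - q * (e * \<beta>)))"
      using u' by (simp add: algebra_simps)
    ultimately show ?thesis using e by simp
  qed
  ultimately show ?thesis by blast
qed

lemma kernel_module_eq: "RM\<lparr>carrier := lmod_kernel RM (I \<alpha>) (cover \<alpha>)\<rparr> = I (q * \<alpha>)"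
  using I_eq[of "q * \<alpha>"] unfolding cover_kernel .

lemma first_cocycles_I:
  assumes res: "projective_resolution A (I \<alpha>) P d" and ne: "\<beta> \<noteq> \<alpha>" "\<beta> \<noteq> q * \<alpha>"
  shows "cocycles A P d (I \<beta>) (Suc 0) \<subseteq> coboundaries A P d (I \<beta>) (Suc 0)"
  unfolding first_cocycles_subset_coboundaries_iff[OF res left_module_I]
proof
  note r = projective_resolutionD[OF res]
  fix f assume f: "f \<in> lmod_hom A ((P 0)\<lparr>carrier := lmod_kernel (P 0) (I \<alpha>) (d 0)\<rparr>) (I \<beta>)"
  show "\<exists>F\<in>lmod_hom A (P 0) (I \<beta>). \<forall>x\<in>lmod_kernel (P 0) (I \<alpha>) (d 0). F x = f x"
  proof (rule extension_from_kernel_transfer[OF projective_RM r(1) fl_module_I left_module_I cover_hom _ r(2,3) _ f])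
    show "cover \<alpha> ` carrier RM = carrier (I \<alpha>)" using cover_image by simp
    fix f assume "f \<in> lmod_hom A (RM\<lparr>carrier := lmod_kernel RM (I \<alpha>) (cover \<alpha>)\<rparr>) (I \<beta>)"
    then show "\<exists>F\<in>lmod_hom A RM (I \<beta>). \<forall>x\<in>lmod_kernel RM (I \<alpha>) (cover \<alpha>). F x = f x"
      unfolding kernel_module_eq unfolding cover_kernel by (rule extend_from_I[OF _ ne])
  qed
qed

text \<open>The homomorphism \<open>k\<close> from \<open>I(q \<alpha>)\<close> to \<open>I(\<alpha>)\<close> that maps \<open>x + q \<alpha> y\<close> to \<open>y x\<close> and \<open>y x\<close> to zero does not
  extend to \<open>A\<close>: an extension would map \<open>x + q \<alpha> y\<close> into \<open>(x + q \<alpha> y) I(\<alpha>)\<close>, which is zero.\<close>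
lemma first_cocycles_self:
  assumes res: "projective_resolution A (I \<alpha>) P d"
  shows "\<not> cocycles A P d (I \<alpha>) (Suc 0) \<subseteq> coboundaries A P d (I \<alpha>) (Suc 0)"
proof
  note r = projective_resolutionD[OF res]
  assume "cocycles A P d (I \<alpha>) (Suc 0) \<subseteq> coboundaries A P d (I \<alpha>) (Suc 0)"
  then have ext: "\<exists>F\<in>lmod_hom A (P 0) (I \<alpha>). \<forall>x\<in>lmod_kernel (P 0) (I \<alpha>) (d 0). F x = f x"
    if "f \<in> lmod_hom A ((P 0)\<lparr>carrier := lmod_kernel (P 0) (I \<alpha>) (d 0)\<rparr>) (I \<alpha>)" for f
    using that unfolding first_cocycles_subset_coboundaries_iff[OF res left_module_I] by blast
  define k where "k u = (THE s. \<exists>c d. u = el 0 c (c * (q * \<alpha>)) d \<and> s = el 0 0 0 c)" for u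
  have k: "k (el 0 c (c * (q * \<alpha>)) d) = el 0 0 0 c" for c d
    unfolding k_def by (rule the_equality) auto
  let ?k = "restrict k (carrier (I (q * \<alpha>)))"
  have k_hom: "?k \<in> lmod_hom A (I (q * \<alpha>)) (I \<alpha>)"
  proof (rule lmod_hom_restrictI[OF left_module_I])
    fix u assume "u \<in> carrier (I (q * \<alpha>))"
    then obtain c d where u: "u = el 0 c (c * (q * \<alpha>)) d" by (rule I_cases)
    show "k u \<in> carrier (I \<alpha>)" unfolding u k by simp
    show "k (a \<odot>\<^bsub>I (q * \<alpha>)\<^esub> u) = a \<odot>\<^bsub>I \<alpha>\<^esub> k u" if "a \<in> carrier A" for a
    proof -
      obtain a0 a1 a2 a3 where a: "a = el a0 a1 a2 a3" using \<open>a \<in> carrier A\<close> by (rule qext_cases)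
      show ?thesis unfolding u a k
        using k[of "a0 * c"] by (simp add: mult.assoc)
    qed
    fix v assume "v \<in> carrier (I (q * \<alpha>))"
    then obtain c' d' where v: "v = el 0 c' (c' * (q * \<alpha>)) d'" by (rule I_cases)
    show "k (u \<oplus>\<^bsub>I (q * \<alpha>)\<^esub> v) = k u \<oplus>\<^bsub>I \<alpha>\<^esub> k v"
      unfolding u v k using k[of "c + c'" "d + d'"] by (simp add: distrib_right)
  qed
  have "\<exists>F\<in>lmod_hom A RM (I \<alpha>). \<forall>x\<in>lmod_kernel RM (I \<alpha>) (cover \<alpha>). F x = ?k x"
  proof (rule extension_from_kernel_transfer[OF r(1) projective_RM fl_module_I left_module_I r(2,3) cover_hom _ ext])
    show "cover \<alpha> ` carrier RM = carrier (I \<alpha>)" using cover_image by simp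
    show "?k \<in> lmod_hom A (RM\<lparr>carrier := lmod_kernel RM (I \<alpha>) (cover \<alpha>)\<rparr>) (I \<alpha>)"
      unfolding kernel_module_eq by (rule k_hom)
  qed
  then obtain F where F: "F \<in> lmod_hom A RM (I \<alpha>)" "\<And>x. x \<in> carrier (I (q * \<alpha>)) \<Longrightarrow> F x = ?k x"
    unfolding cover_kernel by blast
  let ?g = "el 0 1 (1 * (q * \<alpha>)) 0"
  have g: "?g \<in> carrier (I (q * \<alpha>))" by simp
  have Fg: "F ?g = tt" using F(2)[OF g] k[of 1 0] g by simp
  have "F \<one>\<^bsub>A\<^esub> \<in> carrier (I \<alpha>)" using lmod_homD(1)[OF F(1), of "\<one>\<^bsub>A\<^esub>"] by (simp add: qext_one)
  then obtain c d where "F \<one>\<^bsub>A\<^esub> = el 0 c (c * \<alpha>) d" by (rule I_cases)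
  then have "F ?g = el 0 0 0 0"
    using regular_module_hom_eq[OF left_module_I F(1), of ?g] by simp
  then show False using Fg by simp
qed

lemma Ext_self_first_nonzero: "\<not> Ext_zero A 1 (I \<alpha>) (I \<alpha>)"
proof -
  obtain P d where res: "projective_resolution A (I \<alpha>) P d"
    and Ext: "\<And>j (N :: ('k qext, 'k qext) module). left_module A N \<Longrightarrow>
      Ext_zero A (Suc j) (I \<alpha>) N \<longleftrightarrow> cocycles A P d N (Suc j) \<subseteq> coboundaries A P d N (Suc j)"
    by (rule Ext_zero_resolution[OF resolution_I[of \<alpha>]]) blast
  show ?thesis unfolding One_nat_def Ext[OF left_module_I] by (rule first_cocycles_self[OF res])
qed

lemma Ext_zero_of_shift:
  assumes ne: "\<beta> \<noteq> \<alpha>" "\<beta> \<noteq> q * \<alpha>"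
  shows "Ext_zero A (Suc j) (I \<alpha>) (I (q ^ j * \<beta>))"
proof -
  obtain P d where res: "projective_resolution A (I \<alpha>) P d"
    and Ext: "\<And>j (N :: ('k qext, 'k qext) module). left_module A N \<Longrightarrow>
      Ext_zero A (Suc j) (I \<alpha>) N \<longleftrightarrow> cocycles A P d N (Suc j) \<subseteq> coboundaries A P d N (Suc j)"
    by (rule Ext_zero_resolution[OF resolution_I[of \<alpha>]]) blast
  have "cocycles A P d (I (q ^ j * \<beta>)) (Suc j) \<subseteq> coboundaries A P d (I (q ^ j * \<beta>)) (Suc j)"
  proof (induction j)
    case 0
    show ?case using first_cocycles_I[OF res ne] by simp
  next
    case (Suc j)
    then show ?case using cocycles_shift[OF res Suc.IH] by (simp only: power_Suc mult.assoc)
  qed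
  then show ?thesis using Ext[OF left_module_I] by simp
qed

end

section \<open>The component of A(x + y)\<close>


text \<open>The conditions say that each \<open>V z\<close> has exactly the two neighbours \<open>V (z - 1)\<close> and \<open>V (z + 1)\<close>. The
  isomorphism sends \<open>V z\<close> to \<open>- z\<close>, since the arrows of the quiver \<open>\<int>\<close> lower the index.\<close>
lemma type_Z_quiver_componentI:
  fixes Q :: "'v pair_pre_digraph" and V :: "int \<Rightarrow> 'v"
  assumes inj: "inj V" and verts: "\<And>z. V z \<in> pverts Q"
    and out_arcs: "\<And>z w. (V z, w) \<in> parcs Q \<longleftrightarrow> w = V (z + 1)"
    and in_arcs: "\<And>z w. (w, V z) \<in> parcs Q \<longleftrightarrow> w = V (z - 1)"
  shows "type_Z (quiver_component Q (V 0))"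
proof -
  let ?S = "with_proj (mk_symmetric (with_proj Q))"
  have sym_arc: "(u, w) \<in> parcs (mk_symmetric (with_proj Q)) \<longleftrightarrow> (u, w) \<in> parcs Q \<or> (w, u) \<in> parcs Q" for u w
    unfolding parcs_mk_symmetric with_proj_simps
    by (auto intro: bexI[of _ "(u, w)"] bexI[of _ "(w, u)"])
  have reach_nat: "V 0 \<rightarrow>\<^sup>*\<^bsub>?S\<^esub> V (int n) \<and> V 0 \<rightarrow>\<^sup>*\<^bsub>?S\<^esub> V (- int n)" for n
  proof (induction n)
    case 0
    show ?case using verts[of 0] by (simp add: reachable_def)
  next
    case (Suc n)
    have "(V (int n), V (int (Suc n))) \<in> parcs (mk_symmetric (with_proj Q))"
      unfolding sym_arc using out_arcs[of "int n"] by (simp add: add.commute)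
    moreover have "(V (- int n), V (- int (Suc n))) \<in> parcs (mk_symmetric (with_proj Q))"
    proof -
      have "- int (Suc n) = - int n - 1" by simp
      then show ?thesis unfolding sym_arc in_arcs by (intro disjI2 arg_cong[of _ _ V])
    qed
    ultimately show ?case
      using Suc verts unfolding reachable_def by (auto intro: rtrancl_on_into_rtrancl_on)
  qed
  have reach: "V 0 \<rightarrow>\<^sup>*\<^bsub>?S\<^esub> V z" for z
    using reach_nat[of "nat z"] reach_nat[of "nat (- z)"] by (cases "z \<ge> 0") simp_all
  have only: "w \<in> range V" if "V 0 \<rightarrow>\<^sup>*\<^bsub>?S\<^esub> w" for w
    using that unfolding reachable_def
  proof (induction rule: rtrancl_on_induct)
    case base
    show ?case by simp
  next
    case (step u w)
    then obtain z where "u = V z" by blast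
    then have "(V z, w) \<in> parcs Q \<or> (w, V z) \<in> parcs Q"
      using step.hyps(2) by (simp add: sym_arc)
    then show ?case using out_arcs in_arcs by auto
  qed
  have set: "{w. V 0 \<rightarrow>\<^sup>*\<^bsub>?S\<^esub> w} = range V" using reach only by blast
  define C where "C = quiver_component Q (V 0)"
  have C: "verts C = range V" "tail C = fst" "head C = snd" "arcs C = range (\<lambda>z. (V z, V (z + 1)))"
  proof -
    show "verts C = range V" "tail C = fst" "head C = snd"
      by (simp_all add: C_def quiver_component_def set)
    have "arcs C = {e \<in> parcs Q. fst e \<in> range V \<and> snd e \<in> range V}"
      by (simp add: C_def quiver_component_def set)
    also have "\<dots> = range (\<lambda>z. (V z, V (z + 1)))"
      using out_arcs by (auto simp: image_iff)
    finally show "arcs C = range (\<lambda>z. (V z, V (z + 1)))" .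
  qed
  define idx where "idx w = - inv_into UNIV V w" for w
  have nu [simp]: "idx (V z) = - z" for z using inj by (simp add: idx_def)
  let ?iso = "\<lparr>iso_verts = idx, iso_arcs = (\<lambda>e. (idx (fst e), idx (snd e))), iso_head = snd, iso_tail = fst\<rparr>"
  have "pre_digraph.digraph_isomorphism C ?iso"
    unfolding pre_digraph.digraph_isomorphism_def
  proof (intro conjI)
    show "wf_digraph C" by unfold_locales (auto simp: C)
    show "inj_on (iso_verts ?iso) (verts C)" by (auto simp: C inj_on_def)
    show "inj_on (iso_arcs ?iso) (arcs C)" by (auto simp: C inj_on_def)
  qed (auto simp: C)
  moreover have "with_proj Z_quiver = app_iso ?iso C"
  proof -
    have "range (\<lambda>z::int. - z) = UNIV" by (rule surjI[of _ uminus]) simp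
    moreover have "range (\<lambda>z::int. (- z, - (z + 1))) = {(z, z - 1) | z. True}"
    proof -
      have "(z, z - 1) \<in> range (\<lambda>z::int. (- z, - (z + 1)))" for z
        by (rule range_eqI[of _ _ "- z"]) simp
      then show ?thesis by auto
    qed
    ultimately show ?thesis
      by (simp add: app_iso_def with_proj_def Z_quiver_def C image_image)
  qed
  ultimately show ?thesis unfolding type_Z_def digraph_iso_def C_def by blast
qed

context quantum_exterior begin

lemma left_module_vertex: "indecomposable A X \<Longrightarrow> left_module A X"
  by (simp add: indecomposable_def fl_module_def)

lemma I_in_verts: "iso_class A (I \<alpha>) \<in> pverts (mho_quiver A)"
  unfolding mho_quiver_def using indecomposable_I not_projective_I by (auto simp: Let_def)

lemma mho_arc_iff:
  "(u, w) \<in> parcs (mho_quiver A) \<longleftrightarrow> (\<exists>Z X. u = iso_class A Z \<and> w = iso_class A X \<and>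
     indecomposable A Z \<and> \<not> projective A Z \<and> indecomposable A X \<and> \<not> projective A X \<and>
     is_syzygy A Z X \<and> Ext_zero A 1 Z RM)"
  unfolding mho_quiver_def Let_def by auto

lemma mho_arc_I: "(iso_class A (I \<alpha>), iso_class A (I (q * \<alpha>))) \<in> parcs (mho_quiver A)"
  unfolding mho_arc_iff
proof (intro exI conjI)
  show "Ext_zero A 1 (I \<alpha>) RM" unfolding One_nat_def by (rule Ext_RM_zero)
qed (rule refl indecomposable_I not_projective_I is_syzygy_I)+

lemma mho_out_arcs:
  "(iso_class A (I \<alpha>), w) \<in> parcs (mho_quiver A) \<longleftrightarrow> w = iso_class A (I (q * \<alpha>))"
proof
  assume "(iso_class A (I \<alpha>), w) \<in> parcs (mho_quiver A)"
  then obtain Z X where ZX: "iso_class A (I \<alpha>) = iso_class A Z" "w = iso_class A X"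
    "indecomposable A Z" "indecomposable A X" "is_syzygy A Z X"
    unfolding mho_arc_iff by blast
  have Z: "left_module A Z" and X: "left_module A X" using ZX(3,4) left_module_vertex by blast+
  have "lmod_iso A Z (I \<alpha>)" unfolding iso_class_eq_iff[OF Z left_module_I, symmetric] using ZX(1) by (rule sym)
  then have "lmod_iso A X (I (q * \<alpha>))" by (rule syzygy_of_I_unique[OF Z X _ ZX(5)])
  then show "w = iso_class A (I (q * \<alpha>))" unfolding ZX(2) by (simp only: iso_class_eq_iff[OF X left_module_I])
qed (simp only: mho_arc_I)

lemma mho_in_arcs:
  "(w, iso_class A (I (q * \<beta>))) \<in> parcs (mho_quiver A) \<longleftrightarrow> w = iso_class A (I \<beta>)"
proof
  assume "(w, iso_class A (I (q * \<beta>))) \<in> parcs (mho_quiver A)"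
  then obtain Z X where ZX: "w = iso_class A Z" "iso_class A (I (q * \<beta>)) = iso_class A X"
    "indecomposable A Z" "indecomposable A X" "is_syzygy A Z X"
    unfolding mho_arc_iff by blast
  have Z: "left_module A Z" and X: "left_module A X" using ZX(3,4) left_module_vertex by blast+
  have "lmod_iso A X (I (q * \<beta>))" unfolding iso_class_eq_iff[OF X left_module_I, symmetric] using ZX(2) by (rule sym)
  then have "lmod_iso A Z (I \<beta>)" by (rule syzygy_I_preimage[OF ZX(3) X _ ZX(5)])
  then show "w = iso_class A (I \<beta>)" unfolding ZX(1) by (simp only: iso_class_eq_iff[OF Z left_module_I])
qed (simp only: mho_arc_I)

lemma power_int_inj:
  assumes ord: "\<forall>n::nat. n > 0 \<longrightarrow> q ^ n \<noteq> 1"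
  shows "inj (\<lambda>z::int. q powi z)"
proof (rule injI)
  have *: "\<not> m < n" if eq: "q powi m = q powi n" for m n :: int
  proof
    assume "m < n"
    have "q powi (n - m) = 1" using eq q_nonzero by (simp add: power_int_diff)
    then have "q ^ nat (n - m) = 1" using \<open>m < n\<close> by (simp add: power_int_def)
    then show False using ord \<open>m < n\<close> by simp
  qed
  fix m n :: int assume "q powi m = q powi n"
  then show "m = n" using *[of m n] *[of n m] by simp
qed

lemma type_Z_mho_component:
  assumes ord: "\<forall>n::nat. n > 0 \<longrightarrow> q ^ n \<noteq> 1"
  shows "type_Z (mho_component A (I 1))"
proof -
  let ?V = "\<lambda>z::int. iso_class A (I (q powi z))"
  have "type_Z (quiver_component (mho_quiver A) (?V 0))"
  proof (rule type_Z_quiver_componentI)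
    show "inj ?V"
    proof (rule injI)
      fix m n :: int assume "?V m = ?V n"
      then have "lmod_iso A (I (q powi m)) (I (q powi n))"
        by (simp only: iso_class_eq_iff[OF left_module_I left_module_I])
      then have "q powi m = q powi n" by (rule lmod_iso_I_imp_eq)
      then show "m = n" using power_int_inj[OF ord] by (simp add: inj_def)
    qed
    show "?V z \<in> pverts (mho_quiver A)" for z by (rule I_in_verts)
    have succ: "q powi (z + 1) = q * q powi z" for z using q_nonzero by (simp add: power_int_add_1')
    show "(?V z, w) \<in> parcs (mho_quiver A) \<longleftrightarrow> w = ?V (z + 1)" for z w
      unfolding succ by (rule mho_out_arcs)
    show "(w, ?V z) \<in> parcs (mho_quiver A) \<longleftrightarrow> w = ?V (z - 1)" for z w
      using mho_in_arcs[of w "q powi (z - 1)"] succ[of "z - 1"] by simp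
  qed
  then show ?thesis unfolding mho_component_def by simp
qed

lemma dimension_I: "ring.dimension A 2 (qext_scalars q) (carrier (I \<alpha>))"
proof -
  interpret ring A by (rule ring_A)
  let ?K = "qext_scalars q" and ?T = "{el 0 0 0 d | d. True}"
  have line: "line_extension ?K v E = {sc c \<otimes>\<^bsub>A\<^esub> v \<oplus>\<^bsub>A\<^esub> e | c e. e \<in> E}" for v E
    unfolding line_extension_def set_add_def' r_coset_def qext_scalars_eq by blast
  have "dimension (Suc 0) ?K (line_extension ?K tt {\<zero>\<^bsub>A\<^esub>})"
    by (rule Suc_dim[OF qel_in_carrier _ zero_dim]) (simp add: qext_zero)
  moreover have "line_extension ?K tt {\<zero>\<^bsub>A\<^esub>} = ?T" unfolding line by (simp add: qext_zero)
  ultimately have T: "dimension (Suc 0) ?K ?T" by simp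
  have "el 0 1 \<alpha> 0 \<notin> ?T" by simp
  then have "dimension (Suc (Suc 0)) ?K (line_extension ?K (el 0 1 \<alpha> 0) ?T)"
    by (intro Suc_dim qel_in_carrier T)
  moreover have "line_extension ?K (el 0 1 \<alpha> 0) ?T = carrier (I \<alpha>)"
  proof -
    have "{sc c \<otimes>\<^bsub>A\<^esub> el 0 1 \<alpha> 0 \<oplus>\<^bsub>A\<^esub> e | c e. e \<in> ?T} = {el 0 c (c * \<alpha>) d | c d. True}"
    proof (intro equalityI subsetI)
      fix u assume "u \<in> {sc c \<otimes>\<^bsub>A\<^esub> el 0 1 \<alpha> 0 \<oplus>\<^bsub>A\<^esub> e | c e. e \<in> ?T}"
      then obtain c d where "u = sc c \<otimes>\<^bsub>A\<^esub> el 0 1 \<alpha> 0 \<oplus>\<^bsub>A\<^esub> el 0 0 0 d" by blast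
      then have "u = el 0 c (c * \<alpha>) d" by simp
      then show "u \<in> {el 0 c (c * \<alpha>) d | c d. True}" by blast
    next
      fix u assume "u \<in> {el 0 c (c * \<alpha>) d | c d. True}"
      then obtain c d where "u = el 0 c (c * \<alpha>) d" by blast
      then have "u = sc c \<otimes>\<^bsub>A\<^esub> el 0 1 \<alpha> 0 \<oplus>\<^bsub>A\<^esub> el 0 0 0 d" by simp
      then show "u \<in> {sc c \<otimes>\<^bsub>A\<^esub> el 0 1 \<alpha> 0 \<oplus>\<^bsub>A\<^esub> e | c e. e \<in> ?T}" by blast
    qed
    then show ?thesis unfolding line carrier_I .
  qed
  ultimately show ?thesis by (simp add: numeral_2_eq_2)
qed

text \<open>With \<open>j = i - 1\<close>, a shift by \<open>j\<close> reduces the claim to \<open>Ext\<^sup>1(I(1), I(\<beta>))\<close> with \<open>q\<^sup>j \<beta> = 1\<close>. The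
  cases \<open>\<beta> = 1\<close> and \<open>\<beta> = q\<close> would mean \<open>q\<^sup>j = 1\<close> and \<open>q\<^sup>j\<^sup>+\<^sup>1 = 1\<close>.\<close>
lemma Ext_self_zero:
  assumes ord: "\<forall>n::nat. n > 0 \<longrightarrow> q ^ n \<noteq> 1" and i: "i \<ge> 2"
  shows "Ext_zero A i (I 1) (I 1)"
proof -
  define j where "j = i - 1"
  have j: "j > 0" "i = Suc j" using i by (auto simp: j_def)
  define \<beta> where "\<beta> = 1 / q ^ j"
  have \<beta>: "q ^ j * \<beta> = 1" using q_nonzero by (simp add: \<beta>_def)
  have "\<beta> \<noteq> 1" using \<beta> ord j(1) by auto
  moreover have "\<beta> \<noteq> q * 1"
  proof
    assume "\<beta> = q * 1"
    then have "q ^ Suc j = 1" using \<beta> by (simp add: mult.commute)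
    then show False using ord by blast
  qed
  ultimately have "Ext_zero A (Suc j) (I 1) (I (q ^ j * \<beta>))" by (rule Ext_zero_of_shift)
  then show ?thesis unfolding \<beta> j(2) .
qed

end

theorem propositionA19:
  fixes q :: "'k::field"
  assumes "q \<noteq> 0"
    and "\<forall>n::nat. n > 0 \<longrightarrow> q ^ n \<noteq> 1"
  shows "\<exists>M :: ('k qext, 'k qext) module.
           M = principal_left_ideal (qext q) (qext_gen q gen_x \<oplus>\<^bsub>qext q\<^esub> qext_gen q gen_y) \<and>
           ring.dimension (qext q) 2 (qext_scalars q) (carrier M) \<and>
           indecomposable (qext q) M \<and>
           type_Z (mho_component (qext q) M) \<and>
           (\<forall>i\<ge>2. Ext_zero (qext q) i M M) \<and>
           \<not> Ext_zero (qext q) 1 M M"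
proof -
  interpret quantum_exterior q by unfold_locales (rule assms(1))
  have gen: "qext_gen q gen_x \<oplus>\<^bsub>qext q\<^esub> qext_gen q gen_y = el 0 1 1 0"
    by (simp add: qext_gen_x qext_gen_y)
  show ?thesis
    unfolding gen
  proof (intro exI[of _ "I 1"] conjI refl allI impI)
    show "Ext_zero A i (I 1) (I 1)" if "2 \<le> i" for i
      by (rule Ext_self_zero[OF assms(2) that])
  qed (rule dimension_I indecomposable_I type_Z_mho_component[OF assms(2)] Ext_self_first_nonzero)+
qed

end
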